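(* Let $d\ge 1$, let $\mathcal{H}$ be a $d$-dimensional complex Hilbert space with orthonormal basis $e_1,\ldots,e_d$, and let $T_{ij}^{kl}\in\mathbb{C}$ ($i,j,k,l=1,\ldots,d$) be coefficients with $T_{ij}^{kl}=\overline{T_{ji}^{lk}}$. Let $W(T)$ be the associated Wick algebra and $T\colon\mathcal{H}\otimes\mathcal{H}\to\mathcal{H}\otimes\mathcal{H}$, $T(e_k\otimes e_l)=\sum_{i,j}T_{ik}^{lj}\,e_i\otimes e_j$, the associated self-adjoint operator. Suppose that $T$ satisfies the braid condition $$(T\otimes 1)(1\otimes T)(T\otimes 1)=(1\otimes T)(T\otimes 1)(1\otimes T)\quad\text{on }\mathcal{H}^{\otimes 3},$$ and that $-1\le T\le 1$. Then the kernel of the Fock representation of $W(T)$ is generated as a $*$-ideal by $\ker(1+T)$; that is, it is the smallest two-sided ideal of $W(T)$ that is closed under the involution and contains $\ker(1+T)$, where $\ker(1+T)\subset\mathcal{H}\otimes\mathcal{H}\subset\mathcal{T}(\mathcal{H})$ is regarded as a subspace of $W(T)$ via $e_i\otimes e_j\leftrightarrow a_ia_j$.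
   Context: Wick algebra: $W(T)$ is the unital complex $*$-algebra generated by $a_1,\ldots,a_d$ (with adjoints $a_1^*,\ldots,a_d^*$) subject to the relations $$a_i^*a_j=\delta_{ij}1+\sum_{k,l=1}^d T_{ij}^{kl}\,a_l a_k^*,\qquad i,j=1,\ldots,d.$$ The subalgebra of $W(T)$ generated by $a_1,\ldots,a_d$ (and $1$) is identified with the full tensor algebra $\mathcal{T}(\mathcal{H})=\bigoplus_{n\ge 0}\mathcal{H}^{\otimes n}$ (algebraic direct sum, $\mathcal{H}^{\otimes 0}=\mathbb{C}1_{\mathrm{vac}}$), with $a_{i_1}\cdots a_{i_n}$ corresponding to $e_{i_1}\otimes\cdots\otimes e_{i_n}$. Fock action: $\lambda_0$ is the representation of the algebra $W(T)$ on $\mathcal{T}(\mathcal{H})$ determined by $$\lambda_0(a_i)\,e_{i_1}\otimes\cdots\otimes e_{i_n}=e_i\otimes e_{i_1}\otimes\cdots\otimes e_{i_n}\ (n\ge 0),\qquad \lambda_0(a_i^* )1_{\mathrm{vac}}=0,$$ where the action of $\lambda_0(a_i^* )$ on tensors of degree $n\ge 1$ is determined inductively from the defining relations of $W(T)$. Fock inner product: $\langle\cdot,\cdot\rangle_T$ is the unique sesquilinear Hermitian form on $\mathcal{T}(\mathcal{H})$ with $\langle 1_{\mathrm{vac}},1_{\mathrm{vac}}\rangle_T=1$ and $$\langle\lambda_0(a_i)X,Y\rangle_T=\langle X,\lambda_0(a_i^* )Y\rangle_T\quad\text{for all }X,Y\in\mathcal{T}(\mathcal{H}),\ i=1,\ldots,d.$$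 Tensors of different degrees are orthogonal for this form. It coincides with the standard inner product in degrees $0$ and $1$, and for $X,Y\in\mathcal{H}^{\otimes n}$, $n\ge 2$, it is given by $\langle X,Y\rangle_T=\langle X,P_nY\rangle$, where $\langle\cdot,\cdot\rangle$ is the standard inner product on $\mathcal{H}^{\otimes n}$ and, with $T_i$ denoting $T$ acting on the $i$-th and $(i+1)$-st tensor factors, $$R_n=1+T_1+T_1T_2+\cdots+T_1T_2\cdots T_{n-1},\qquad P_2=R_2,\qquad P_{n+1}=(1\otimes P_n)R_{n+1}.$$ Fock representation: let $\mathcal{I}=\bigoplus_{n\ge 2}\ker P_n\subset\mathcal{T}(\mathcal{H})$ be the kernel of the Fock inner product. It is invariant under $\lambda_0(a)$ for every $a\in W(T)$, so $\lambda_0$ induces a $*$-representation of $W(T)$ on the quotient $\mathcal{T}(\mathcal{H})/\mathcal{I}$ equipped with the inner product induced by $\langle\cdot,\cdot\rangle_T$. This is the Fock representation, and its kernel is $\{a\in W(T):\lambda_0(a)\mathcal{T}(\mathcal{H})\subset\mathcal{I}\}$. The inequality $-1\le T\le 1$ is in the sense of self-adjoint operators on $\mathcal{H}\otimes\mathcal{H}$. *)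

theory Defs
  imports
    Complex_Main
    "HOL-Library.Poly_Mapping"
    "HOL-Library.Nonpos_Ints"
    "HOL-Algebra.QuotRing"
begin

section \<open>Free complex algebras\<close>

text \<open>
  Words form a monoid under concatenation, so that \<open>'a list \<Rightarrow>\<^sub>0 complex\<close> with the convolution
  product of \<open>Poly_Mapping\<close> is the free unital complex algebra on \<open>'a\<close>.
\<close>

instantiation list :: (type) monoid_add
begin

definition zero_list :: "'a list" where "0 = []"
definition plus_list :: "'a list \<Rightarrow> 'a list \<Rightarrow> 'a list" where "v + w = v @ w"

instance by standard (simp_all add: zero_list_def plus_list_def)

end

definition word :: "'a list \<Rightarrow> ('a list \<Rightarrow>\<^sub>0 complex)" where
  "word w = Poly_Mapping.single w 1"

definition smul :: "complex \<Rightarrow> ('a list \<Rightarrow>\<^sub>0 complex) \<Rightarrow> ('a list \<Rightarrow>\<^sub>0 complex)" where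
  "smul c x = Poly_Mapping.single 0 c * x"

text \<open>Linear extension from the basis of words.\<close>

definition lin :: "('a list \<Rightarrow> ('b list \<Rightarrow>\<^sub>0 complex)) \<Rightarrow> ('a list \<Rightarrow>\<^sub>0 complex) \<Rightarrow> ('b list \<Rightarrow>\<^sub>0 complex)" where
  "lin f x = (\<Sum>w\<in>Poly_Mapping.keys x. smul (Poly_Mapping.lookup x w) (f w))"

definition free_alg :: "('a list \<Rightarrow>\<^sub>0 complex) ring" where
  "free_alg = \<lparr>carrier = UNIV, mult = (*), one = 1, zero = 0, add = (+)\<rparr>"

definition gen_star_ideal :: "('a, 'm) ring_scheme \<Rightarrow> ('a \<Rightarrow> 'a) \<Rightarrow> 'a set \<Rightarrow> 'a set" where
  "gen_star_ideal R s S = \<Inter>{I. ideal I R \<and> s ` I \<subseteq> I \<and> S \<subseteq> I}"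


section \<open>The Wick algebra\<close>

text \<open>
  The index type \<open>'n\<close> plays the role of \<open>{1, \<dots>, d}\<close>, and \<open>T i j k l\<close> stands for
  \<open>T\<^sub>i\<^sub>j\<^sup>k\<^sup>l\<close>. \<open>Cre i\<close> and \<open>Ann i\<close> stand for \<open>a\<^sub>i\<close> and \<open>a\<^sub>i\<^sup>*\<close>.
\<close>

type_synonym 'n coeffs = "'n \<Rightarrow> 'n \<Rightarrow> 'n \<Rightarrow> 'n \<Rightarrow> complex"

datatype 'n letter = Cre 'n | Ann 'n

type_synonym 'n free_star = "'n letter list \<Rightarrow>\<^sub>0 complex"

primrec adj :: "'n letter \<Rightarrow> 'n letter" where
  "adj (Cre i) = Ann i"
| "adj (Ann i) = Cre i"

definition star :: "'n free_star \<Rightarrow> 'n free_star" where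
  "star x = (\<Sum>w\<in>Poly_Mapping.keys x.
     Poly_Mapping.single (rev (map adj w)) (cnj (Poly_Mapping.lookup x w)))"

definition wick_relator :: "('n::finite) coeffs \<Rightarrow> 'n \<Rightarrow> 'n \<Rightarrow> 'n free_star" where
  "wick_relator T i j = word [Ann i] * word [Cre j] - (if i = j then 1 else 0)
     - (\<Sum>k\<in>UNIV. \<Sum>l\<in>UNIV. smul (T i j k l) (word [Cre l] * word [Ann k]))"

definition wick_ideal :: "('n::finite) coeffs \<Rightarrow> 'n free_star set" where
  "wick_ideal T = gen_star_ideal free_alg star {wick_relator T i j | i j. True}"

definition wick_algebra :: "('n::finite) coeffs \<Rightarrow> 'n free_star set ring" where
  "wick_algebra T = free_alg Quot wick_ideal T"

definition wick_class :: "('n::finite) coeffs \<Rightarrow> 'n free_star \<Rightarrow> 'n free_star set" where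
  "wick_class T x = wick_ideal T +>\<^bsub>free_alg\<^esub> x"

definition wick_star :: "'n free_star set \<Rightarrow> 'n free_star set" where
  "wick_star A = star ` A"


section \<open>The full tensor algebra and the Fock action\<close>

text \<open>
  The word \<open>[i\<^sub>1, \<dots>, i\<^sub>n]\<close> stands for \<open>e\<^sub>i\<^sub>1 \<otimes> \<cdots> \<otimes> e\<^sub>i\<^sub>n\<close>, so the product of \<open>'n tensors\<close> is the
  tensor product.
\<close>

type_synonym 'n tensors = "'n list \<Rightarrow>\<^sub>0 complex"

definition tensor_power :: "nat \<Rightarrow> 'n tensors set" where
  "tensor_power n = {X. \<forall>w\<in>Poly_Mapping.keys X. length w = n}"

definition homog :: "nat \<Rightarrow> 'n tensors \<Rightarrow> 'n tensors" where
  "homog n = lin (\<lambda>w. if length w = n then word w else 0)"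

text \<open>Antilinear in the first argument.\<close>

definition std_inner :: "'n tensors \<Rightarrow> 'n tensors \<Rightarrow> complex" where
  "std_inner X Y =
     (\<Sum>w\<in>Poly_Mapping.keys X. cnj (Poly_Mapping.lookup X w) * Poly_Mapping.lookup Y w)"

definition tensor_to_wick :: "('n::finite) coeffs \<Rightarrow> 'n tensors \<Rightarrow> 'n free_star set" where
  "tensor_to_wick T X = wick_class T (lin (\<lambda>w. word (map Cre w)) X)"

text \<open>
  The action of \<open>a\<^sub>i\<^sup>*\<close> on basis tensors; the recursion is
  \<open>a\<^sub>i\<^sup>* a\<^sub>j X = \<delta>\<^sub>i\<^sub>j X + \<Sum>\<^sub>k\<^sub>l T\<^sub>i\<^sub>j\<^sup>k\<^sup>l a\<^sub>l a\<^sub>k\<^sup>* X\<close>.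
\<close>

primrec ann_basis :: "('n::finite) coeffs \<Rightarrow> 'n list \<Rightarrow> 'n \<Rightarrow> 'n tensors" where
  "ann_basis T [] = (\<lambda>i. 0)"
| "ann_basis T (j # w) = (\<lambda>i. (if i = j then word w else 0)
     + (\<Sum>k\<in>UNIV. \<Sum>l\<in>UNIV. smul (T i j k l) (word [l] * ann_basis T w k)))"

primrec letter_action :: "('n::finite) coeffs \<Rightarrow> 'n letter \<Rightarrow> 'n tensors \<Rightarrow> 'n tensors" where
  "letter_action T (Cre i) = (\<lambda>X. word [i] * X)"
| "letter_action T (Ann i) = lin (\<lambda>w. ann_basis T w i)"

primrec word_action :: "('n::finite) coeffs \<Rightarrow> 'n letter list \<Rightarrow> 'n tensors \<Rightarrow> 'n tensors" where
  "word_action T [] = (\<lambda>X. X)"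
| "word_action T (g # w) = (\<lambda>X. letter_action T g (word_action T w X))"

definition free_action :: "('n::finite) coeffs \<Rightarrow> 'n free_star \<Rightarrow> 'n tensors \<Rightarrow> 'n tensors" where
  "free_action T x X = lin (\<lambda>w. word_action T w X) x"

text \<open>
  The Fock action of an element of the Wick algebra is that of any of its representatives; see
  \<open>fock_action_class\<close> below.
\<close>

definition fock_action :: "('n::finite) coeffs \<Rightarrow> 'n free_star set \<Rightarrow> 'n tensors \<Rightarrow> 'n tensors" where
  "fock_action T A = free_action T (SOME x. x \<in> A)"


section \<open>The operators \<open>T\<^sub>i\<close>, \<open>R\<^sub>n\<close>, \<open>P\<^sub>n\<close> and the Fock inner product\<close>

text \<open>
  \<open>leg T i\<close> (\<open>i \<ge> 1\<close>) is \<open>T\<close> acting on the tensor factors number \<open>i\<close> and \<open>i + 1\<close>, which are the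
  list positions \<open>i - 1\<close> and \<open>i\<close>; it is set to zero in degrees below \<open>i + 1\<close>.
\<close>

definition leg :: "('n::finite) coeffs \<Rightarrow> nat \<Rightarrow> 'n tensors \<Rightarrow> 'n tensors" where
  "leg T i = lin (\<lambda>w. if 1 \<le> i \<and> i < length w
     then \<Sum>a\<in>UNIV. \<Sum>b\<in>UNIV. smul (T a (w ! (i - 1)) (w ! i) b) (word (w[i - 1 := a, i := b]))
     else 0)"

primrec leg_prod :: "('n::finite) coeffs \<Rightarrow> nat \<Rightarrow> 'n tensors \<Rightarrow> 'n tensors" where
  "leg_prod T 0 = (\<lambda>X. X)"
| "leg_prod T (Suc m) = (\<lambda>X. leg_prod T m (leg T (Suc m) X))"

definition R_op :: "('n::finite) coeffs \<Rightarrow> nat \<Rightarrow> 'n tensors \<Rightarrow> 'n tensors" where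
  "R_op T n X = (\<Sum>m<n. leg_prod T m X)"

text \<open>\<open>1 \<otimes> A\<close>, set to zero in degree \<open>0\<close>.\<close>

definition one_tensor :: "('n tensors \<Rightarrow> 'n tensors) \<Rightarrow> 'n tensors \<Rightarrow> 'n tensors" where
  "one_tensor A = lin (\<lambda>w. case w of [] \<Rightarrow> 0 | i # v \<Rightarrow> word [i] * A (word v))"

text \<open>\<open>P_op T n\<close> is only meaningful in degree \<open>n\<close>, where it is the identity if
  \<open>n \<le> 1\<close>; hence \<open>P\<^sub>2 = (1 \<otimes> 1) R\<^sub>2 = R\<^sub>2\<close>.\<close>

primrec P_op :: "('n::finite) coeffs \<Rightarrow> nat \<Rightarrow> 'n tensors \<Rightarrow> 'n tensors" where
  "P_op T 0 = (\<lambda>X. X)"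
| "P_op T (Suc n) = (\<lambda>X. one_tensor (P_op T n) (R_op T (Suc n) X))"

definition fock_form :: "('n::finite) coeffs \<Rightarrow> 'n tensors \<Rightarrow> 'n tensors \<Rightarrow> complex" where
  "fock_form T X Y = std_inner X (lin (\<lambda>w. P_op T (length w) (word w)) Y)"

definition fock_null :: "('n::finite) coeffs \<Rightarrow> 'n tensors set" where
  "fock_null T = {X. homog 0 X = 0 \<and> homog 1 X = 0 \<and> (\<forall>n\<ge>2. P_op T n (homog n X) = 0)}"


section \<open>The Fock representation\<close>

definition fock_space :: "('n::finite) coeffs \<Rightarrow> 'n tensors set set" where
  "fock_space T = a_rcosets\<^bsub>free_alg\<^esub> (fock_null T)"

definition fock_rep :: "('n::finite) coeffs \<Rightarrow> 'n free_star set \<Rightarrow> 'n tensors set \<Rightarrow> 'n tensors set" where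
  "fock_rep T A C = (\<Union>X\<in>C. fock_null T +>\<^bsub>free_alg\<^esub> fock_action T A X)"

definition fock_kernel :: "('n::finite) coeffs \<Rightarrow> 'n free_star set set" where
  "fock_kernel T = {A \<in> carrier (wick_algebra T). \<forall>C\<in>fock_space T. fock_rep T A C = fock_null T}"


section \<open>Conditions on \<open>T\<close>\<close>

definition hermitian_coeffs :: "'n coeffs \<Rightarrow> bool" where
  "hermitian_coeffs T \<longleftrightarrow> (\<forall>i j k l. T i j k l = cnj (T j i l k))"

definition braided :: "('n::finite) coeffs \<Rightarrow> bool" where
  "braided T \<longleftrightarrow> (\<forall>X\<in>tensor_power 3.
     leg T 1 (leg T 2 (leg T 1 X)) = leg T 2 (leg T 1 (leg T 2 X)))"

text \<open>Order of self-adjoint operators on \<open>\<H> \<otimes> \<H>\<close>.\<close>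

definition op_le :: "('n tensors \<Rightarrow> 'n tensors) \<Rightarrow> ('n tensors \<Rightarrow> 'n tensors) \<Rightarrow> bool" where
  "op_le A B \<longleftrightarrow> (\<forall>X\<in>tensor_power 2. std_inner X (B X - A X) \<in> \<real>\<^sub>\<ge>\<^sub>0)"

definition ker_one_plus :: "('n::finite) coeffs \<Rightarrow> 'n tensors set" where
  "ker_one_plus T = {X \<in> tensor_power 2. X + leg T 1 X = 0}"

section \<open>Consistency of the definitions\<close>

text \<open>
  For hermitian coefficients the Fock action is well defined on the Wick algebra
  (\<open>fock_action_class\<close>); \<open>fock_form\<close> is the Hermitian form for which \<open>a\<^sub>i\<^sup>*\<close> is adjoint to \<open>a\<^sub>i\<close>
  (\<open>fock_form_vac\<close>, \<open>fock_form_adjoint\<close>, \<open>fock_form_hermitian\<close>); \<open>fock_null\<close> is its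
  kernel (\<open>fock_null_iff\<close>) and is invariant under the action, so that \<open>fock_rep\<close> is the induced
  representation on the quotient (\<open>fock_rep_coset\<close>, \<open>fock_kernel_eq\<close>).
\<close>

lemma lookup_smul: "Poly_Mapping.lookup (smul c x) w = c * Poly_Mapping.lookup x w"
  unfolding smul_def
  by (subst mult_map_scale_conv_mult[symmetric])
     (simp add: Poly_Mapping.map.rep_eq when_def)

lemma smul_simps [simp]:
  "smul c 0 = 0" "smul 0 x = 0" "smul 1 x = x"
  "smul c (x + y) = smul c x + smul c y" "smul (c + d) x = smul c x + smul d x"
  "smul c (smul d x) = smul (c * d) x" "smul c (x - y) = smul c x - smul c y"
  "smul c (- x) = - smul c x"
  by (auto intro!: poly_mapping_eqI simp: lookup_smul lookup_add lookup_minus algebra_simps)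

lemma smul_sum: "smul c (sum f A) = (\<Sum>a\<in>A. smul c (f a))"
  by (induction A rule: infinite_finite_induct) auto

lemma smul_mult_left: "smul c x * y = smul c (x * y)"
  by (simp add: smul_def mult.assoc)

lemma lin_superset:
  assumes "finite A" "Poly_Mapping.keys x \<subseteq> A"
  shows "lin f x = (\<Sum>w\<in>A. smul (Poly_Mapping.lookup x w) (f w))"
  unfolding lin_def using assms
  by (intro sum.mono_neutral_left) (auto simp: in_keys_iff)

lemma lin_add: "lin f (x + y) = lin f x + lin f y"
proof -
  let ?A = "Poly_Mapping.keys x \<union> Poly_Mapping.keys y"
  have "Poly_Mapping.keys (x + y) \<subseteq> ?A" by (rule keys_add)
  then show ?thesis
    by (simp add: lin_superset[of ?A] lookup_add sum.distrib)
qed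

lemma lin_smul: "lin f (smul c x) = smul c (lin f x)"
proof -
  have "Poly_Mapping.keys (smul c x) \<subseteq> Poly_Mapping.keys x"
    by (auto simp: in_keys_iff lookup_smul)
  then show ?thesis
    by (simp add: lin_superset[of "Poly_Mapping.keys x"] lookup_smul smul_sum)
qed

lemma lin_zero [simp]: "lin f 0 = 0"
  by (simp add: lin_def)

lemma lin_diff: "lin f (x - y) = lin f x - lin f y"
  by (metis lin_add add_diff_cancel_right' diff_add_cancel)

lemma lin_sum: "lin f (sum g A) = (\<Sum>a\<in>A. lin f (g a))"
  by (induction A rule: infinite_finite_induct) (auto simp: lin_add)

lemma lin_word [simp]: "lin f (word w) = f w"
  by (simp add: lin_def word_def)

lemma words_span: "x = (\<Sum>w\<in>Poly_Mapping.keys x. smul (Poly_Mapping.lookup x w) (word w))"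
  by (rule poly_mapping_eqI)
     (auto simp: lookup_sum lookup_smul word_def lookup_single when_def in_keys_iff
       if_distrib[of "\<lambda>z. _ * z"] sum.delta cong: if_cong)

lemma word_Nil: "word [] = 1"
  by (simp add: word_def flip: zero_list_def)

lemma word_append: "word (v @ w) = word v * word w"
  by (simp add: word_def mult_single plus_list_def)

lemma word_Cons: "word (i # w) = word [i] * word w"
  using word_append[of "[i]" w] by simp

lemma span_induct:
  assumes "P 0" "\<And>x y. P x \<Longrightarrow> P y \<Longrightarrow> P (x + y)" "\<And>c w. P (smul c (word w))"
  shows "P x"
proof -
  have "P (\<Sum>w\<in>A. smul (f w) (word w))" if "finite A" for A f
    using that by (induction A) (auto intro: assms)
  then show ?thesis using words_span[of x] by (metis finite_keys)
qed

lemma mult_smul_right: "x * smul c y = smul c (x * y)"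
proof -
  have "Poly_Mapping.single 0 c * x = x * Poly_Mapping.single 0 c"
    by (induction x rule: span_induct)
       (simp_all add: algebra_simps smul_def word_def mult_single)
  then show ?thesis unfolding smul_def by (metis mult.assoc)
qed

lemma star_eq: "star x = (\<Sum>w\<in>Poly_Mapping.keys x.
    smul (cnj (Poly_Mapping.lookup x w)) (word (rev (map adj w))))"
  by (simp add: star_def smul_def word_def mult_single)

lemma star_superset:
  assumes "finite A" "Poly_Mapping.keys x \<subseteq> A"
  shows "star x = (\<Sum>w\<in>A. smul (cnj (Poly_Mapping.lookup x w)) (word (rev (map adj w))))"
  unfolding star_eq using assms
  by (intro sum.mono_neutral_left) (auto simp: in_keys_iff)

lemma star_add: "star (x + y) = star x + star y"
proof -
  let ?A = "Poly_Mapping.keys x \<union> Poly_Mapping.keys y"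
  have "Poly_Mapping.keys (x + y) \<subseteq> ?A" by (rule keys_add)
  then show ?thesis
    by (simp add: star_superset[of ?A] lookup_add sum.distrib)
qed

lemma star_smul: "star (smul c x) = smul (cnj c) (star x)"
proof -
  have "Poly_Mapping.keys (smul c x) \<subseteq> Poly_Mapping.keys x"
    by (auto simp: in_keys_iff lookup_smul)
  then show ?thesis
    by (simp add: star_superset[of "Poly_Mapping.keys x"] lookup_smul smul_sum)
qed

lemma star_zero [simp]: "star 0 = 0"
  by (simp add: star_def)

lemma star_word [simp]: "star (word w) = word (rev (map adj w))"
  by (simp add: star_def word_def)

lemma star_one [simp]: "star 1 = 1"
  using star_word[of "[]"] by (simp add: word_Nil)

lemma star_diff: "star (x - y) = star x - star y"
  by (metis star_add add_diff_cancel_right' diff_add_cancel)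

lemma star_uminus: "star (- x) = - star x"
  using star_diff[of 0 x] by simp

lemma star_sum: "star (sum f A) = (\<Sum>a\<in>A. star (f a))"
  by (induction A rule: infinite_finite_induct) (auto simp: star_add)

lemma star_mult: "star (x * y) = star y * star x"
proof (induction x rule: span_induct)
  case (3 c v)
  show ?case
    by (induction y rule: span_induct)
       (simp_all add: star_add star_smul smul_mult_left mult_smul_right algebra_simps
         flip: word_append)
qed (simp_all add: star_add algebra_simps)

lemma adj_adj [simp]: "adj (adj g) = g"
  by (cases g) auto

lemma star_star [simp]: "star (star x) = x"
  by (induction x rule: span_induct)
     (simp_all add: star_add star_smul rev_map comp_def)

lemma ring_free_alg: "ring free_alg"
  by (rule ringI; (rule abelian_groupI monoidI)?)
     (auto simp: free_alg_def algebra_simps intro: exI[of _ "- x" for x] dest: minus_unique)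

lemma free_alg_simps [simp]:
  "carrier free_alg = UNIV" "x \<otimes>\<^bsub>free_alg\<^esub> y = x * y" "x \<oplus>\<^bsub>free_alg\<^esub> y = x + y"
  "\<one>\<^bsub>free_alg\<^esub> = 1" "\<zero>\<^bsub>free_alg\<^esub> = 0"
  by (simp_all add: free_alg_def)

lemma a_inv_free_alg [simp]: "\<ominus>\<^bsub>free_alg\<^esub> x = - x"
proof -
  interpret ring free_alg by (rule ring_free_alg)
  show ?thesis by (rule minus_equality) auto
qed

lemma ideal_free_algI:
  fixes I :: "('a list \<Rightarrow>\<^sub>0 complex) set"
  assumes "0 \<in> I" "\<And>x y. x \<in> I \<Longrightarrow> y \<in> I \<Longrightarrow> x + y \<in> I"
    "\<And>x y. x \<in> I \<Longrightarrow> y * x \<in> I" "\<And>x y. x \<in> I \<Longrightarrow> x * y \<in> I"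
  shows "ideal I free_alg"
proof (rule idealI[OF ring_free_alg])
  have neg: "- x \<in> I" if "x \<in> I" for x
    using assms(3)[OF that, of "- 1"] by simp
  show "subgroup I (add_monoid free_alg)"
  proof (rule group.subgroupI)
    show "group (add_monoid free_alg)"
      using ring.is_abelian_group[OF ring_free_alg] abelian_group.a_group by blast
    show "I \<noteq> {}" using assms(1) by blast
    show "inv\<^bsub>add_monoid free_alg\<^esub> x \<in> I" if "x \<in> I" for x
      using neg[OF that] unfolding a_inv_free_alg[of x, unfolded a_inv_def] .
    show "x \<otimes>\<^bsub>add_monoid free_alg\<^esub> y \<in> I" if "x \<in> I" "y \<in> I" for x y
      using assms(2)[OF that] by (simp add: free_alg_def)
  qed (simp add: free_alg_def)
next
  fix a x :: "'a list \<Rightarrow>\<^sub>0 complex" assume "a \<in> I" "x \<in> carrier free_alg"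
  then show "x \<otimes>\<^bsub>free_alg\<^esub> a \<in> I" "a \<otimes>\<^bsub>free_alg\<^esub> x \<in> I"
    using assms(3,4)[OF \<open>a \<in> I\<close>, of x] by simp_all
qed

lemma (in ring) gen_star_ideal_ideal:
  assumes "S \<subseteq> carrier R" "s ` carrier R \<subseteq> carrier R"
  shows "ideal (gen_star_ideal R s S) R"
  unfolding gen_star_ideal_def
  by (rule i_Intersect) (use assms oneideal in auto)

lemma gen_star_ideal_closed: "x \<in> gen_star_ideal R s S \<Longrightarrow> s x \<in> gen_star_ideal R s S"
  unfolding gen_star_ideal_def by auto

lemma gen_star_ideal_gen: "S \<subseteq> gen_star_ideal R s S"
  unfolding gen_star_ideal_def by auto

lemma gen_star_ideal_least: "ideal I R \<Longrightarrow> s ` I \<subseteq> I \<Longrightarrow> S \<subseteq> I \<Longrightarrow> gen_star_ideal R s S \<subseteq> I"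
  unfolding gen_star_ideal_def by auto

lemma wick_ideal: "ideal (wick_ideal T) free_alg"
  unfolding wick_ideal_def by (rule ring.gen_star_ideal_ideal[OF ring_free_alg]) auto

lemma wick_ideal_star: "x \<in> wick_ideal T \<Longrightarrow> star x \<in> wick_ideal T"
  unfolding wick_ideal_def by (rule gen_star_ideal_closed)

lemma ring_wick_algebra: "ring (wick_algebra T)"
  unfolding wick_algebra_def by (rule ideal.quotient_is_ring[OF wick_ideal])

lemma wick_class_eq: "wick_class T x = {z + x | z. z \<in> wick_ideal T}"
  by (auto simp: wick_class_def a_r_coset_def r_coset_def free_alg_def)

lemma carrier_wick_algebra: "carrier (wick_algebra T) = range (wick_class T)"
  by (auto simp: wick_algebra_def wick_class_def FactRing_def A_RCOSETS_def RCOSETS_def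
      a_r_coset_def free_alg_def)

lemma wick_star_class: "wick_star (wick_class T x) = wick_class T (star x)"
proof -
  have "z + star x \<in> star ` {z + x |z. z \<in> wick_ideal T}" if "z \<in> wick_ideal T" for z
    using that wick_ideal_star[OF that]
    by (intro image_eqI[of _ _ "star z + x"]) (auto simp: star_add)
  then show ?thesis
    by (auto simp: wick_star_def wick_class_eq star_add dest: wick_ideal_star)
qed

lemma star_relator: "hermitian_coeffs T \<Longrightarrow> star (wick_relator T i j) = wick_relator T j i"
proof -
  assume "hermitian_coeffs T"
  then have h: "cnj (T i j k l) = T j i l k" for k l
    unfolding hermitian_coeffs_def by (metis complex_cnj_cnj)
  have "(\<Sum>k\<in>UNIV. \<Sum>l\<in>UNIV. smul (cnj (T i j k l)) (word [Cre k] * word [Ann l]))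
      = (\<Sum>k\<in>UNIV. \<Sum>l\<in>UNIV. smul (T j i k l) (word [Cre l] * word [Ann k]))"
    by (subst sum.swap) (simp add: h)
  then show ?thesis
    by (simp add: wick_relator_def star_diff star_sum star_smul star_mult)
qed

lemma letter_action_add: "letter_action T g (X + Y) = letter_action T g X + letter_action T g Y"
  by (cases g) (simp_all add: lin_add algebra_simps)

lemma letter_action_smul: "letter_action T g (smul c X) = smul c (letter_action T g X)"
  by (cases g) (simp_all add: lin_smul mult_smul_right)

lemma word_action_add: "word_action T w (X + Y) = word_action T w X + word_action T w Y"
  by (induction w) (simp_all add: letter_action_add)

lemma word_action_smul: "word_action T w (smul c X) = smul c (word_action T w X)"
  by (induction w) (simp_all add: letter_action_smul)

lemma word_action_append: "word_action T (v @ w) X = word_action T v (word_action T w X)"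
  by (induction v) simp_all

lemma free_action_add_left: "free_action T (x + y) X = free_action T x X + free_action T y X"
  by (simp add: free_action_def lin_add)

lemma free_action_diff_left: "free_action T (x - y) X = free_action T x X - free_action T y X"
  by (simp add: free_action_def lin_diff)

lemma free_action_sum_left: "free_action T (sum f A) X = (\<Sum>a\<in>A. free_action T (f a) X)"
  by (simp add: free_action_def lin_sum)

lemma free_action_smul_left: "free_action T (smul c x) X = smul c (free_action T x X)"
  by (simp add: free_action_def lin_smul)

lemma free_action_zero_left [simp]: "free_action T 0 X = 0"
  by (simp add: free_action_def)

lemma free_action_word [simp]: "free_action T (word w) X = word_action T w X"
  by (simp add: free_action_def)

lemma free_action_one [simp]: "free_action T 1 X = X"
  by (simp flip: word_Nil)

lemma free_action_add: "free_action T x (X + Y) = free_action T x X + free_action T x Y"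
  by (simp add: free_action_def lin_def word_action_add sum.distrib)

lemma free_action_smul: "free_action T x (smul c X) = smul c (free_action T x X)"
  by (simp add: free_action_def lin_def word_action_smul smul_sum mult.commute)

lemma free_action_zero [simp]: "free_action T x 0 = 0"
  using free_action_smul[of T x 0 0] by simp

lemma free_action_mult: "free_action T (x * y) X = free_action T x (free_action T y X)"
proof (induction y rule: span_induct)
  case (3 c w)
  show ?case
    by (induction x rule: span_induct)
       (simp_all add: free_action_add_left free_action_smul_left free_action_smul
         smul_mult_left mult_smul_right word_action_append algebra_simps flip: word_append)
qed (simp_all add: free_action_add_left free_action_add distrib_left)

lemma free_action_relator: "free_action T (wick_relator T i j) X = 0"
proof (induction X rule: span_induct)
  case (3 c w)
  have 1: "lin (\<lambda>w. ann_basis T w i) (word [j] * word w) = ann_basis T (j # w) i"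
    by (subst word_append[symmetric]) simp
  have "free_action T (wick_relator T i j) (word w) = 0"
    by (simp add: wick_relator_def free_action_diff_left free_action_sum_left
      free_action_smul_left free_action_mult 1)
  then show ?case by (simp add: free_action_smul)
qed (simp_all add: free_action_add)

lemma free_action_wick_ideal:
  assumes "hermitian_coeffs T" "x \<in> wick_ideal T"
  shows "free_action T x X = 0"
proof -
  let ?I = "{x. \<forall>X. free_action T x X = 0 \<and> free_action T (star x) X = 0}"
  have "ideal ?I free_alg"
    by (rule ideal_free_algI)
       (simp_all add: free_action_add_left free_action_mult star_add star_mult)
  moreover have "star ` ?I \<subseteq> ?I" by auto
  moreover have "{wick_relator T i j | i j. True} \<subseteq> ?I"
    using assms(1) by (auto simp: free_action_relator star_relator)
  ultimately have "wick_ideal T \<subseteq> ?I"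
    unfolding wick_ideal_def by (rule gen_star_ideal_least)
  then show ?thesis using assms(2) by auto
qed

lemma fock_action_class:
  assumes "hermitian_coeffs T"
  shows "fock_action T (wick_class T x) X = free_action T x X"
proof -
  have "0 + x \<in> wick_class T x"
    unfolding wick_class_eq using additive_subgroup.zero_closed[OF ideal.axioms(1)[OF wick_ideal]]
    by force
  then have "(SOME y. y \<in> wick_class T x) \<in> wick_class T x" by (rule someI)
  then show ?thesis
    using free_action_wick_ideal[OF assms]
    by (auto simp: fock_action_def wick_class_eq free_action_add_left)
qed

lemma std_inner_superset:
  assumes "finite A" "Poly_Mapping.keys X \<subseteq> A"
  shows "std_inner X Y = (\<Sum>w\<in>A. cnj (Poly_Mapping.lookup X w) * Poly_Mapping.lookup Y w)"
  unfolding std_inner_def using assms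
  by (intro sum.mono_neutral_left) (auto simp: in_keys_iff)

lemma std_inner_word: "std_inner (word w) Y = Poly_Mapping.lookup Y w"
  by (simp add: std_inner_def word_def)

lemma std_inner_add_left: "std_inner (X + Y) Z = std_inner X Z + std_inner Y Z"
proof -
  let ?A = "Poly_Mapping.keys X \<union> Poly_Mapping.keys Y"
  have "Poly_Mapping.keys (X + Y) \<subseteq> ?A" by (rule keys_add)
  then show ?thesis
    by (simp add: std_inner_superset[of ?A] lookup_add sum.distrib algebra_simps)
qed

lemma std_inner_smul_left: "std_inner (smul c X) Z = cnj c * std_inner X Z"
proof -
  have "Poly_Mapping.keys (smul c X) \<subseteq> Poly_Mapping.keys X"
    by (auto simp: in_keys_iff lookup_smul)
  then show ?thesis
    by (simp add: std_inner_superset[of "Poly_Mapping.keys X"] lookup_smul sum_distrib_left mult.assoc)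
qed

lemma std_inner_add_right: "std_inner Z (X + Y) = std_inner Z X + std_inner Z Y"
  by (simp add: std_inner_def lookup_add sum.distrib algebra_simps)

lemma std_inner_smul_right: "std_inner Z (smul c X) = c * std_inner Z X"
  by (simp add: std_inner_def lookup_smul sum_distrib_left mult_ac)

lemma std_inner_zero_left [simp]: "std_inner 0 X = 0"
  by (simp add: std_inner_def)

lemma std_inner_zero_right [simp]: "std_inner X 0 = 0"
  by (simp add: std_inner_def)

lemma leg_add: "leg T i (X + Y) = leg T i X + leg T i Y"
  by (simp add: leg_def lin_add)

lemma leg_smul: "leg T i (smul c X) = smul c (leg T i X)"
  by (simp add: leg_def lin_smul)

lemma leg_zero [simp]: "leg T i 0 = 0"
  by (simp add: leg_def)

lemma leg_sum: "leg T i (sum f A) = (\<Sum>a\<in>A. leg T i (f a))"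
  by (simp add: leg_def lin_sum)

lemma leg_prod_add: "leg_prod T m (X + Y) = leg_prod T m X + leg_prod T m Y"
  by (induction m arbitrary: X Y) (simp_all add: leg_add)

lemma leg_prod_smul: "leg_prod T m (smul c X) = smul c (leg_prod T m X)"
  by (induction m arbitrary: X) (simp_all add: leg_smul)

lemma leg_prod_zero [simp]: "leg_prod T m 0 = 0"
  by (induction m) simp_all

lemma R_op_add: "R_op T n (X + Y) = R_op T n X + R_op T n Y"
  by (simp add: R_op_def leg_prod_add sum.distrib)

lemma R_op_smul: "R_op T n (smul c X) = smul c (R_op T n X)"
  by (simp add: R_op_def leg_prod_smul smul_sum)

lemma R_op_zero [simp]: "R_op T n 0 = 0"
  by (simp add: R_op_def)

lemma one_tensor_word [simp]:
  "one_tensor A (word []) = 0" "one_tensor A (word (i # v)) = word [i] * A (word v)"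
  by (simp_all add: one_tensor_def)

lemma one_tensor_add: "one_tensor A (X + Y) = one_tensor A X + one_tensor A Y"
  by (simp add: one_tensor_def lin_add)

lemma one_tensor_smul: "one_tensor A (smul c X) = smul c (one_tensor A X)"
  by (simp add: one_tensor_def lin_smul)

lemma one_tensor_zero [simp]: "one_tensor A 0 = 0"
  by (simp add: one_tensor_def)

lemma P_op_add: "P_op T n (X + Y) = P_op T n X + P_op T n Y"
  by (induction n arbitrary: X Y) (simp_all add: R_op_add one_tensor_add)

lemma P_op_smul: "P_op T n (smul c X) = smul c (P_op T n X)"
  by (induction n arbitrary: X) (simp_all add: R_op_smul one_tensor_smul)

lemma P_op_zero [simp]: "P_op T n 0 = 0"
  by (induction n) simp_all

lemma P_op_sum: "P_op T n (sum f A) = (\<Sum>a\<in>A. P_op T n (f a))"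
  by (induction A rule: infinite_finite_induct) (simp_all add: P_op_add del: P_op.simps)

text \<open>Contraction of the first tensor factor with \<open>e\<^sub>i\<close>.\<close>

definition contr :: "'n \<Rightarrow> 'n tensors \<Rightarrow> 'n tensors" where
  "contr i = lin (\<lambda>w. case w of [] \<Rightarrow> 0 | j # v \<Rightarrow> if i = j then word v else 0)"

lemma contr_add: "contr i (X + Y) = contr i X + contr i Y"
  by (simp add: contr_def lin_add)

lemma contr_smul: "contr i (smul c X) = smul c (contr i X)"
  by (simp add: contr_def lin_smul)

lemma contr_zero [simp]: "contr i 0 = 0"
  by (simp add: contr_def)

lemma contr_sum: "contr i (sum f A) = (\<Sum>a\<in>A. contr i (f a))"
  by (simp add: contr_def lin_sum)

lemma contr_word [simp]:
  "contr i (word []) = 0" "contr i (word (j # v)) = (if i = j then word v else 0)"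
  by (simp_all add: contr_def)

lemma contr_Cons: "contr i (word [j] * X) = (if i = j then X else 0)"
  by (induction X rule: span_induct)
     (simp_all add: contr_add contr_smul algebra_simps mult_smul_right flip: word_Cons)

lemma lookup_Cons: "Poly_Mapping.lookup X (i # v) = Poly_Mapping.lookup (contr i X) v"
proof (induction X rule: span_induct)
  case (3 c w)
  then show ?case
    by (cases w) (auto simp: contr_smul lookup_smul, auto simp: word_def lookup_single when_def)
qed (simp_all add: contr_add lookup_add)

lemma leg_Cons: "0 < i \<Longrightarrow> leg T (Suc i) (word [j] * X) = word [j] * leg T i X"
proof (induction X rule: span_induct)
  case (3 c w)
  then obtain m where i: "i = Suc m" by (cases i) auto
  show ?case
    by (simp add: leg_def lin_smul mult_smul_right sum_distrib_left i flip: word_Cons)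
qed (simp_all add: leg_add algebra_simps)

lemma leg_prod_Cons:
  "leg_prod T (Suc m) (word [j] * X) = leg T 1 (word [j] * leg_prod T m X)"
proof (induction m arbitrary: X)
  case (Suc m)
  have "leg_prod T (Suc (Suc m)) (word [j] * X)
      = leg_prod T (Suc m) (word [j] * leg T (Suc m) X)"
    by (simp only: leg_prod.simps leg_Cons zero_less_Suc)
  then show ?case using Suc by simp
qed simp

lemma R_op_Cons:
  "R_op T (Suc n) (word [j] * X) = word [j] * X + leg T 1 (word [j] * R_op T n X)"
  unfolding R_op_def
  by (simp add: sum.lessThan_Suc_shift leg_prod_Cons sum_distrib_left leg_sum
      del: leg_prod.simps(2) sum.lessThan_Suc)

lemma contr_leg:
  "contr i (leg T 1 (word [j] * X))
    = (\<Sum>k\<in>UNIV. \<Sum>l\<in>UNIV. smul (T i j k l) (word [l] * contr k X))"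
proof (induction X rule: span_induct)
  case (3 c w)
  show ?case
  proof (cases w)
    case (Cons m v)
    have L: "leg T 1 (word [j] * word w) = (\<Sum>a\<in>UNIV. \<Sum>b\<in>UNIV. smul (T a j m b) (word (a # b # v)))"
      by (simp add: leg_def Cons flip: word_Cons)
    have "contr i (leg T 1 (word [j] * word w)) = (\<Sum>b\<in>UNIV. smul (T i j m b) (word (b # v)))"
    proof -
      have "contr i (leg T 1 (word [j] * word w))
          = (\<Sum>a\<in>UNIV. \<Sum>b\<in>UNIV. smul (T a j m b) (if i = a then word (b # v) else 0))"
        unfolding L by (simp only: contr_sum contr_smul contr_word)
      also have "\<dots> = (\<Sum>a\<in>UNIV. if i = a then \<Sum>b\<in>UNIV. smul (T i j m b) (word (b # v)) else 0)"
        by (intro sum.cong) auto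
      finally show ?thesis by simp
    qed
    moreover have "(\<Sum>k\<in>UNIV. \<Sum>l\<in>UNIV. smul (T i j k l) (word [l] * contr k (word w)))
        = (\<Sum>l\<in>UNIV. smul (T i j m l) (word (l # v)))"
    proof -
      have "(\<Sum>k\<in>UNIV. \<Sum>l\<in>UNIV. smul (T i j k l) (word [l] * contr k (word w)))
        = (\<Sum>k\<in>UNIV. if m = k then \<Sum>l\<in>UNIV. smul (T i j m l) (word (l # v)) else 0)"
        unfolding Cons contr_word by (intro sum.cong) (auto simp flip: word_Cons)
      then show ?thesis by simp
    qed
    ultimately have *: "contr i (leg T 1 (word [j] * word w))
        = (\<Sum>k\<in>UNIV. \<Sum>l\<in>UNIV. smul (T i j k l) (word [l] * contr k (word w)))"
      by simp
    have "smul (T i j k l) (word [l] * contr k (smul c (word w)))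
        = smul c (smul (T i j k l) (word [l] * contr k (word w)))" for k l
      by (simp add: contr_smul mult_smul_right mult.commute)
    then show ?thesis
      by (simp only: mult_smul_right leg_smul contr_smul[of i] * smul_sum)
  next
    case Nil
    have "leg T 1 (word [j]) = 0" by (simp add: leg_def)
    then have "leg T 1 (word [j] * word w) = 0" by (simp add: Nil word_Nil)
    then show ?thesis by (simp add: mult_smul_right leg_smul contr_smul Nil)
  qed
qed (simp_all add: leg_add contr_add algebra_simps sum.distrib)

lemma contr_R_op: "contr i (R_op T (length w) (word w)) = ann_basis T w i"
proof (induction w arbitrary: i)
  case (Cons j w)
  show ?case
    by (simp only: length_Cons word_Cons[of j w] R_op_Cons contr_add contr_leg contr_Cons Cons
        ann_basis.simps)
qed (simp add: R_op_def)

lemma tensor_power_smul: "X \<in> tensor_power n \<Longrightarrow> smul c X \<in> tensor_power n"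
  by (auto simp: tensor_power_def in_keys_iff lookup_smul)

lemma tensor_power_add: "X \<in> tensor_power n \<Longrightarrow> Y \<in> tensor_power n \<Longrightarrow> X + Y \<in> tensor_power n"
  using keys_add[of X Y] by (auto simp: tensor_power_def)

lemma tensor_power_zero [simp]: "0 \<in> tensor_power n"
  by (auto simp: tensor_power_def)

lemma tensor_power_sum:
  "(\<And>a. a \<in> A \<Longrightarrow> f a \<in> tensor_power n) \<Longrightarrow> sum f A \<in> tensor_power n"
  by (induction A rule: infinite_finite_induct) (auto intro: tensor_power_add)

lemma tensor_power_word: "length w = n \<Longrightarrow> word w \<in> tensor_power n"
  by (auto simp: tensor_power_def word_def)

lemma tensor_power_lin:
  "X \<in> tensor_power m \<Longrightarrow> (\<And>w. length w = m \<Longrightarrow> f w \<in> tensor_power n) \<Longrightarrow> lin f X \<in> tensor_power n"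
  unfolding lin_def by (intro tensor_power_sum tensor_power_smul) (auto simp: tensor_power_def)

lemma tensor_power_Cons: "X \<in> tensor_power n \<Longrightarrow> word [l] * X \<in> tensor_power (Suc n)"
  using keys_mult[of "word [l]" X]
  by (fastforce simp: tensor_power_def word_def plus_list_def split: if_splits)

lemma ann_basis_power: "ann_basis T w i \<in> tensor_power (length w - 1)"
proof (induction w arbitrary: i)
  case (Cons j w)
  have "word [l] * ann_basis T w k \<in> tensor_power (length w)" for k l
    using tensor_power_Cons[OF Cons, of l k] by (cases w) auto
  then show ?case
    by (auto intro!: tensor_power_add tensor_power_sum tensor_power_smul tensor_power_word)
qed simp

lemma leg_power: "X \<in> tensor_power n \<Longrightarrow> leg T i X \<in> tensor_power n"
  unfolding leg_def
  by (rule tensor_power_lin)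
     (auto intro!: tensor_power_sum tensor_power_smul tensor_power_word)

lemma leg_prod_power: "X \<in> tensor_power n \<Longrightarrow> leg_prod T m X \<in> tensor_power n"
  by (induction m arbitrary: X) (auto intro: leg_power)

lemma R_op_power: "X \<in> tensor_power n \<Longrightarrow> R_op T m X \<in> tensor_power n"
  unfolding R_op_def by (intro tensor_power_sum leg_prod_power)

lemma P_op_power: "X \<in> tensor_power n \<Longrightarrow> P_op T n X \<in> tensor_power n"
proof (induction n arbitrary: X)
  case (Suc n)
  have "one_tensor (P_op T n) Y \<in> tensor_power (Suc n)" if "Y \<in> tensor_power (Suc n)" for Y
    unfolding one_tensor_def using that
    by (rule tensor_power_lin)
       (auto split: list.split intro!: tensor_power_Cons Suc.IH tensor_power_word)
  then show ?case using R_op_power[OF Suc.prems, of T "Suc n"] by simp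
qed simp

definition P_total :: "('n::finite) coeffs \<Rightarrow> 'n tensors \<Rightarrow> 'n tensors" where
  "P_total T = lin (\<lambda>w. P_op T (length w) (word w))"

lemma P_total_power:
  assumes "X \<in> tensor_power n"
  shows "P_total T X = P_op T n X"
proof -
  have "P_total T X = (\<Sum>w\<in>Poly_Mapping.keys X. P_op T n (smul (Poly_Mapping.lookup X w) (word w)))"
    using assms by (simp add: P_total_def lin_def tensor_power_def P_op_smul cong: sum.cong)
  also have "\<dots> = P_op T n (\<Sum>w\<in>Poly_Mapping.keys X. smul (Poly_Mapping.lookup X w) (word w))"
    by (simp add: P_op_sum)
  finally show ?thesis by (simp flip: words_span)
qed

lemma contr_one_tensor: "contr i (one_tensor (P_op T n) X) = P_op T n (contr i X)"
proof (induction X rule: span_induct)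
  case (3 c w)
  show ?case
    by (cases w) (auto simp: one_tensor_smul contr_smul P_op_smul contr_Cons
        simp del: P_op.simps)
qed (simp_all add: one_tensor_add contr_add P_op_add)

lemma contr_P_total: "contr i (P_total T Y) = P_total T (lin (\<lambda>w. ann_basis T w i) Y)"
proof (induction Y rule: span_induct)
  case (3 c w)
  have "contr i (P_total T (word w)) = P_total T (ann_basis T w i)"
  proof (cases w)
    case Nil
    then show ?thesis by (simp add: P_total_def contr_def)
  next
    case (Cons j v)
    have "contr i (P_total T (word w)) = P_op T (length v) (contr i (R_op T (length w) (word w)))"
      by (simp add: P_total_def Cons contr_one_tensor)
    also have "\<dots> = P_total T (ann_basis T w i)"
      unfolding contr_R_op using P_total_power[OF ann_basis_power[of T w i], of T] Cons by simp
    finally show ?thesis .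
  qed
  then show ?case by (simp add: P_total_def lin_smul contr_smul)
qed (simp_all add: P_total_def lin_add contr_add)

lemma fock_form_vac: "fock_form T 1 1 = 1"
  by (simp add: fock_form_def std_inner_word flip: word_Nil) (simp add: word_def)

lemma fock_form_adjoint:
  "fock_form T (letter_action T (Cre i) X) Y = fock_form T X (letter_action T (Ann i) Y)"
proof (induction X rule: span_induct)
  case (3 c w)
  show ?case
    by (simp add: fock_form_def mult_smul_right std_inner_smul_left lookup_Cons std_inner_word
        contr_P_total[unfolded P_total_def] flip: word_Cons)
qed (simp_all add: fock_form_def algebra_simps std_inner_add_left)

lemma homog_power: "homog n X \<in> tensor_power n"
proof -
  have "lin (\<lambda>w. if length w = n then word w else 0) X \<in> tensor_power n"
    unfolding lin_def
    by (intro tensor_power_sum tensor_power_smul) (auto intro: tensor_power_word)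
  then show ?thesis by (simp add: homog_def)
qed

lemma homog_of_power: "X \<in> tensor_power m \<Longrightarrow> homog n X = (if m = n then X else 0)"
  by (subst (2) words_span) (auto simp: homog_def lin_def tensor_power_def)

lemma homog_P_total: "homog n (P_total T X) = P_op T n (homog n X)"
proof (induction X rule: span_induct)
  case (3 c w)
  have "homog n (P_op T (length w) (word w)) = P_op T n (homog n (word w))"
    using homog_of_power[OF P_op_power[OF tensor_power_word[OF refl]], of n T w]
      homog_of_power[OF tensor_power_word[OF refl], of n w]
    by auto
  then show ?case by (simp add: P_total_def lin_smul homog_def P_op_smul)
qed (simp_all add: P_total_def homog_def lin_add P_op_add)

lemma lookup_homog: "Poly_Mapping.lookup (homog n X) w = (if length w = n then Poly_Mapping.lookup X w else 0)"
proof (induction X rule: span_induct)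
  case (3 c v)
  then show ?case
    by (auto simp: homog_def lin_smul lookup_smul) (auto simp: word_def lookup_single when_def split: if_splits)
qed (simp_all add: homog_def lin_add lookup_add)

lemma P_op_le_1: "n \<le> 1 \<Longrightarrow> P_op T n (homog n X) = homog n X"
proof -
  assume n: "n \<le> 1"
  have "P_op T n (word w) = word w" if "length w = n" for w
    using n that
    by (cases n; cases w) (auto simp: R_op_def one_tensor_def word_Nil)
  then have "P_op T n (homog n X) = homog n X"
  proof (induction X rule: span_induct)
    case (3 c w)
    then show ?case by (auto simp: homog_def lin_smul P_op_smul)
  qed (simp_all add: homog_def lin_add P_op_add)
  then show ?thesis .
qed

lemma fock_null_iff: "Y \<in> fock_null T \<longleftrightarrow> (\<forall>X. fock_form T X Y = 0)"
proof -
  have "(\<forall>X. fock_form T X Y = 0) \<longleftrightarrow> P_total T Y = 0"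
    unfolding fock_form_def P_total_def[symmetric]
    by (metis std_inner_zero_right std_inner_word lookup_zero poly_mapping_eqI)
  also have "\<dots> \<longleftrightarrow> (\<forall>n. homog n (P_total T Y) = 0)"
    by (auto simp: poly_mapping_eq_iff fun_eq_iff lookup_homog)
  also have "\<dots> \<longleftrightarrow> (\<forall>n. P_op T n (homog n Y) = 0)"
    by (simp add: homog_P_total)
  also have "\<dots> \<longleftrightarrow> Y \<in> fock_null T"
  proof
    assume *: "\<forall>n. P_op T n (homog n Y) = 0"
    then show "Y \<in> fock_null T"
      using P_op_le_1[of 0 T Y] P_op_le_1[of 1 T Y] unfolding fock_null_def
      by (simp del: P_op.simps One_nat_def)
  next
    assume *: "Y \<in> fock_null T"
    have "P_op T n (homog n Y) = 0" for n
      using * P_op_le_1[of n T Y] by (cases "n = 0 \<or> n = 1") (auto simp: fock_null_def simp del: P_op.simps)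
    then show "\<forall>n. P_op T n (homog n Y) = 0" by blast
  qed
  finally show ?thesis by blast
qed

lemma fock_form_add_left: "fock_form T (X + Y) Z = fock_form T X Z + fock_form T Y Z"
  by (simp add: fock_form_def std_inner_add_left)

lemma fock_form_smul_left: "fock_form T (smul c X) Z = cnj c * fock_form T X Z"
  by (simp add: fock_form_def std_inner_smul_left)

lemma fock_form_add_right: "fock_form T Z (X + Y) = fock_form T Z X + fock_form T Z Y"
  by (simp add: fock_form_def lin_add std_inner_add_right)

lemma fock_form_smul_right: "fock_form T Z (smul c X) = c * fock_form T Z X"
  by (simp add: fock_form_def lin_smul std_inner_smul_right)

lemma fock_form_zero [simp]: "fock_form T 0 X = 0" "fock_form T X 0 = 0"
  by (simp_all add: fock_form_def)

lemma fock_form_sum_left: "fock_form T (sum f A) Z = (\<Sum>a\<in>A. fock_form T (f a) Z)"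
  by (induction A rule: infinite_finite_induct) (simp_all add: fock_form_add_left)

lemma fock_form_sum_right: "fock_form T Z (sum f A) = (\<Sum>a\<in>A. fock_form T Z (f a))"
  by (induction A rule: infinite_finite_induct) (simp_all add: fock_form_add_right)

lemma fock_form_homog:
  assumes "Y \<in> tensor_power n" "length w \<noteq> n"
  shows "fock_form T (word w) Y = 0"
proof -
  have "P_total T Y \<in> tensor_power n"
    using P_op_power[OF assms(1)] P_total_power[OF assms(1)] by metis
  then show ?thesis
    using assms(2) by (auto simp: fock_form_def std_inner_word tensor_power_def in_keys_iff
      simp flip: P_total_def)
qed

lemma fock_form_hermitian_bilinear:
  assumes "\<And>u v. length u = n \<Longrightarrow> length v = n \<Longrightarrow>
      fock_form T (word u) (word v) = cnj (fock_form T (word v) (word u))"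
    and "X \<in> tensor_power n" "Y \<in> tensor_power n"
  shows "fock_form T X Y = cnj (fock_form T Y X)"
proof -
  let ?X = "\<Sum>w\<in>Poly_Mapping.keys X. smul (Poly_Mapping.lookup X w) (word w)"
  let ?Y = "\<Sum>w\<in>Poly_Mapping.keys Y. smul (Poly_Mapping.lookup Y w) (word w)"
  have *: "fock_form T (word u) (word v) = cnj (fock_form T (word v) (word u))"
    if "u \<in> Poly_Mapping.keys X" "v \<in> Poly_Mapping.keys Y" for u v
    using assms(2,3) that by (intro assms(1)) (auto simp: tensor_power_def)
  let ?x = "Poly_Mapping.lookup X" and ?y = "Poly_Mapping.lookup Y"
  have "fock_form T ?X ?Y = (\<Sum>u\<in>Poly_Mapping.keys X. \<Sum>v\<in>Poly_Mapping.keys Y.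
      cnj (?x u) * (?y v * fock_form T (word u) (word v)))"
    by (simp add: fock_form_sum_left fock_form_sum_right fock_form_smul_left fock_form_smul_right
        sum_distrib_left) (subst sum.swap, simp add: mult.left_commute)
  also have "\<dots> = (\<Sum>u\<in>Poly_Mapping.keys X. \<Sum>v\<in>Poly_Mapping.keys Y.
      cnj (?x u * (cnj (?y v) * fock_form T (word v) (word u))))"
    by (intro sum.cong refl) (simp only: *, simp)
  also have "\<dots> = cnj (\<Sum>v\<in>Poly_Mapping.keys Y. \<Sum>u\<in>Poly_Mapping.keys X.
      cnj (?y v) * (?x u * fock_form T (word v) (word u)))"
    unfolding cnj_sum by (subst sum.swap) (simp add: mult.left_commute)
  also have "\<dots> = cnj (fock_form T ?Y ?X)"
    by (simp add: fock_form_sum_left fock_form_sum_right fock_form_smul_left fock_form_smul_right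
        sum_distrib_left) (subst sum.swap, simp add: mult.left_commute)
  finally have "fock_form T ?X ?Y = cnj (fock_form T ?Y ?X)" .
  then show ?thesis by (simp flip: words_span)
qed

lemma fock_form_hermitian_words:
  assumes h: "hermitian_coeffs T"
  shows "length u = n \<Longrightarrow> length v = n \<Longrightarrow>
    fock_form T (word u) (word v) = cnj (fock_form T (word v) (word u))"
proof (induction n arbitrary: u v rule: less_induct)
  case (less n)
  have herm: "fock_form T X Y = cnj (fock_form T Y X)"
    if "m < n" "X \<in> tensor_power m" "Y \<in> tensor_power m" for m X Y
    using fock_form_hermitian_bilinear[OF less.IH[OF that(1)] that(2,3)] by blast
  show ?case
  proof (cases n)
    case 0
    then show ?thesis using less.prems by (simp add: fock_form_vac word_Nil)
  next
    case (Suc m)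
    then obtain i u' j v' where u: "u = i # u'" "length u' = m" and v: "v = j # v'" "length v' = m"
      using less.prems by (metis length_Suc_conv)
    have expand: "fock_form T (word (a # x)) (word (b # y))
        = (if a = b then fock_form T (word x) (word y) else 0)
        + (\<Sum>k\<in>UNIV. \<Sum>l\<in>UNIV. T a b k l * cnj (fock_form T (ann_basis T y k) (ann_basis T x l)))"
      if len: "length x = m" "length y = m" for a b x y
    proof -
      have "fock_form T (word (a # x)) (word (b # y))
          = fock_form T (word x) (ann_basis T (b # y) a)"
        using fock_form_adjoint[of T a "word x" "word (b # y)"] by (simp flip: word_Cons)
      also have e1: "\<dots> = (if a = b then fock_form T (word x) (word y) else 0)
        + (\<Sum>k\<in>UNIV. \<Sum>l\<in>UNIV. T a b k l * fock_form T (word x) (word [l] * ann_basis T y k))"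
        by (simp add: fock_form_add_right fock_form_sum_right fock_form_smul_right)
      finally have e1: "fock_form T (word (a # x)) (word (b # y)) = \<dots>" .
      have "fock_form T (word x) (word [l] * ann_basis T y k)
          = cnj (fock_form T (ann_basis T y k) (ann_basis T x l))" for k l
      proof -
        have "word [l] * ann_basis T y k \<in> tensor_power m"
          using tensor_power_Cons[OF ann_basis_power[of T y k], of l] len by (cases y) auto
        then have "fock_form T (word x) (word [l] * ann_basis T y k)
            = cnj (fock_form T (word [l] * ann_basis T y k) (word x))"
          using herm[of m "word x" "word [l] * ann_basis T y k"] tensor_power_word[OF len(1)] Suc
          by simp
        then show ?thesis
          using fock_form_adjoint[of T l "ann_basis T y k" "word x"] by simp
      qed
      then show ?thesis using e1 by (simp only:)
    qed
    have f: "fock_form T (ann_basis T u' l) (ann_basis T v' k)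
        = cnj (fock_form T (ann_basis T v' k) (ann_basis T u' l))" for k l
      by (rule herm[of "m - 1"])
        (use ann_basis_power[of T u' l] ann_basis_power[of T v' k] Suc u(2) v(2) in simp_all)
    have g: "T i j k l = cnj (T j i l k)" for k l
      using h unfolding hermitian_coeffs_def by blast
    have e: "fock_form T (word u') (word v') = cnj (fock_form T (word v') (word u'))"
      using less.IH[of m] Suc u v by blast
    have "cnj (\<Sum>k\<in>UNIV. \<Sum>l\<in>UNIV. T j i k l * cnj (fock_form T (ann_basis T u' k) (ann_basis T v' l)))
        = (\<Sum>k\<in>UNIV. \<Sum>l\<in>UNIV. cnj (T j i l k) * fock_form T (ann_basis T u' l) (ann_basis T v' k))"
      by (subst sum.swap) (simp add: cnj_sum)
    also have "\<dots> = (\<Sum>k\<in>UNIV. \<Sum>l\<in>UNIV. T i j k l * cnj (fock_form T (ann_basis T v' k) (ann_basis T u' l)))"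
      by (simp only: f flip: g)
    finally show ?thesis
      unfolding u v expand[OF u(2) v(2)] expand[OF v(2) u(2)] complex_cnj_add
      by (auto intro: e)
  qed
qed

lemma fock_form_hermitian:
  assumes "hermitian_coeffs T"
  shows "cnj (fock_form T Y X) = fock_form T X Y"
proof (induction X rule: span_induct)
  case (3 c u)
  have "cnj (fock_form T Y (word u)) = fock_form T (word u) Y"
  proof (induction Y rule: span_induct)
    case (3 d v)
    have "cnj (fock_form T (word v) (word u)) = fock_form T (word u) (word v)"
    proof (cases "length u = length v")
      case True
      show ?thesis by (rule fock_form_hermitian_words[OF assms True refl, symmetric])
    next
      case False
      have "fock_form T (word u) (word v) = 0"
        by (rule fock_form_homog[OF tensor_power_word[OF refl]]) (rule False)
      moreover have "fock_form T (word v) (word u) = 0"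
        by (rule fock_form_homog[OF tensor_power_word[OF refl]]) (rule False[symmetric])
      ultimately show ?thesis by simp
    qed
    then show ?case by (simp add: fock_form_smul_left fock_form_smul_right)
  qed (simp_all add: fock_form_add_left fock_form_add_right)
  then show ?case by (simp add: fock_form_smul_left fock_form_smul_right)
qed (simp_all add: fock_form_add_left fock_form_add_right)

lemma fock_null_letter_action:
  assumes "hermitian_coeffs T" "Y \<in> fock_null T"
  shows "letter_action T g Y \<in> fock_null T"
proof (cases g)
  case (Cre i)
  have "fock_form T X (letter_action T (Cre i) Y) = 0" for X
    using fock_form_adjoint[of T i Y X] fock_form_hermitian[OF assms(1)] assms(2)[unfolded fock_null_iff]
    by (metis complex_cnj_zero)
  then show ?thesis unfolding Cre fock_null_iff by blast
next
  case (Ann i)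
  show ?thesis
    unfolding Ann fock_null_iff fock_form_adjoint[symmetric]
    using assms(2)[unfolded fock_null_iff] by blast
qed

lemma fock_null_add: "X \<in> fock_null T \<Longrightarrow> Y \<in> fock_null T \<Longrightarrow> X + Y \<in> fock_null T"
  by (simp add: fock_null_iff fock_form_add_right)

lemma fock_null_smul: "X \<in> fock_null T \<Longrightarrow> smul c X \<in> fock_null T"
  by (simp add: fock_null_iff fock_form_smul_right)

lemma fock_null_zero: "0 \<in> fock_null T"
  by (simp add: fock_null_iff)

lemma fock_null_free_action:
  assumes "hermitian_coeffs T" "Y \<in> fock_null T"
  shows "free_action T x Y \<in> fock_null T"
proof (induction x rule: span_induct)
  case (3 c w)
  have "word_action T w Y \<in> fock_null T"
    using assms by (induction w) (auto intro: fock_null_letter_action)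
  then show ?case by (simp add: free_action_smul_left fock_null_smul)
qed (auto simp: free_action_add_left intro: fock_null_add fock_null_zero)

lemma fock_null_coset: "fock_null T +>\<^bsub>free_alg\<^esub> X = {Z + X | Z. Z \<in> fock_null T}"
  by (auto simp: a_r_coset_def r_coset_def free_alg_def)

lemma fock_null_coset_add:
  assumes "Z \<in> fock_null T"
  shows "fock_null T +>\<^bsub>free_alg\<^esub> (Z + X) = fock_null T +>\<^bsub>free_alg\<^esub> X"
proof -
  have "smul (- 1) Z \<in> fock_null T" by (rule fock_null_smul[OF assms])
  moreover have "smul (- 1) Z = - Z"
    by (rule poly_mapping_eqI) (simp add: lookup_smul)
  ultimately have "- Z \<in> fock_null T" by simp
  then have "W - Z \<in> fock_null T" if "W \<in> fock_null T" for W
    using fock_null_add[OF that] by fastforce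
  then show ?thesis
    unfolding fock_null_coset using assms
    by (auto intro: fock_null_add simp flip: add.assoc)
       (metis add.assoc diff_add_cancel)
qed

lemma fock_space_eq: "fock_space T = range (\<lambda>X. fock_null T +>\<^bsub>free_alg\<^esub> X)"
  by (auto simp: fock_space_def A_RCOSETS_def RCOSETS_def a_r_coset_def free_alg_def)

lemma fock_rep_coset:
  assumes "hermitian_coeffs T"
  shows "fock_rep T (wick_class T x) (fock_null T +>\<^bsub>free_alg\<^esub> X)
    = fock_null T +>\<^bsub>free_alg\<^esub> free_action T x X"
proof -
  have "fock_null T +>\<^bsub>free_alg\<^esub> free_action T x Y = fock_null T +>\<^bsub>free_alg\<^esub> free_action T x X"
    if Y: "Y \<in> fock_null T +>\<^bsub>free_alg\<^esub> X" for Y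
  proof -
    from Y obtain Z where "Z \<in> fock_null T" "Y = Z + X" unfolding fock_null_coset by blast
    then show ?thesis
      using fock_null_coset_add[OF fock_null_free_action[OF assms]] by (simp add: free_action_add)
  qed
  moreover have "X \<in> fock_null T +>\<^bsub>free_alg\<^esub> X"
    unfolding fock_null_coset using fock_null_zero by force
  ultimately show ?thesis
    unfolding fock_rep_def fock_action_class[OF assms] by blast
qed

lemma fock_kernel_eq:
  assumes "hermitian_coeffs T"
  shows "fock_kernel T = {A \<in> carrier (wick_algebra T). \<forall>X. fock_action T A X \<in> fock_null T}"
proof -
  have *: "fock_null T +>\<^bsub>free_alg\<^esub> Y = fock_null T \<longleftrightarrow> Y \<in> fock_null T" for Y
  proof
    assume "fock_null T +>\<^bsub>free_alg\<^esub> Y = fock_null T"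
    then have "0 + Y \<in> fock_null T" using fock_null_zero[of T] unfolding fock_null_coset by blast
    then show "Y \<in> fock_null T" by simp
  next
    assume "Y \<in> fock_null T"
    then show "fock_null T +>\<^bsub>free_alg\<^esub> Y = fock_null T"
      using fock_null_coset_add[of Y T 0] by (simp add: fock_null_coset)
  qed
  have "(\<forall>C\<in>fock_space T. fock_rep T A C = fock_null T) \<longleftrightarrow> (\<forall>X. fock_action T A X \<in> fock_null T)"
    if "A \<in> carrier (wick_algebra T)" for A
  proof -
    from that obtain x where A: "A = wick_class T x" by (auto simp: carrier_wick_algebra)
    show ?thesis
      by (simp add: A fock_space_eq fock_rep_coset[OF assms] fock_action_class[OF assms] *)
  qed
  then show ?thesis unfolding fock_kernel_def by blast
qed

lemma tensor_two_formula:
  "leg T 1 (word [k, l]) = (\<Sum>i\<in>UNIV. \<Sum>j\<in>UNIV. smul (T i k l j) (word [i, j]))"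
  by (simp add: leg_def)

lemma gen_star_ideal_wick_algebra:
  assumes "S \<subseteq> carrier (wick_algebra T)"
  shows "ideal (gen_star_ideal (wick_algebra T) wick_star S) (wick_algebra T)"
  by (rule ring.gen_star_ideal_ideal[OF ring_wick_algebra assms])
     (auto simp: carrier_wick_algebra wick_star_class)

end

theory Submission
  imports Defs
begin

text \<open>
  The theorem has an analytic half and an algebraic half.

  The analytic half determines the kernel of \<open>P\<^sub>n\<close>: it is the sum of the kernels of \<open>1 + T\<^sub>i\<close> over
  \<open>0 < i < n\<close> (\<open>qsym_kernel\<close>), so that the kernel of the Fock inner product is the ideal of the
  tensor algebra generated by \<open>ker (1 + T)\<close>. By the braid relations \<open>P\<^sub>n\<close> is the quantum symmetrizer,
  the sum over all permutations of products of the \<open>T\<^sub>i\<close> along reduced words. It factors through the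
  symmetrizers of the first \<open>k\<close> and of the last \<open>n - k\<close> strands and a sum over shuffles
  (\<open>qsym_add\<close>). With \<open>U\<^sub>k\<close> the product of the \<open>T\<^sub>i\<close> along the half twist of the first \<open>k\<close> strands,
  the alternating sum over \<open>k\<close> of \<open>U\<^sub>k\<close> times the shuffle sum vanishes (\<open>alternating_twist_shuf\<close>).
  Let \<open>Z\<close> be in the kernel of \<open>P\<^sub>n\<close> and orthogonal to all the kernels of \<open>1 + T\<^sub>i\<close>. By induction the
  terms with \<open>0 < k < n\<close>, applied to \<open>Z\<close>, lie in the sum of these kernels. The terms \<open>Z\<close> and
  \<open>U\<^sub>n Z\<close> that remain give \<open>\<langle>Z, U\<^sub>n Z\<rangle> = \<plusminus> \<langle>Z, Z\<rangle>\<close>. As \<open>-1 \<le> T \<le> 1\<close>, all factors of \<open>U\<^sub>n\<close> are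
  self-adjoint contractions, so none of them may shorten the vector; a vector that \<open>T\<^sub>i\<close> does not
  shorten and that is orthogonal to the kernel of \<open>1 + T\<^sub>i\<close> is fixed by \<open>T\<^sub>i\<close>. Hence all \<open>T\<^sub>i\<close> fix \<open>Z\<close>,
  and \<open>0 = P\<^sub>n Z = n! Z\<close>.

  The algebraic half compares two ideals of the Wick algebra. The kernel of the Fock
  representation is a \<open>*\<close>-ideal, and it contains \<open>ker (1 + T)\<close> because \<open>P\<^sub>n\<close> annihilates the kernel
  of \<open>1 + T\<^sub>1\<close>. Conversely, an element of the Fock kernel is a Wick ordered sum of terms
  \<open>y\<^sub>v a\<^sub>v\<^sup>*\<close> with \<open>y\<^sub>v\<close> a tensor and \<open>v\<close> a word (\<open>all_wick_orderable\<close>). Let \<open>n\<close> be the least length of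
  a word that occurs. Applied to a tensor \<open>X\<close> of degree \<open>n\<close>, the words longer than \<open>n\<close> vanish, and
  the words of length \<open>n\<close> give the coordinates of \<open>P\<^sub>n X\<close>. So the combinations of the \<open>y\<^sub>v\<close> whose
  coefficients are the coordinates of a vector in the range of \<open>P\<^sub>n\<close> lie in the ideal, and the
  orthogonal complement of the range, the kernel of \<open>P\<^sub>n\<close>, contributes elements of the ideal by its
  adjoints. Hence the terms with words of length \<open>n\<close> add up to an element of the ideal
  (\<open>wick_level_ker_ideal\<close>). They are subtracted, and \<open>n\<close> increases.
\<close>

section \<open>The quantum symmetrizer in a ring with braid relations\<close>

locale braid_sequence =
  fixes t :: "nat \<Rightarrow> 'r::ring_1"
  assumes braid: "t i * t (Suc i) * t i = t (Suc i) * t i * t (Suc i)"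
    and far: "Suc i < j \<Longrightarrow> t i * t j = t j * t i"
begin

text \<open>
  In all the elements below the first argument \<open>a\<close> is an offset: the strands are numbered
  \<open>a + 1, a + 2, \<dots>\<close>, and \<open>t i\<close> crosses the strands \<open>i\<close> and \<open>i + 1\<close>. The offset lets an induction
  on the number of strands treat all blocks of consecutive strands at once, without tensor
  products of operators.
\<close>

primrec run :: "nat \<Rightarrow> nat \<Rightarrow> 'r" where
  "run a 0 = 1"
| "run a (Suc m) = run a m * t (Suc (a + m))"

text \<open>
  \<open>ins a n = 1 + t (a + n - 1) + \<dots> + t (a + 1) \<cdots> t (a + n - 1)\<close> inserts the last of \<open>n\<close> strands
  at all possible positions. The value \<open>ins a 0 = 0\<close>, an empty sum, makes the recursion uniform.
\<close>

primrec ins :: "nat \<Rightarrow> nat \<Rightarrow> 'r" where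
  "ins a 0 = 0"
| "ins a (Suc n) = 1 + ins a n * t (a + n)"

text \<open>The sum over all permutations of \<open>n\<close> strands of the product of \<open>t\<close> along a reduced word.\<close>

primrec qsym :: "nat \<Rightarrow> nat \<Rightarrow> 'r" where
  "qsym a 0 = 1"
| "qsym a (Suc n) = ins a (Suc n) * qsym a n"

text \<open>
  The sum over all ways to move \<open>k\<close> of \<open>k + l\<close> strands to the front; the recursion asks whether
  the last strand is moved.
\<close>

fun shuf :: "nat \<Rightarrow> nat \<Rightarrow> nat \<Rightarrow> 'r" where
  "shuf a 0 l = 1"
| "shuf a (Suc k) 0 = 1"
| "shuf a (Suc k) (Suc l) = shuf a (Suc k) l + run (a + k) (Suc l) * shuf a k (Suc l)"

text \<open>The half twist, which reverses the order of \<open>k\<close> strands (the Garside element).\<close>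

primrec twist :: "nat \<Rightarrow> nat \<Rightarrow> 'r" where
  "twist a 0 = 1"
| "twist a (Suc k) = run a k * twist a k"

lemma shuf_0_right [simp]: "shuf a k 0 = 1"
  by (cases k) simp_all

lemma run_add: "run a (m + n) = run a m * run (a + m) n"
  by (induction n) (simp_all add: mult.assoc add.assoc)

subsection \<open>Intertwining\<close>

text \<open>
  An element that carries the generators with offset \<open>a\<close> to those with offset \<open>b\<close> does the same
  with everything built from them. The case \<open>a = b\<close> is commutation.
\<close>

lemma run_intertwine:
  "(\<And>i. 0 < i \<Longrightarrow> i \<le> m \<Longrightarrow> x * t (a + i) = t (b + i) * x) \<Longrightarrow> x * run a m = run b m * x"
proof (induction m)
  case (Suc m)
  have "x * run a (Suc m) = (x * run a m) * t (Suc (a + m))"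
    by (simp add: mult.assoc)
  also have "\<dots> = run b m * (x * t (a + Suc m))"
    using Suc.IH Suc.prems by (simp add: mult.assoc)
  also have "\<dots> = run b (Suc m) * x"
    using Suc.prems[of "Suc m"] by (simp add: mult.assoc)
  finally show ?case .
qed simp

lemma ins_intertwine:
  "(\<And>i. 0 < i \<Longrightarrow> i < n \<Longrightarrow> x * t (a + i) = t (b + i) * x) \<Longrightarrow> x * ins a n = ins b n * x"
proof (induction n)
  case (Suc n)
  have *: "x * (ins a n * t (a + n)) = ins b n * t (b + n) * x"
  proof (cases "n = 0")
    case False
    have "x * (ins a n * t (a + n)) = (x * ins a n) * t (a + n)" by (simp add: mult.assoc)
    also have "\<dots> = ins b n * (x * t (a + n))" using Suc by (simp add: mult.assoc)
    also have "\<dots> = ins b n * t (b + n) * x" using Suc.prems[of n] False by (simp add: mult.assoc)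
    finally show ?thesis .
  qed simp
  show ?case by (simp add: distrib_left distrib_right *)
qed simp

lemma qsym_intertwine:
  "(\<And>i. 0 < i \<Longrightarrow> i < n \<Longrightarrow> x * t (a + i) = t (b + i) * x) \<Longrightarrow> x * qsym a n = qsym b n * x"
proof (induction n)
  case (Suc n)
  have "x * qsym a (Suc n) = (x * ins a (Suc n)) * qsym a n" by (simp only: qsym.simps mult.assoc)
  also have "x * ins a (Suc n) = ins b (Suc n) * x" by (rule ins_intertwine) (rule Suc.prems)
  also have "ins b (Suc n) * x * qsym a n = ins b (Suc n) * (qsym b n * x)"
    using Suc.IH Suc.prems by (simp only: mult.assoc)
  finally show ?case by (simp only: qsym.simps mult.assoc)
qed simp

lemma twist_intertwine:
  "(\<And>i. 0 < i \<Longrightarrow> i < n \<Longrightarrow> x * t (a + i) = t (b + i) * x) \<Longrightarrow> x * twist a n = twist b n * x"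
proof (induction n)
  case (Suc n)
  have "x * twist a (Suc n) = (x * run a n) * twist a n" by (simp add: mult.assoc)
  also have "x * run a n = run b n * x" by (rule run_intertwine) (simp add: Suc.prems)
  also have "run b n * x * twist a n = run b n * (twist b n * x)"
    using Suc.IH Suc.prems by (simp add: mult.assoc)
  finally show ?case by (simp add: mult.assoc)
qed simp

lemma run_commute_far: "j < a \<or> a + m + 1 < j \<Longrightarrow> t j * run a m = run a m * t j"
  by (rule run_intertwine) (auto intro: far far[symmetric])

lemma twist_commute_far: "j < a \<or> a + n < j \<Longrightarrow> t j * twist a n = twist a n * t j"
  by (rule twist_intertwine) (auto intro: far far[symmetric])

lemma twist_run_commute: "run (a + n) m * twist a n = twist a n * run (a + n) m"
proof (rule twist_intertwine)
  fix i assume i: "0 < i" "i < n"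
  show "run (a + n) m * t (a + i) = t (a + i) * run (a + n) m"
    by (rule run_commute_far[symmetric]) (use i in simp)
qed

lemma run_shift:
  "0 < i \<Longrightarrow> i < m \<Longrightarrow> run a m * t (a + i) = t (Suc (a + i)) * run a m"
proof (induction m)
  case (Suc m)
  show ?case
  proof (cases "i < m")
    case True
    have "run a (Suc m) * t (a + i) = run a m * (t (Suc (a + m)) * t (a + i))"
      by (simp add: mult.assoc)
    also have "\<dots> = (run a m * t (a + i)) * t (Suc (a + m))"
      using far[of "a + i" "Suc (a + m)"] True by (simp add: mult.assoc)
    also have "\<dots> = t (Suc (a + i)) * run a (Suc m)"
      using Suc.IH Suc.prems True by (simp add: mult.assoc)
    finally show ?thesis .
  next
    case False
    then have "i = m" using Suc.prems by simp
    with Suc.prems obtain p where m: "m = Suc p" and i: "i = Suc p"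
      by (cases m) auto
    let ?s = "t (Suc (a + p))" and ?u = "t (Suc (Suc (a + p)))"
    have "run a (Suc m) * t (a + i) = run a p * (?s * ?u * ?s)"
      by (simp add: m i mult.assoc)
    also have "\<dots> = run a p * (?u * ?s * ?u)"
      by (simp only: braid)
    also have "\<dots> = (run a p * ?u) * ?s * ?u"
      by (simp add: mult.assoc)
    also have "run a p * ?u = ?u * run a p"
      by (rule run_commute_far[symmetric]) simp
    finally show ?thesis by (simp add: m i mult.assoc)
  qed
qed simp

text \<open>Moving the half twist past a braid reverses the numbering of its strands.\<close>

lemma twist_flip:
  "0 < i \<Longrightarrow> i < k \<Longrightarrow> twist a k * t (a + i) = t (a + (k - i)) * twist a k"
proof (induction k arbitrary: i)
  case (Suc k)
  show ?case
  proof (cases "i < k")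
    case True
    have "twist a (Suc k) * t (a + i) = run a k * (twist a k * t (a + i))"
      by (simp add: mult.assoc)
    also have "\<dots> = (run a k * t (a + (k - i))) * twist a k"
      using Suc True by (simp add: mult.assoc)
    also have "run a k * t (a + (k - i)) = t (Suc (a + (k - i))) * run a k"
      by (rule run_shift) (use True Suc.prems in simp_all)
    finally show ?thesis using True by (simp add: mult.assoc Suc_diff_le)
  next
    case False
    then have "i = k" using Suc.prems by simp
    with Suc.prems obtain p where k: "k = Suc p" and i: "i = Suc p"
      by (cases k) auto
    \<comment> \<open>Both sides equal \<open>run a k * run a k * twist a p\<close>.\<close>
    have "run a k * run a p = run (Suc a) p * run a k"
      by (rule run_intertwine) (use run_shift[of _ k a] in \<open>simp add: k\<close>)
    then have "t (Suc a) * (run a k * run a p) = (t (Suc a) * run (Suc a) p) * run a k"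
      by (simp only: mult.assoc)
    also have "t (Suc a) * run (Suc a) p = run a k"
      using run_add[of a 1 p] by (simp add: k)
    finally have *: "t (Suc a) * (run a k * run a p) = run a k * run a k" .
    have "twist a (Suc k) * t (a + i) = run a k * (run a p * (twist a p * t (Suc (a + p))))"
      by (simp add: k i mult.assoc)
    also have "twist a p * t (Suc (a + p)) = t (Suc (a + p)) * twist a p"
      by (rule twist_commute_far[symmetric]) simp
    also have "run a k * (run a p * (t (Suc (a + p)) * twist a p)) = run a k * run a k * twist a p"
      by (simp add: k mult.assoc)
    also have "\<dots> = t (Suc a) * (run a k * (run a p * twist a p))"
      by (simp only: * [symmetric] mult.assoc)
    also have "\<dots> = t (a + (Suc k - i)) * twist a (Suc k)"
      by (simp add: k i)
    finally show ?thesis .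
  qed
qed simp

subsection \<open>Factorization of the symmetrizer\<close>

lemma ins_add: "ins a (Suc k + l) = ins (a + Suc k) l + ins a (Suc k) * run (a + k) l"
proof (induction l)
  case (Suc l)
  have "ins a (Suc k + Suc l) = 1 + ins a (Suc k + l) * t (Suc (a + k + l))"
    by (simp add: add.assoc)
  then show ?case
    unfolding Suc by (simp add: distrib_right mult.assoc add.assoc)
qed simp

text \<open>
  A permutation of \<open>k + l\<close> strands is a choice of \<open>k\<close> of them followed by permutations of the
  first \<open>k\<close> and of the last \<open>l\<close> strands.
\<close>

lemma qsym_add: "qsym a (k + l) = qsym a k * qsym (a + k) l * shuf a k l"
proof (induction a k l rule: shuf.induct)
  case (3 a k l)
  note IH = 3
  let ?r = "run (a + k) (Suc l)"
  have c1: "ins (a + Suc k) (Suc l) * qsym a (Suc k) = qsym a (Suc k) * ins (a + Suc k) (Suc l)"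
  proof (rule qsym_intertwine)
    fix i assume "0 < i" "i < Suc k"
    then show "ins (a + Suc k) (Suc l) * t (a + i) = t (a + i) * ins (a + Suc k) (Suc l)"
      by (intro ins_intertwine[symmetric]) (auto intro: far)
  qed
  have c2: "?r * qsym a k = qsym a k * ?r"
    by (rule qsym_intertwine) (rule run_commute_far[symmetric], simp)
  have c3: "?r * qsym (a + k) (Suc l) = qsym (a + Suc k) (Suc l) * ?r"
    by (rule qsym_intertwine) (use run_shift[of _ "Suc l" "a + k"] in \<open>simp add: add.assoc\<close>)
  have "qsym a (Suc k + Suc l)
      = ins (a + Suc k) (Suc l) * qsym a (Suc k + l) + ins a (Suc k) * ?r * qsym a (k + Suc l)"
    using ins_add[of a k "Suc l"] by (simp only: add_Suc_right qsym.simps add_Suc) (simp only: distrib_right add_Suc_right)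
  also have "ins (a + Suc k) (Suc l) * qsym a (Suc k + l)
      = qsym a (Suc k) * qsym (a + Suc k) (Suc l) * shuf a (Suc k) l"
  proof -
    have "ins (a + Suc k) (Suc l) * qsym a (Suc k + l)
        = (ins (a + Suc k) (Suc l) * qsym a (Suc k)) * qsym (a + Suc k) l * shuf a (Suc k) l"
      unfolding IH(1) by (simp only: mult.assoc)
    then show ?thesis
      unfolding c1 qsym.simps(2)[of "a + Suc k" l] by (simp only: mult.assoc)
  qed
  also have "ins a (Suc k) * ?r * qsym a (k + Suc l)
      = qsym a (Suc k) * qsym (a + Suc k) (Suc l) * (?r * shuf a k (Suc l))"
  proof -
    have "ins a (Suc k) * ?r * qsym a (k + Suc l)
        = ins a (Suc k) * (?r * qsym a k) * qsym (a + k) (Suc l) * shuf a k (Suc l)"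
      unfolding IH(2) by (simp only: mult.assoc)
    also have "\<dots> = ins a (Suc k) * qsym a k * (?r * qsym (a + k) (Suc l)) * shuf a k (Suc l)"
      unfolding c2 by (simp only: mult.assoc)
    finally show ?thesis unfolding c3 by (simp only: mult.assoc qsym.simps)
  qed
  finally show ?case by (simp only: shuf.simps distrib_left)
qed simp_all

lemma shuf_1_left: "shuf a (Suc 0) l = (\<Sum>m\<le>l. run a m)"
  by (induction l) simp_all

lemma shuf_1_right: "shuf a (Suc k) (Suc 0) = 1 + t (Suc (a + k)) * shuf a k (Suc 0)"
  by simp

text \<open>
  The strand that goes to the front can be chosen first. This is the recursion that defines \<open>P_op\<close>.
\<close>

lemma qsym_Suc_front: "qsym a (Suc n) = qsym (Suc a) n * (\<Sum>m\<le>n. run a m)"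
  using qsym_add[of a "Suc 0" n] by (simp add: shuf_1_left)

lemma qsym_Suc_back: "qsym a (Suc n) = qsym a n * shuf a n (Suc 0)"
  using qsym_add[of a n "Suc 0"] by simp

lemma qsym_commute_disjoint: "qsym a k * qsym (a + k) l = qsym (a + k) l * qsym a k"
proof (rule qsym_intertwine[symmetric])
  fix i assume i: "0 < i" "i < k"
  show "qsym (a + k) l * t (a + i) = t (a + i) * qsym (a + k) l"
    by (rule qsym_intertwine[symmetric]) (use i in \<open>auto intro: far\<close>)
qed

text \<open>
  This is the formula \<open>\<Sum> S(x') x'' = 0\<close>, where \<open>\<Sum> x' \<otimes> x''\<close> is the coproduct of an element \<open>x\<close> of
  positive degree, for the antipode \<open>S\<close> of the quantum shuffle algebra; up to sign \<open>S\<close> is the half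
  twist. The recursion for shuffles by the last strand turns the sum
  for \<open>n + 1\<close> strands into \<open>1 - run a n\<close> times the sum for \<open>n\<close> strands, and \<open>run a 0 = 1\<close>.
\<close>

lemma alternating_twist_shuf:
  "(\<Sum>k\<le>Suc n. (- 1) ^ k * (twist a k * shuf a k (Suc n - k))) = 0"
proof -
  define S where "S n = (\<Sum>k\<le>n. (- 1) ^ k * (twist a k * shuf a k (n - k)))" for n
  have rec: "S (Suc n) = (1 - run a n) * S n" for n
  proof -
    define f where "f k = (- 1) ^ k * (twist a k * shuf a k (Suc n - k))" for k
    define g where "g k = (- 1) ^ k * (twist a k * shuf a k (n - k))" for k
    have comm: "run a n * (- 1) ^ k = (- 1) ^ k * run a n" for k
      by (cases "even k") simp_all
    \<comment> \<open>the last strand is moved to place \<open>k + 1\<close> and then, by a factor of the twist, to the front\<close>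
    have tw: "twist a (Suc k) * run (a + k) (n - k) = run a n * twist a k" if "k \<le> n" for k
    proof -
      have "twist a (Suc k) * run (a + k) (n - k) = run a k * (twist a k * run (a + k) (n - k))"
        by (simp add: mult.assoc)
      also have "\<dots> = run a k * run (a + k) (n - k) * twist a k"
        by (simp add: twist_run_commute[symmetric] mult.assoc)
      finally show ?thesis using run_add[of a k "n - k"] that by simp
    qed
    have h: "(- 1) ^ Suc k * (twist a (Suc k) * (run (a + k) (n - k) * shuf a k (n - k)))
        = - (run a n * g k)" if "k \<le> n" for k
    proof -
      have "twist a (Suc k) * (run (a + k) (n - k) * shuf a k (n - k))
          = run a n * (twist a k * shuf a k (n - k))"
        using tw[OF that] by (metis mult.assoc)
      then show ?thesis unfolding g_def
        by (simp only: mult.assoc[symmetric] comm) simp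
    qed
    have f0: "f 0 = g 0" by (simp add: f_def g_def)
    have fS: "f (Suc k) = g (Suc k) - run a n * g k" if "k < n" for k
    proof -
      from that obtain l where n: "n = Suc (k + l)" using less_iff_Suc_add by auto
      have l: "n - k = Suc l" "n - Suc k = l" by (simp_all add: n)
      have "f (Suc k) = g (Suc k)
          + (- 1) ^ Suc k * (twist a (Suc k) * (run (a + k) (n - k) * shuf a k (n - k)))"
        unfolding f_def g_def by (simp only: diff_Suc_Suc l shuf.simps distrib_left)
      then show ?thesis using h[of k] that by simp
    qed
    have fn: "f (Suc n) = - (run a n * g n)"
      using h[of n] by (simp add: f_def)
    have shift: "(\<Sum>k\<le>n. F k) = F 0 + (\<Sum>k<n. F (Suc k))" for F :: "nat \<Rightarrow> 'r"
      by (simp only: lessThan_Suc_atMost[symmetric] sum.lessThan_Suc_shift)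
    have "S (Suc n) = f 0 + (\<Sum>k<n. f (Suc k)) + f (Suc n)"
      unfolding S_def f_def[symmetric]
      by (simp only: sum.atMost_Suc shift)
    also have "(\<Sum>k<n. f (Suc k)) = (\<Sum>k<n. g (Suc k)) - (\<Sum>k<n. run a n * g k)"
      by (simp add: fS sum_subtractf[symmetric])
    also have "f 0 + ((\<Sum>k<n. g (Suc k)) - (\<Sum>k<n. run a n * g k)) + f (Suc n)
        = (g 0 + (\<Sum>k<n. g (Suc k))) - ((\<Sum>k<n. run a n * g k) + run a n * g n)"
      by (simp add: f0 fn)
    also have "g 0 + (\<Sum>k<n. g (Suc k)) = (\<Sum>k\<le>n. g k)"
      by (simp only: shift)
    also have "(\<Sum>k<n. run a n * g k) + run a n * g n = run a n * (\<Sum>k\<le>n. g k)"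
      by (simp add: lessThan_Suc_atMost[symmetric] distrib_left sum_distrib_left)
    finally show ?thesis
      by (simp add: S_def g_def left_diff_distrib)
  qed
  have "S (Suc n) = 0"
    by (induction n) (simp_all add: rec)
  then show ?thesis by (simp add: S_def)
qed

end

section \<open>The ring of operators on the tensor algebra\<close>

text \<open>
  Bundling the linear operators in a type turns them into a ring, in which the identities for braid
  sequences are available.
\<close>

typedef 'n operator = "{f :: 'n tensors \<Rightarrow> 'n tensors.
    (\<forall>X Y. f (X + Y) = f X + f Y) \<and> (\<forall>c X. f (smul c X) = smul c (f X))}"
  morphisms act Operator
  by (rule exI[of _ "\<lambda>X. X"]) simp

lemma act_add: "act f (X + Y) = act f X + act f Y"
  and act_smul: "act f (smul c X) = smul c (act f X)"
  using act[of f] by auto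

lemma act_zero [simp]: "act f 0 = 0"
  using act_smul[of f 0 0] by simp

lemma act_Operator:
  "(\<And>X Y. f (X + Y) = f X + f Y) \<Longrightarrow> (\<And>c X. f (smul c X) = smul c (f X))
    \<Longrightarrow> act (Operator f) = f"
  by (rule Operator_inverse) simp

instantiation operator :: (type) ring_1
begin

definition zero_operator :: "'a operator" where "0 = Operator (\<lambda>X. 0)"
definition one_operator :: "'a operator" where "1 = Operator (\<lambda>X. X)"
definition plus_operator :: "'a operator \<Rightarrow> 'a operator \<Rightarrow> 'a operator" where
  "f + g = Operator (\<lambda>X. act f X + act g X)"
definition minus_operator :: "'a operator \<Rightarrow> 'a operator \<Rightarrow> 'a operator" where
  "f - g = Operator (\<lambda>X. act f X - act g X)"
definition uminus_operator :: "'a operator \<Rightarrow> 'a operator" where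
  "- f = Operator (\<lambda>X. - act f X)"
definition times_operator :: "'a operator \<Rightarrow> 'a operator \<Rightarrow> 'a operator" where
  "f * g = Operator (\<lambda>X. act f (act g X))"

lemma act_simps [simp]:
  "act 0 X = 0" "act 1 X = X" "act (f + g) X = act f X + act g X"
  "act (f - g) X = act f X - act g X" "act (- f) X = - act f X"
  "act (f * g) X = act f (act g X)"
  unfolding zero_operator_def one_operator_def plus_operator_def minus_operator_def
    uminus_operator_def times_operator_def
  by (subst act_Operator; simp add: act_add act_smul)+

lemma operator_eqI: "(\<And>X. act f X = act g X) \<Longrightarrow> f = g"
  by (simp add: act_inject[symmetric] fun_eq_iff)

instance
proof
  show "(0 :: 'a operator) \<noteq> 1"
  proof
    assume "(0 :: 'a operator) = 1"
    then have "act 0 (1 :: 'a tensors) = act 1 1" by simp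
    then show False by simp
  qed
qed (auto intro!: operator_eqI simp: act_add)

end

lemma act_sum: "act (sum f A) X = (\<Sum>a\<in>A. act (f a) X)"
  by (induction A rule: infinite_finite_induct) simp_all

lemma act_minus: "act f (X - Y) = act f X - act f Y"
  by (metis act_add add_diff_cancel_right' diff_add_cancel)

definition leg_op :: "('n::finite) coeffs \<Rightarrow> nat \<Rightarrow> 'n operator" where
  "leg_op T i = Operator (leg T i)"

lemma act_leg_op [simp]: "act (leg_op T i) = leg T i"
  unfolding leg_op_def by (rule act_Operator) (simp_all add: leg_add leg_smul)

subsection \<open>The braid relations for the operators \<open>T\<^sub>i\<close>\<close>

lemma leg_append:
  assumes "X \<in> tensor_power n" "i < n"
  shows "leg T i (X * Y) = leg T i X * Y"
proof -
  have w: "leg T i (word u * word v) = leg T i (word u) * word v" if "length u = n" for u v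
    using that assms(2)
    by (auto simp: leg_def sum_distrib_right smul_mult_left nth_append list_update_append
        simp flip: word_append)
  have u: "leg T i (word u * Y) = leg T i (word u) * Y" if "length u = n" for u
    by (induction Y rule: span_induct)
       (simp_all add: w[OF that] leg_add leg_smul distrib_left mult_smul_right)
  have "leg T i ((\<Sum>u\<in>Poly_Mapping.keys X. smul (Poly_Mapping.lookup X u) (word u)) * Y)
      = leg T i (\<Sum>u\<in>Poly_Mapping.keys X. smul (Poly_Mapping.lookup X u) (word u)) * Y"
    using assms(1)
    by (simp add: sum_distrib_right leg_sum leg_smul smul_mult_left u tensor_power_def)
  then show ?thesis by (simp flip: words_span)
qed

lemma leg_eq_0:
  assumes "X \<in> tensor_power n" "n \<le> i \<or> i = 0"
  shows "leg T i X = 0"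
proof -
  have "leg T i (\<Sum>u\<in>Poly_Mapping.keys X. smul (Poly_Mapping.lookup X u) (word u)) = 0"
    using assms by (simp add: leg_sum leg_smul tensor_power_def) (auto simp: leg_def intro!: sum.neutral)
  then show ?thesis by (simp flip: words_span)
qed

lemma leg_0 [simp]: "leg T 0 X = 0"
  by (simp add: leg_def lin_def)

lemma leg_short [simp]: "length w \<le> i \<Longrightarrow> leg T i (word w) = 0"
  by (rule leg_eq_0[OF tensor_power_word[OF refl]]) simp

text \<open>
  The braid relations hold in all degrees at once, because \<open>leg T i\<close> vanishes on tensors with too
  few factors. Splitting off a first factor that is not touched lowers all indices by one.
\<close>

lemma leg_far_commute: "Suc i < j \<Longrightarrow> leg T i (leg T j X) = leg T j (leg T i X)"
proof (induction X rule: span_induct)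
  case (3 c w)
  have "leg T i (leg T j (word w)) = leg T j (leg T i (word w))"
    using \<open>Suc i < j\<close>
  proof (induction i arbitrary: j w)
    case (Suc i)
    obtain k where j: "j = Suc k" "Suc i < k" using Suc.prems by (cases j) auto
    show ?case
    proof (cases w)
      case (Cons x v)
      show ?thesis
      proof (cases "i = 0")
        case False
        then show ?thesis
          using Suc.IH[of k v] j by (simp only: Cons word_Cons[of x v] leg_Cons)
      next
        case True
        obtain m where k: "k = Suc m" "0 < m" using j True by (cases k) auto
        show ?thesis
        proof (cases v)
          case (Cons y z)
          have jj: "leg T j (word [a, b] * Z) = word [a, b] * leg T m Z" for a b Z
            using j(1) k word_Cons[of a "[b]"] by (simp add: leg_Cons mult.assoc)
          have l1: "leg T (Suc 0) (word [a, b] * Z) = leg T (Suc 0) (word [a, b]) * Z" for a b Z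
            by (rule leg_append[of _ 2]) (simp_all add: tensor_power_word)
          have w: "word w = word [x, y] * word z"
            by (simp add: \<open>w = x # v\<close> Cons flip: word_append)
          have "leg T j (leg T (Suc 0) (word [x, y]) * word z)
              = leg T (Suc 0) (word [x, y]) * leg T m (word z)"
            using tensor_two_formula[of T x y]
            by (simp add: sum_distrib_right leg_sum smul_mult_left leg_smul jj)
          then show ?thesis by (simp add: w jj l1 True)
        qed (simp add: Cons j True)
      qed
    qed simp
  qed simp
  then show ?case by (simp add: leg_smul)
qed (simp_all add: leg_add)

lemma leg_braid:
  assumes "braided T"
  shows "leg T i (leg T (Suc i) (leg T i X)) = leg T (Suc i) (leg T i (leg T (Suc i) X))"
proof (induction X rule: span_induct)
  case (3 c w)
  have "leg T i (leg T (Suc i) (leg T i (word w))) = leg T (Suc i) (leg T i (leg T (Suc i) (word w)))"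
  proof (induction i arbitrary: w)
    case (Suc i)
    show ?case
    proof (cases "i = 0")
      case False
      then show ?thesis
      proof (cases w)
        case (Cons x v)
        then show ?thesis
          using Suc[of v] False by (simp only: word_Cons[of x v] leg_Cons)
      qed simp
    next
      case True
      show ?thesis
      proof (cases "length w < 3")
        case len: True
        have z: "leg T 2 Z = 0" if "Z \<in> tensor_power (length w)" for Z
          by (rule leg_eq_0[OF that]) (use len in simp)
        have "word w \<in> tensor_power (length w)" by (rule tensor_power_word) simp
        then show ?thesis
          using z leg_power[OF \<open>word w \<in> tensor_power (length w)\<close>, of T 1] True
          by (simp flip: numeral_2_eq_2)
      next
        case False
        then have split: "word w = word (take 3 w) * word (drop 3 w)" and len: "length (take 3 w) = 3"
          by (simp_all flip: word_append)
        have app: "leg T i (X * Y) = leg T i X * Y" if "X \<in> tensor_power 3" "i < 3" for i X Y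
          using leg_append that by blast
        have p: "word (take 3 w) \<in> tensor_power 3" using len by (rule tensor_power_word)
        have "leg T 1 (leg T 2 (leg T 1 (word (take 3 w)))) = leg T 2 (leg T 1 (leg T 2 (word (take 3 w))))"
          using assms p unfolding braided_def by blast
        then show ?thesis
          by (simp add: True split app p leg_power flip: numeral_2_eq_2 del: One_nat_def flip: One_nat_def)
      qed
    qed
  qed simp
  then show ?case by (simp add: leg_smul)
qed (simp_all add: leg_add)

lemma braid_sequence_leg:
  assumes "braided T"
  shows "braid_sequence (leg_op T)"
proof
  show "leg_op T i * leg_op T (Suc i) * leg_op T i
      = leg_op T (Suc i) * leg_op T i * leg_op T (Suc i)" for i
    by (rule operator_eqI) (simp add: leg_braid[OF assms])
  show "leg_op T i * leg_op T j = leg_op T j * leg_op T i" if "Suc i < j" for i j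
    by (rule operator_eqI) (simp add: leg_far_commute[OF that])
qed

subsection \<open>\<open>P\<^sub>n\<close> is the quantum symmetrizer\<close>

lemma tensor_power_induct [consumes 1]:
  assumes "X \<in> tensor_power n"
    and "P 0" "\<And>X Y. P X \<Longrightarrow> P Y \<Longrightarrow> P (X + Y)" "\<And>c w. length w = n \<Longrightarrow> P (smul c (word w))"
  shows "P X"
proof -
  have "P (\<Sum>w\<in>A. smul (f w) (word w))" if "finite A" "A \<subseteq> {w. length w = n}" for A f
    using that by (induction A) (auto intro: assms)
  moreover have "Poly_Mapping.keys X \<subseteq> {w. length w = n}"
    using assms(1) by (auto simp: tensor_power_def)
  ultimately show ?thesis using words_span[of X] by (metis finite_keys)
qed

context
  fixes T :: "('n::finite) coeffs"
  assumes braided: "braided T"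
begin

interpretation braid_sequence "leg_op T"
  by (rule braid_sequence_leg[OF braided])

lemma leg_prod_run: "leg_prod T m X = act (run 0 m) X"
  by (induction m arbitrary: X) simp_all

lemma ins_Cons: "act (ins (Suc a) n) (word [j] * X) = word [j] * act (ins a n) X"
proof (induction n arbitrary: X)
  case (Suc n)
  show ?case
  proof (cases "n = 0")
    case False
    then show ?thesis by (simp add: Suc leg_Cons distrib_left)
  qed simp
qed simp

lemma qsym_Cons: "act (qsym (Suc a) n) (word [j] * X) = word [j] * act (qsym a n) X"
  by (induction n arbitrary: X) (simp_all add: ins_Cons del: ins.simps)

lemma P_op_qsym: "X \<in> tensor_power n \<Longrightarrow> P_op T n X = act (qsym 0 n) X"
proof (induction n arbitrary: X)
  case (Suc n)
  have R: "R_op T (Suc n) X = act (\<Sum>m\<le>n. run 0 m) X"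
    by (simp only: R_op_def leg_prod_run act_sum lessThan_Suc_atMost)
  have "one_tensor (P_op T n) Y = act (qsym (Suc 0) n) Y" if "Y \<in> tensor_power (Suc n)" for Y
    using that
  proof (induction Y rule: tensor_power_induct)
    case (3 c w)
    then obtain j v where w: "w = j # v" "length v = n" by (cases w) auto
    then show ?case
      using Suc.IH[OF tensor_power_word[of v n]] qsym_Cons[of 0 n j "word v"]
      by (simp add: one_tensor_smul act_smul word_Cons[of j v, symmetric])
  qed (simp_all add: one_tensor_add act_add)
  from this[OF R_op_power[OF Suc.prems, of T "Suc n"]] show ?case
    unfolding P_op.simps R qsym_Suc_front by simp
qed simp

end

section \<open>The inner product on tensors\<close>

lemma std_inner_minus: 
  "std_inner (X - Y) Z = std_inner X Z - std_inner Y Z"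
  "std_inner Z (X - Y) = std_inner Z X - std_inner Z Y"
  using std_inner_add_left[of "X - Y" Y Z] std_inner_add_right[of Z "X - Y" Y] by simp_all

lemma std_inner_sum:
  "std_inner (sum f A) Z = (\<Sum>a\<in>A. std_inner (f a) Z)"
  "std_inner Z (sum f A) = (\<Sum>a\<in>A. std_inner Z (f a))"
  by (induction A rule: infinite_finite_induct) (simp_all add: std_inner_add_left std_inner_add_right)

lemma cnj_std_inner: "cnj (std_inner X Y) = std_inner Y X"
  by (simp add: std_inner_superset[of "Poly_Mapping.keys X \<union> Poly_Mapping.keys Y"] cnj_sum mult.commute)

definition nrm2 :: "'n tensors \<Rightarrow> real" where
  "nrm2 X = Re (std_inner X X)"

lemma nrm2_sum: "nrm2 X = (\<Sum>w\<in>Poly_Mapping.keys X. (cmod (Poly_Mapping.lookup X w))\<^sup>2)"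
  unfolding nrm2_def std_inner_def Re_sum
  by (rule sum.cong) (simp_all add: cmod_power2 flip: power2_eq_square)

lemma nrm2_nonneg: "0 \<le> nrm2 X"
  unfolding nrm2_sum by (simp add: sum_nonneg)

lemma nrm2_zero: "nrm2 X \<le> 0 \<Longrightarrow> X = 0"
proof -
  assume "nrm2 X \<le> 0"
  then have "nrm2 X = 0" using nrm2_nonneg[of X] by simp
  then have "\<forall>w\<in>Poly_Mapping.keys X. (cmod (Poly_Mapping.lookup X w))\<^sup>2 = 0"
    unfolding nrm2_sum by (subst (asm) sum_nonneg_eq_0_iff) auto
  then show "X = 0" by (intro poly_mapping_eqI) (auto simp: in_keys_iff)
qed

lemma std_inner_self_zero: "std_inner X X = 0 \<Longrightarrow> X = 0"
  by (rule nrm2_zero) (simp add: nrm2_def)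

lemma tensor_power_minus: "X \<in> tensor_power n \<Longrightarrow> Y \<in> tensor_power n \<Longrightarrow> X - Y \<in> tensor_power n"
  using keys_diff[of X Y] by (auto simp: tensor_power_def)

subsection \<open>Orthogonal decomposition\<close>

interpretation tensor_space: vector_space "smul :: complex \<Rightarrow> 'a tensors \<Rightarrow> 'a tensors"
  by standard simp_all

text \<open>Gram-Schmidt orthogonalization, one spanning vector at a time.\<close>

lemma orthogonal_decomposition_span:
  assumes "finite B"
  shows "\<exists>Y\<in>tensor_space.span B. \<forall>Z\<in>tensor_space.span B. std_inner Z (X - Y) = 0"
  using assms
proof (induction B arbitrary: X)
  case (insert b B)
  from insert.IH[of b] obtain b1 where b1: "b1 \<in> tensor_space.span B"
    "\<And>Z. Z \<in> tensor_space.span B \<Longrightarrow> std_inner Z (b - b1) = 0" by blast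
  from insert.IH[of X] obtain Y where Y: "Y \<in> tensor_space.span B"
    "\<And>Z. Z \<in> tensor_space.span B \<Longrightarrow> std_inner Z (X - Y) = 0" by blast
  define b2 where "b2 = b - b1"
  have sub: "tensor_space.span B \<subseteq> tensor_space.span (insert b B)"
    by (rule tensor_space.span_mono) auto
  have "b \<in> tensor_space.span (insert b B)"
    by (rule tensor_space.span_base) simp
  then have b2: "b2 \<in> tensor_space.span (insert b B)"
    unfolding b2_def using b1(1) sub by (blast intro: tensor_space.span_diff)
  \<comment> \<open>\<open>b2 = 0\<close> means that \<open>b\<close> is in the span of \<open>B\<close> already\<close>
  define c where "c = (if b2 = 0 then 0 else std_inner b2 (X - Y) / std_inner b2 b2)"
  have c: "std_inner b2 (X - Y) = c * std_inner b2 b2"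
    using std_inner_self_zero[of b2] by (auto simp: c_def)
  show ?case
  proof (intro bexI ballI)
    show "Y + smul c b2 \<in> tensor_space.span (insert b B)"
      using Y(1) b2 sub by (blast intro: tensor_space.span_add tensor_space.span_scale)
    fix Z assume "Z \<in> tensor_space.span (insert b B)"
    then obtain k where "Z - smul k b \<in> tensor_space.span B"
      unfolding tensor_space.span_insert by blast
    then have "(Z - smul k b) + smul k b1 \<in> tensor_space.span B"
      using b1(1) by (blast intro: tensor_space.span_add tensor_space.span_scale)
    then have Z1: "Z - smul k b2 \<in> tensor_space.span B"
      by (simp add: b2_def algebra_simps)
    have e: "X - (Y + smul c b2) = (X - Y) - smul c b2" by simp
    have "std_inner (Z - smul k b2) (X - (Y + smul c b2)) = 0"
      unfolding e std_inner_minus(2)[of _ "X - Y"] std_inner_smul_right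
      using Y(2)[OF Z1] b1(2)[OF Z1] by (simp add: b2_def)
    moreover have "std_inner b2 (X - (Y + smul c b2)) = 0"
      unfolding e std_inner_minus(2)[of _ "X - Y"] std_inner_smul_right c by simp
    ultimately show "std_inner Z (X - (Y + smul c b2)) = 0"
      by (simp add: std_inner_minus(1) std_inner_smul_left)
  qed
qed (simp add: tensor_space.span_empty)

lemma subspace_image_tensor_power:
  assumes "\<And>X Y. f (X + Y) = f X + f Y" "\<And>c X. f (smul c X) = smul c (f X)"
  shows "tensor_space.subspace (f ` tensor_power n)"
proof (rule tensor_space.subspaceI)
  show "0 \<in> f ` tensor_power n"
    using assms(2)[of 0 0] by (intro image_eqI[of _ _ 0]) simp_all
  show "u + v \<in> f ` tensor_power n" if "u \<in> f ` tensor_power n" "v \<in> f ` tensor_power n" for u v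
    using that by (auto simp: assms(1)[symmetric] intro: tensor_power_add)
  show "smul c u \<in> f ` tensor_power n" if "u \<in> f ` tensor_power n" for c u
    using that by (auto simp: assms(2)[symmetric] intro: tensor_power_smul)
qed

lemma finite_words: "finite {w :: ('n::finite) list. length w = n}"
  using finite_lists_length_eq[of "UNIV :: 'n set" n] by simp

lemma orthogonal_decomposition:
  fixes S :: "('n::finite) tensors set"
  assumes "tensor_space.subspace S" "S \<subseteq> tensor_power n"
  shows "\<exists>Y\<in>S. \<forall>Z\<in>S. std_inner Z (X - Y) = 0"
proof -
  let ?W = "word ` {w :: 'n list. length w = n}"
  have "tensor_power n \<subseteq> tensor_space.span ?W"
  proof
    fix X :: "'n tensors" assume "X \<in> tensor_power n"
    then show "X \<in> tensor_space.span ?W"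
      by (induction X rule: tensor_power_induct)
        (auto intro: tensor_space.span_zero tensor_space.span_add tensor_space.span_scale
          tensor_space.span_base)
  qed
  moreover obtain B where B: "B \<subseteq> S" "tensor_space.independent B" "S \<subseteq> tensor_space.span B"
    by (rule tensor_space.maximal_independent_subset)
  ultimately have "finite B"
    using tensor_space.independent_span_bound[of ?W B] finite_words[where 'n = 'n, of n] assms(2) by blast
  moreover have "tensor_space.span B = S"
    using B assms(1) by (metis tensor_space.span_minimal subset_antisym)
  ultimately show ?thesis using orthogonal_decomposition_span[of B X] by simp
qed

subsection \<open>Slices\<close>

text \<open>
  \<open>slice u v X\<close> contracts all factors of \<open>X\<close> but two adjacent ones with basis vectors. It reduces
  statements on \<open>leg T i\<close> to the operator \<open>T\<close> on the tensors of degree two.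
\<close>

definition slice :: "'n list \<Rightarrow> 'n list \<Rightarrow> ('n::finite) tensors \<Rightarrow> 'n tensors" where
  "slice u v X = (\<Sum>a\<in>UNIV. \<Sum>b\<in>UNIV. smul (Poly_Mapping.lookup X (u @ a # b # v)) (word [a, b]))"

lemma slice_power: "slice u v X \<in> tensor_power 2"
  unfolding slice_def by (intro tensor_power_sum tensor_power_smul tensor_power_word) simp

lemma lookup_slice:
  "Poly_Mapping.lookup (slice u v X) [a, b] = Poly_Mapping.lookup X (u @ a # b # v)"
proof -
  have "Poly_Mapping.lookup (slice u v X) [a, b]
      = (\<Sum>c\<in>UNIV. \<Sum>d\<in>UNIV. if c = a then if d = b then Poly_Mapping.lookup X (u @ c # d # v) else 0 else 0)"
    unfolding slice_def lookup_sum lookup_smul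
    by (intro sum.cong) (auto simp: word_def lookup_single when_def)
  also have "\<dots> = (\<Sum>c\<in>UNIV. if c = a then \<Sum>d\<in>UNIV. if d = b then Poly_Mapping.lookup X (u @ c # d # v) else 0 else 0)"
    by (intro sum.cong) auto
  finally show ?thesis by simp
qed

lemma tensor_two_eqI:
  assumes "X \<in> tensor_power 2" "Y \<in> tensor_power 2"
    "\<And>a b. Poly_Mapping.lookup X [a, b] = Poly_Mapping.lookup Y [a, b]"
  shows "X = Y"
proof (rule poly_mapping_eqI)
  fix w
  show "Poly_Mapping.lookup X w = Poly_Mapping.lookup Y w"
  proof (cases "length w = 2")
    case True
    then obtain a b where "w = [a, b]"
      by (metis (no_types, lifting) One_nat_def Suc_1 Suc_length_conv length_0_conv)
    then show ?thesis using assms(3) by simp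
  next
    case False
    then show ?thesis using assms(1,2) by (metis (mono_tags, lifting) in_keys_iff mem_Collect_eq tensor_power_def)
  qed
qed

lemma contr_leg_Suc: "0 < i \<Longrightarrow> contr j (leg T (Suc i) X) = leg T i (contr j X)"
proof (induction X rule: span_induct)
  case (3 c w)
  have "contr j (leg T (Suc i) (word w)) = leg T i (contr j (word w))"
  proof (cases w)
    case (Cons x v)
    then show ?thesis
      using leg_Cons[OF \<open>0 < i\<close>, of T x "word v"] by (simp add: contr_Cons flip: word_Cons)
  qed simp
  then show ?case by (simp add: leg_smul contr_smul)
qed (simp_all add: leg_add contr_add)

lemma contr_contr_leg:
  "contr b (contr a (leg T 1 X)) = (\<Sum>c\<in>UNIV. \<Sum>d\<in>UNIV. smul (T a c d b) (contr d (contr c X)))"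
proof (induction X rule: span_induct)
  case (3 s w)
  have "contr b (contr a (leg T 1 (word w))) = (\<Sum>c\<in>UNIV. \<Sum>d\<in>UNIV. smul (T a c d b) (contr d (contr c (word w))))"
  proof (cases w)
    case (Cons j v)
    have "contr b (contr a (leg T 1 (word [j] * word v)))
        = (\<Sum>k\<in>UNIV. \<Sum>l\<in>UNIV. if b = l then smul (T a j k b) (contr k (word v)) else 0)"
      unfolding contr_leg contr_sum contr_smul contr_Cons by (intro sum.cong) auto
    also have "\<dots> = (\<Sum>c\<in>UNIV. if c = j then \<Sum>k\<in>UNIV. smul (T a j k b) (contr k (word v)) else 0)"
      by simp
    also have "\<dots> = (\<Sum>c\<in>UNIV. \<Sum>d\<in>UNIV. smul (T a c d b) (contr d (contr c (word [j] * word v))))"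
      by (intro sum.cong refl) (auto simp: contr_Cons)
    finally show ?thesis by (simp only: Cons word_Cons[of j v])
  qed (simp add: leg_short)
  then show ?case by (simp only: leg_smul contr_smul smul_sum smul_simps mult.commute)
qed (simp_all add: leg_add contr_add sum.distrib)

lemma lookup_leg:
  "Poly_Mapping.lookup (leg T (Suc (length u)) X) (u @ a # b # v)
    = (\<Sum>c\<in>UNIV. \<Sum>d\<in>UNIV. T a c d b * Poly_Mapping.lookup X (u @ c # d # v))"
proof (induction u arbitrary: X)
  case Nil
  then show ?case
    by (simp add: lookup_Cons contr_contr_leg[unfolded One_nat_def] lookup_sum lookup_smul)
next
  case (Cons j u)
  show ?case
    using Cons.IH[of "contr j X"] by (simp add: lookup_Cons contr_leg_Suc)
qed

lemma lookup_leg_two: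
  "Poly_Mapping.lookup (leg T 1 X) [a, b] = (\<Sum>c\<in>UNIV. \<Sum>d\<in>UNIV. T a c d b * Poly_Mapping.lookup X [c, d])"
  using lookup_leg[of T "[]" X a b "[]"] by simp

lemma slice_leg: "slice u v (leg T (Suc (length u)) X) = leg T 1 (slice u v X)"
  by (rule tensor_two_eqI[OF slice_power leg_power[OF slice_power]])
     (simp only: lookup_slice lookup_leg_two lookup_leg)

lemma sum_words_add:
  "(\<Sum>w | length w = m + n. f w) = (\<Sum>u | length u = m. \<Sum>v | length v = n. f (u @ v))"
  for f :: "('n::finite) list \<Rightarrow> 'b::comm_monoid_add"
proof -
  have "(\<Sum>u | length u = m. \<Sum>v | length v = n. f (u @ v))
      = (\<Sum>p\<in>{u :: 'n list. length u = m} \<times> {v. length v = n}. f (fst p @ snd p))"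
    by (simp add: sum.cartesian_product case_prod_beta)
  also have "\<dots> = (\<Sum>w | length w = m + n. f w)"
    by (rule sum.reindex_bij_witness[of _ "\<lambda>w. (take m w, drop m w)" "\<lambda>p. fst p @ snd p"]) auto
  finally show ?thesis by simp
qed

lemma sum_words_two:
  "(\<Sum>w | length w = 2. f w) = (\<Sum>a\<in>UNIV. \<Sum>b\<in>UNIV. f [a, b])"
  for f :: "('n::finite) list \<Rightarrow> 'b::comm_monoid_add"
proof -
  have "(\<Sum>w | length w = 2. f w) = (\<Sum>p\<in>UNIV \<times> UNIV. f [fst p, snd p])"
    by (rule sum.reindex_bij_witness[of _ "\<lambda>p. [fst p, snd p]" "\<lambda>w. (w ! 0, w ! 1)"])
       (auto simp: numeral_2_eq_2 length_Suc_conv)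
  then show ?thesis by (simp add: sum.cartesian_product case_prod_beta)
qed

lemma sum_words_slices:
  "(\<Sum>w | length w = p + (2 + q). f w)
    = (\<Sum>u | length u = p. \<Sum>v | length v = q. \<Sum>a\<in>UNIV. \<Sum>b\<in>UNIV. f (u @ a # b # v))"
  for f :: "('n::finite) list \<Rightarrow> 'b::comm_monoid_add"
proof -
  have "(\<Sum>w | length w = p + (2 + q). f w)
      = (\<Sum>u | length u = p. \<Sum>a\<in>UNIV. \<Sum>b\<in>UNIV. \<Sum>v | length v = q. f (u @ a # b # v))"
    by (simp only: sum_words_add sum_words_two append_Cons append_Nil)
  also have "\<dots> = (\<Sum>u | length u = p. \<Sum>a\<in>UNIV. \<Sum>v | length v = q. \<Sum>b\<in>UNIV. f (u @ a # b # v))"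
    by (intro sum.cong refl sum.swap)
  also have "\<dots> = (\<Sum>u | length u = p. \<Sum>v | length v = q. \<Sum>a\<in>UNIV. \<Sum>b\<in>UNIV. f (u @ a # b # v))"
    by (intro sum.cong refl sum.swap)
  finally show ?thesis .
qed

lemma std_inner_words:
  "X \<in> tensor_power n \<Longrightarrow> std_inner X Y
    = (\<Sum>w | length w = n. cnj (Poly_Mapping.lookup X w) * Poly_Mapping.lookup Y w)"
  for X :: "('n::finite) tensors"
  by (rule std_inner_superset[OF finite_words]) (auto simp: tensor_power_def)

lemma std_inner_two:
  "X \<in> tensor_power 2 \<Longrightarrow> std_inner X Y
    = (\<Sum>a\<in>UNIV. \<Sum>b\<in>UNIV. cnj (Poly_Mapping.lookup X [a, b]) * Poly_Mapping.lookup Y [a, b])"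
  for X :: "('n::finite) tensors"
  by (simp add: std_inner_words sum_words_two)

lemma std_inner_slices:
  fixes X :: "('n::finite) tensors"
  assumes "X \<in> tensor_power (p + (2 + q))"
  shows "std_inner X Y = (\<Sum>u | length u = p. \<Sum>v | length v = q. std_inner (slice u v X) (slice u v Y))"
  by (simp add: std_inner_words[OF assms] sum_words_slices std_inner_two[OF slice_power] lookup_slice
      del: add_2_eq_Suc add_2_eq_Suc')

lemma leg_cases:
  obtains "\<And>X. X \<in> tensor_power n \<Longrightarrow> leg T i X = 0" | p q where "i = Suc p" "n = p + (2 + q)"
proof (cases "0 < i \<and> i < n")
  case True
  then obtain p where "i = Suc p" by (cases i) auto
  moreover have "n = p + (2 + (n - p - 2))" using True calculation by simp
  ultimately show ?thesis by (rule that(2))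
next
  case False
  then show ?thesis using that(1) leg_eq_0 by (metis leD neq0_conv not_le_imp_less)
qed

subsection \<open>The operators \<open>T\<^sub>i\<close> are self-adjoint contractions\<close>

lemma leg_two_self_adjoint:
  assumes "hermitian_coeffs T" and XY: "X \<in> tensor_power 2" "Y \<in> tensor_power 2"
  shows "std_inner (leg T 1 X) Y = std_inner X (leg T 1 Y)"
proof -
  let ?x = "\<lambda>a b. cnj (Poly_Mapping.lookup X [a, b])" and ?y = "\<lambda>a b. Poly_Mapping.lookup Y [a, b]"
  have h: "cnj (T i j k l) = T j i l k" for i j k l
    using assms(1) unfolding hermitian_coeffs_def by (metis complex_cnj_cnj)
  have swap: "(\<Sum>a\<in>UNIV. \<Sum>b\<in>UNIV. \<Sum>c\<in>UNIV. \<Sum>d\<in>UNIV. f a b c d)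
      = (\<Sum>c\<in>UNIV. \<Sum>d\<in>UNIV. \<Sum>a\<in>UNIV. \<Sum>b\<in>UNIV. f a b c d)"
    for f :: "'a \<Rightarrow> 'a \<Rightarrow> 'a \<Rightarrow> 'a \<Rightarrow> complex"
  proof -
    have "(\<Sum>a\<in>UNIV. \<Sum>b\<in>UNIV. \<Sum>c\<in>UNIV. \<Sum>d\<in>UNIV. f a b c d)
        = (\<Sum>a\<in>UNIV. \<Sum>c\<in>UNIV. \<Sum>d\<in>UNIV. \<Sum>b\<in>UNIV. f a b c d)"
      by (subst (2) sum.swap) (intro sum.cong refl sum.swap)
    also have "\<dots> = (\<Sum>c\<in>UNIV. \<Sum>d\<in>UNIV. \<Sum>a\<in>UNIV. \<Sum>b\<in>UNIV. f a b c d)"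
      by (subst sum.swap) (intro sum.cong refl sum.swap)
    finally show ?thesis .
  qed
  have "std_inner (leg T 1 X) Y
      = (\<Sum>a\<in>UNIV. \<Sum>b\<in>UNIV. \<Sum>c\<in>UNIV. \<Sum>d\<in>UNIV. T c a b d * ?x c d * ?y a b)"
    unfolding std_inner_two[OF leg_power[OF XY(1)]] lookup_leg_two
    by (simp add: cnj_sum h sum_distrib_right)
  also have "\<dots> = (\<Sum>c\<in>UNIV. \<Sum>d\<in>UNIV. \<Sum>a\<in>UNIV. \<Sum>b\<in>UNIV. T c a b d * ?x c d * ?y a b)"
    by (rule swap)
  also have "\<dots> = std_inner X (leg T 1 Y)"
    unfolding std_inner_two[OF XY(1)] lookup_leg_two
    by (simp add: sum_distrib_left mult_ac)
  finally show ?thesis .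
qed

lemma leg_self_adjoint:
  assumes "hermitian_coeffs T" and "X \<in> tensor_power n" "Y \<in> tensor_power n"
  shows "std_inner (leg T i X) Y = std_inner X (leg T i Y)"
proof (rule leg_cases[of n T i])
  fix p q assume i: "i = Suc p" and n: "n = p + (2 + q)"
  have s: "slice u v (leg T i Z) = leg T 1 (slice u v Z)" if "length u = p" for u v Z
    using slice_leg[of u v T Z] that i by simp
  show ?thesis
    using leg_power[OF assms(2), of T i] assms(2) unfolding n
    by (simp add: std_inner_slices s leg_two_self_adjoint[OF assms(1) slice_power slice_power, unfolded One_nat_def])
next
  assume "\<And>X. X \<in> tensor_power n \<Longrightarrow> leg T i X = 0"
  then show ?thesis using assms(2,3) by simp
qed

text \<open>
  \<open>2 (1 - T\<^sup>2) = (1 - T) (1 + T) (1 - T) + (1 + T) (1 - T) (1 + T)\<close>, and both summands are positive.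
\<close>

lemma leg_two_contraction:
  assumes "hermitian_coeffs T"
    and lower: "op_le (\<lambda>X. - X) (leg T 1)" and upper: "op_le (leg T 1) (\<lambda>X. X)"
    and Z: "Z \<in> tensor_power 2"
  shows "nrm2 (leg T 1 Z) \<le> nrm2 Z"
proof -
  let ?T = "leg T 1"
  define A where "A = Z - ?T Z"
  define B where "B = Z + ?T Z"
  have AB: "A \<in> tensor_power 2" "B \<in> tensor_power 2"
    unfolding A_def B_def using Z by (auto intro: tensor_power_minus tensor_power_add leg_power)
  have Tm: "?T (X - Y) = ?T X - ?T Y" for X Y
    using act_minus[of "leg_op T 1"] by simp
  have "0 \<le> Re (std_inner A (?T A - - A))" "0 \<le> Re (std_inner B (B - ?T B))"
    using lower upper AB unfolding op_le_def by (auto simp: complex_nonneg_Reals_iff)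
  moreover have "?T A - - A = Z - ?T (?T Z)" "B - ?T B = Z - ?T (?T Z)"
    unfolding A_def B_def by (simp_all add: Tm leg_add del: One_nat_def)
  moreover have "std_inner A (Z - ?T (?T Z)) + std_inner B (Z - ?T (?T Z))
      = 2 * (std_inner Z Z - std_inner Z (?T (?T Z)))"
    unfolding A_def B_def by (simp add: std_inner_minus std_inner_add_left)
  moreover have "std_inner Z (?T (?T Z)) = std_inner (?T Z) (?T Z)"
    by (rule leg_two_self_adjoint[OF assms(1) Z leg_power[OF Z], symmetric])
  ultimately have "0 \<le> Re (2 * (std_inner Z Z - std_inner (?T Z) (?T Z)))"
    by (metis add_nonneg_nonneg plus_complex.simps(1))
  then show ?thesis by (simp add: nrm2_def)
qed

text \<open>The square of the norm is the sum of those of the slices.\<close>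

lemma leg_contraction:
  assumes "hermitian_coeffs T" "op_le (\<lambda>X. - X) (leg T 1)" "op_le (leg T 1) (\<lambda>X. X)"
    and X: "X \<in> tensor_power n"
  shows "nrm2 (leg T i X) \<le> nrm2 X"
proof (rule leg_cases[of n T i])
  fix p q assume i: "i = Suc p" and n: "n = p + (2 + q)"
  have s: "slice u v (leg T i Z) = leg T 1 (slice u v Z)" if "length u = p" for u v Z
    using slice_leg[of u v T Z] that i by simp
  have *: "nrm2 Y = (\<Sum>u | length u = p. \<Sum>v | length v = q. nrm2 (slice u v Y))"
    if "Y \<in> tensor_power n" for Y :: "'a tensors"
    using that unfolding n nrm2_def by (simp add: std_inner_slices Re_sum)
  show ?thesis
    unfolding *[OF X] *[OF leg_power[OF X]]
    by (intro sum_mono) (simp add: s leg_two_contraction[OF assms(1-3) slice_power, unfolded One_nat_def])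
next
  assume "\<And>X. X \<in> tensor_power n \<Longrightarrow> leg T i X = 0"
  then show ?thesis using X by (simp add: nrm2_nonneg[of X] nrm2_def[of 0])
qed

section \<open>The kernel of the quantum symmetrizer\<close>

definition graded :: "'n operator \<Rightarrow> bool" where
  "graded x \<longleftrightarrow> (\<forall>n. \<forall>X\<in>tensor_power n. act x X \<in> tensor_power n)"

lemma gradedD: "graded x \<Longrightarrow> X \<in> tensor_power n \<Longrightarrow> act x X \<in> tensor_power n"
  by (simp add: graded_def)

lemma graded_intros [intro]:
  "graded 0" "graded 1" "graded (leg_op T i)"
  "graded x \<Longrightarrow> graded y \<Longrightarrow> graded (x + y)" "graded x \<Longrightarrow> graded y \<Longrightarrow> graded (x * y)"
  by (auto simp: graded_def intro: leg_power tensor_power_add)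

definition adjoint_ops :: "'n operator \<Rightarrow> 'n operator \<Rightarrow> bool" where
  "adjoint_ops x y \<longleftrightarrow> graded x \<and> graded y \<and> (\<forall>n. \<forall>X\<in>tensor_power n. \<forall>Y\<in>tensor_power n.
     std_inner (act x X) Y = std_inner X (act y Y))"

lemma adjoint_opsD:
  "adjoint_ops x y \<Longrightarrow> X \<in> tensor_power n \<Longrightarrow> Y \<in> tensor_power n
    \<Longrightarrow> std_inner (act x X) Y = std_inner X (act y Y)"
  unfolding adjoint_ops_def by blast

lemma adjoint_ops_one: "adjoint_ops 1 1"
  by (auto simp: adjoint_ops_def)

lemma adjoint_ops_add:
  "adjoint_ops x y \<Longrightarrow> adjoint_ops x' y' \<Longrightarrow> adjoint_ops (x + x') (y + y')"
  by (auto simp: adjoint_ops_def std_inner_add_left std_inner_add_right)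

lemma adjoint_ops_mult:
  "adjoint_ops x y \<Longrightarrow> adjoint_ops x' y' \<Longrightarrow> adjoint_ops (x * x') (y' * y)"
  unfolding adjoint_ops_def by (metis act_simps(6) graded_intros(5) gradedD)

text \<open>
  Decompose \<open>Y\<close> orthogonally into \<open>Y2\<close> in the range of \<open>x\<close> and \<open>Y1\<close> in the kernel of \<open>x\<close>. Then
  \<open>y Y2\<close> is in the range and in the kernel of \<open>x\<close>, hence zero.
\<close>

lemma kernel_commuting_product:
  fixes x y :: "('n::finite) operator"
  assumes adj: "adjoint_ops x x" "adjoint_ops y y" and comm: "x * y = y * x"
    and Y: "Y \<in> tensor_power n" "act (x * y) Y = 0"
  obtains Y1 Y2 where "Y = Y1 + Y2" "Y1 \<in> tensor_power n" "Y2 \<in> tensor_power n"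
    "act x Y1 = 0" "act y Y2 = 0"
proof -
  have gr: "graded x" "graded y" using adj by (auto simp: adjoint_ops_def)
  let ?S = "act x ` tensor_power n"
  have "tensor_space.subspace ?S"
    by (rule subspace_image_tensor_power) (simp_all add: act_add act_smul)
  moreover have "?S \<subseteq> tensor_power n" using gradedD[OF gr(1)] by blast
  ultimately obtain Y2 where Y2: "Y2 \<in> ?S" "\<And>Z. Z \<in> ?S \<Longrightarrow> std_inner Z (Y - Y2) = 0"
    using orthogonal_decomposition by meson
  then obtain Z where Z: "Y2 = act x Z" "Z \<in> tensor_power n" by blast
  have Y2p: "Y2 \<in> tensor_power n" using gradedD[OF gr(1) Z(2)] Z(1) by simp
  then have Y1p: "Y - Y2 \<in> tensor_power n" using Y(1) tensor_power_minus by blast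
  have xY1: "act x (Y - Y2) = 0"
  proof (rule std_inner_self_zero)
    have "std_inner (act x (act x (Y - Y2))) (Y - Y2) = 0"
      using Y2(2) gradedD[OF gr(1) Y1p] by blast
    then show "std_inner (act x (Y - Y2)) (act x (Y - Y2)) = 0"
      using adjoint_opsD[OF adj(1) gradedD[OF gr(1) Y1p] Y1p] by simp
  qed
  have xy: "act x (act y W) = act y (act x W)" for W
    using comm by (metis act_simps(6))
  have "act x (act y Y2) = 0"
  proof -
    have "act x (act y Y) - act y (act x (Y - Y2)) = act x (act y Y2)"
      by (simp add: xy act_minus)
    then show ?thesis using Y(2) xY1 by simp
  qed
  moreover have "act y Y2 = act x (act y Z)" by (simp add: Z xy)
  ultimately have "std_inner (act y Y2) (act y Y2) = 0"
    using adjoint_opsD[OF adj(1) gradedD[OF gr(2) Z(2)] gradedD[OF gr(2) Y2p]] by simp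
  then have "act y Y2 = 0" by (rule std_inner_self_zero)
  then show thesis using that[of "Y - Y2" Y2] Y1p Y2p xY1 by simp
qed

definition ker_leg :: "('n::finite) coeffs \<Rightarrow> nat \<Rightarrow> nat \<Rightarrow> 'n tensors set" where
  "ker_leg T n i = {X \<in> tensor_power n. X + leg T i X = 0}"

definition ker_span :: "('n::finite) coeffs \<Rightarrow> nat \<Rightarrow> nat \<Rightarrow> nat \<Rightarrow> 'n tensors set" where
  "ker_span T n a m = tensor_space.span (\<Union>i\<in>{0<..<m}. ker_leg T n (a + i))"

lemma ker_span_induct [consumes 1, case_names zero add scale gen]:
  assumes "X \<in> ker_span T n a m"
    and "P 0" "\<And>X Y. P X \<Longrightarrow> P Y \<Longrightarrow> P (X + Y)" "\<And>c X. P X \<Longrightarrow> P (smul c X)"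
    and "\<And>i X. 0 < i \<Longrightarrow> i < m \<Longrightarrow> X \<in> ker_leg T n (a + i) \<Longrightarrow> P X"
  shows "P X"
proof -
  have "tensor_space.subspace (Collect P)"
    by (rule tensor_space.subspaceI) (use assms in auto)
  then have "ker_span T n a m \<subseteq> Collect P"
    unfolding ker_span_def by (intro tensor_space.span_minimal) (use assms(5) in auto)
  with assms(1) have "X \<in> Collect P" by blast
  then show ?thesis by simp
qed

lemma ker_span_gen: "0 < i \<Longrightarrow> i < m \<Longrightarrow> X \<in> ker_leg T n (a + i) \<Longrightarrow> X \<in> ker_span T n a m"
  unfolding ker_span_def by (rule tensor_space.span_base) auto

lemma ker_span_subspace: "tensor_space.subspace (ker_span T n a m)"
  unfolding ker_span_def by (rule tensor_space.subspace_span)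

lemma ker_span_zero: "0 \<in> ker_span T n a m"
  and ker_span_add: "X \<in> ker_span T n a m \<Longrightarrow> Y \<in> ker_span T n a m \<Longrightarrow> X + Y \<in> ker_span T n a m"
  and ker_span_smul: "X \<in> ker_span T n a m \<Longrightarrow> smul c X \<in> ker_span T n a m"
  using tensor_space.subspace_0 tensor_space.subspace_add tensor_space.subspace_scale
    ker_span_subspace by blast+

lemma ker_span_power: "ker_span T n a m \<subseteq> tensor_power n"
proof
  fix X assume "X \<in> ker_span T n a m"
  then show "X \<in> tensor_power n"
    by (induction rule: ker_span_induct)
       (auto intro: tensor_power_add tensor_power_smul simp: ker_leg_def)
qed

lemma ker_leg_intertwine:
  assumes "x * leg_op T i = leg_op T j * x" "graded x" "X \<in> ker_leg T n i"
  shows "act x X \<in> ker_leg T n j"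
proof -
  have "act x X + leg T j (act x X) = act x (X + leg T i X)"
    using arg_cong[OF assms(1), of "\<lambda>y. act y X"] by (simp add: act_add)
  then show ?thesis using assms(2,3) by (auto simp: ker_leg_def gradedD)
qed

lemma ker_span_map:
  assumes "X \<in> ker_span T n a m"
    and "\<And>i Y. 0 < i \<Longrightarrow> i < m \<Longrightarrow> Y \<in> ker_leg T n (a + i) \<Longrightarrow> act x Y \<in> ker_span T n b k"
  shows "act x X \<in> ker_span T n b k"
  using assms(1)
  by (induction rule: ker_span_induct)
     (auto simp: act_add act_smul intro: assms(2) ker_span_zero ker_span_add ker_span_smul)

locale braided_contraction =
  fixes T :: "('n::finite) coeffs"
  assumes hermitian: "hermitian_coeffs T" and braided: "braided T"
    and lower: "op_le (\<lambda>X. - X) (leg T 1)" and upper: "op_le (leg T 1) (\<lambda>X. X)"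
begin

sublocale braid_sequence "leg_op T"
  by (rule braid_sequence_leg[OF braided])

lemma graded_run: "graded (run a m)"
  by (induction m) auto

lemma graded_ins: "graded (ins a m)"
  by (induction m) auto

lemma graded_qsym: "graded (qsym a m)"
  by (induction m) (auto simp: graded_ins simp del: ins.simps)

lemma graded_shuf: "graded (shuf a k l)"
  by (induction a k l rule: shuf.induct) (auto intro: graded_run simp del: run.simps)

lemma graded_twist: "graded (twist a m)"
  by (induction m) (auto simp: graded_run)

lemma adjoint_leg: "adjoint_ops (leg_op T i) (leg_op T i)"
  by (auto simp: adjoint_ops_def leg_self_adjoint[OF hermitian])

lemma adjoint_ins_shuf: "adjoint_ops (ins a (Suc n)) (shuf a n (Suc 0))"
proof (induction n)
  case (Suc n)
  show ?case
    unfolding ins.simps(2)[of a "Suc n"] shuf_1_right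
    using adjoint_ops_add[OF adjoint_ops_one adjoint_ops_mult[OF Suc adjoint_leg]] by simp
qed (simp add: adjoint_ops_one)

lemma adjoint_qsym: "adjoint_ops (qsym a n) (qsym a n)"
proof (induction n)
  case (Suc n)
  have "adjoint_ops (ins a (Suc n) * qsym a n) (qsym a n * shuf a n (Suc 0))"
    by (rule adjoint_ops_mult[OF adjoint_ins_shuf Suc])
  then show ?case
    by (simp only: qsym_Suc_back[symmetric] qsym.simps(2)[symmetric])
qed (simp add: adjoint_ops_one)

lemma contraction_run: "X \<in> tensor_power n \<Longrightarrow> nrm2 (act (run a m) X) \<le> nrm2 X"
proof (induction m arbitrary: X)
  case (Suc m)
  then have "nrm2 (act (run a (Suc m)) X) \<le> nrm2 (leg T (Suc (a + m)) X)"
    by (simp add: leg_power)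
  also have "\<dots> \<le> nrm2 X"
    by (rule leg_contraction[OF hermitian lower upper Suc.prems])
  finally show ?case .
qed simp

lemma contraction_twist: "X \<in> tensor_power n \<Longrightarrow> nrm2 (act (twist a m) X) \<le> nrm2 X"
proof (induction m)
  case (Suc m)
  then show ?case
    using contraction_run[OF gradedD[OF graded_twist Suc.prems, of a m], of a m] by simp
qed simp

text \<open>
  The symmetrizer has a factor \<open>1 + T\<^sub>i\<close> on the right for each \<open>i\<close>. The recursion that removes the
  last strand shows this for all \<open>i\<close> but the last. For the last one, the other recursion has the
  smaller symmetrizer on the left, and self-adjointness brings it to the right.
\<close>

lemma qsym_ker_leg:
  "0 < i \<Longrightarrow> i < m \<Longrightarrow> X \<in> ker_leg T n (a + i) \<Longrightarrow> act (qsym a m) X = 0"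
proof (induction m arbitrary: a i)
  case (Suc m)
  have X: "X \<in> tensor_power n" using Suc.prems by (simp add: ker_leg_def)
  show ?case
  proof (cases "i < m")
    case True
    then show ?thesis using Suc by simp
  next
    case False
    then have im: "i = m" using Suc.prems by simp
    show ?thesis
    proof (cases "m = 1")
      case True
      then show ?thesis using Suc.prems im by (simp add: ker_leg_def)
    next
      case False
      have 0: "act (qsym (Suc a) m) X = 0"
        by (rule Suc.IH[of "i - 1"]) (use Suc.prems im False in auto)
      let ?R = "\<Sum>k\<le>m. run a k"
      let ?Z = "act (qsym a (Suc m)) X"
      have Z: "?Z \<in> tensor_power n" by (rule gradedD[OF graded_qsym X])
      have RZ: "act ?R ?Z \<in> tensor_power n"
        unfolding shuf_1_left[symmetric] by (rule gradedD[OF graded_shuf Z])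
      have "std_inner ?Z ?Z = std_inner (act (qsym a (Suc m)) ?Z) X"
        by (rule adjoint_opsD[OF adjoint_qsym Z X, symmetric])
      also have "\<dots> = std_inner (act (qsym (Suc a) m) (act ?R ?Z)) X"
        by (simp only: qsym_Suc_front act_simps)
      also have "\<dots> = 0"
        using adjoint_opsD[OF adjoint_qsym RZ X, of "Suc a" m] 0 by simp
      finally show ?thesis by (rule std_inner_self_zero)
    qed
  qed
qed simp

lemma qsym_ker_span: "X \<in> ker_span T n a m \<Longrightarrow> act (qsym a m) X = 0"
  by (induction rule: ker_span_induct) (auto simp: act_add act_smul intro: qsym_ker_leg)

text \<open>
  If a self-adjoint contraction \<open>t\<close> does not shorten \<open>Z\<close>, then \<open>t\<^sup>2 Z = Z\<close>, and then \<open>Z - t Z\<close> is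
  in the kernel of \<open>1 + t\<close>. If \<open>Z\<close> is orthogonal to this kernel, then the difference is zero.
\<close>

lemma leg_fixes:
  assumes Z: "Z \<in> tensor_power n" "nrm2 Z \<le> nrm2 (leg T i Z)"
    and orth: "\<And>W. W \<in> ker_leg T n i \<Longrightarrow> std_inner W Z = 0"
  shows "leg T i Z = Z"
proof -
  let ?t = "leg T i"
  have tp: "?t Z \<in> tensor_power n" "?t (?t Z) \<in> tensor_power n" using Z by (auto intro: leg_power)
  have sa: "std_inner (?t X) Y = std_inner X (?t Y)"
    if "X \<in> tensor_power n" "Y \<in> tensor_power n" for X Y
    by (rule leg_self_adjoint[OF hermitian that])
  have tm: "?t (X - Y) = ?t X - ?t Y" for X Y
    using act_minus[of "leg_op T i"] by simp
  have "nrm2 (?t (?t Z) - Z) = nrm2 (?t (?t Z)) - 2 * nrm2 (?t Z) + nrm2 Z"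
    unfolding nrm2_def std_inner_minus
    by (simp add: sa[OF Z(1) tp(1), symmetric] sa[OF tp(1) Z(1)])
  also have "nrm2 (?t (?t Z)) \<le> nrm2 (?t Z)"
    by (rule leg_contraction[OF hermitian lower upper tp(1)])
  finally have "?t (?t Z) - Z = 0"
    using Z(2) by (intro nrm2_zero) simp
  then have tt: "?t (?t Z) = Z" by simp
  have "Z - ?t Z \<in> ker_leg T n i"
    using Z(1) tp by (simp add: ker_leg_def tm tt tensor_power_minus)
  from orth[OF this] have "std_inner (Z - ?t Z) (Z - ?t Z) = 0"
    unfolding std_inner_minus
    using sa[OF Z(1) tp(1)] sa[OF Z(1) Z(1)] by (simp add: tt)
  then have "Z - ?t Z = 0" by (rule std_inner_self_zero)
  then show ?thesis by simp
qed

text \<open>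
  As no factor lengthens a vector, the hypothesis on the inner product forces the first factor not
  to shorten \<open>Z\<close>. By \<open>leg_fixes\<close> it fixes \<open>Z\<close>, so that it may be removed from the inner product.
\<close>

lemma run_fixes:
  assumes Z: "Z \<in> tensor_power n" and e: "e * e = (1 :: real)"
  shows "Y \<in> tensor_power n \<Longrightarrow> nrm2 Y \<le> nrm2 Z
    \<Longrightarrow> std_inner Z (act (run a m) Y) = of_real e * std_inner Z Z
    \<Longrightarrow> (\<And>i W. 0 < i \<Longrightarrow> i \<le> m \<Longrightarrow> W \<in> ker_leg T n (a + i) \<Longrightarrow> std_inner W Z = 0)
    \<Longrightarrow> 0 < i \<Longrightarrow> i \<le> m \<Longrightarrow> leg T (a + i) Z = Z"
proof (induction m arbitrary: a i)
  case (Suc m)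
  let ?t = "leg T (Suc a)"
  define Y' where "Y' = act (run (Suc a) m) Y"
  have Y': "Y' \<in> tensor_power n"
    unfolding Y'_def by (rule gradedD[OF graded_run Suc.prems(1)])
  have nY': "nrm2 Y' \<le> nrm2 Z"
    using contraction_run[OF Suc.prems(1), of "Suc a" m] Suc.prems(2) by (simp add: Y'_def)
  have "act (run a (Suc m)) Y = ?t Y'"
    using run_add[of a 1 m] by (simp add: Y'_def del: run.simps) simp
  then have tZ: "std_inner (?t Z) Y' = of_real e * std_inner Z Z"
    using Suc.prems(3) leg_self_adjoint[OF hermitian Z Y', of "Suc a"] by simp
  then have tZ': "std_inner Y' (?t Z) = of_real e * std_inner Z Z"
    using cnj_std_inner[of "?t Z" Y'] cnj_std_inner[of Z Z] by simp
  \<comment> \<open>the equality case of the Cauchy-Schwarz inequality\<close>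
  have "nrm2 (?t Z - smul (of_real e) Y') = nrm2 (?t Z) - 2 * (e * e) * nrm2 Z + (e * e) * nrm2 Y'"
    unfolding nrm2_def std_inner_minus std_inner_smul_left std_inner_smul_right tZ tZ'
    by (simp add: algebra_simps)
  then have "nrm2 Z \<le> nrm2 (?t Z)"
    using nrm2_nonneg[of "?t Z - smul (of_real e) Y'"] nY' e by simp
  then have fix_a: "?t Z = Z"
    using leg_fixes[OF Z] Suc.prems(4)[of 1] by simp
  show ?case
  proof (cases "i = 1")
    case False
    have "leg T (Suc a + (i - 1)) Z = Z"
    proof (rule Suc.IH)
      show "std_inner Z (act (run (Suc a) m) Y) = of_real e * std_inner Z Z"
        using tZ fix_a by (simp add: Y'_def)
      show "std_inner W Z = 0" if "0 < i" "i \<le> m" "W \<in> ker_leg T n (Suc a + i)" for i W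
        using Suc.prems(4)[of "Suc i" W] that by simp
    qed (use Suc.prems False in auto)
    then show ?thesis using Suc.prems by simp
  qed (simp add: fix_a)
qed simp

lemma qsym_fixed:
  assumes "\<And>i. 0 < i \<Longrightarrow> i < m \<Longrightarrow> leg T (a + i) Z = Z"
  shows "act (qsym a m) Z = smul (fact m) Z"
  using assms
proof (induction m)
  case (Suc m)
  have "act (ins a k) Z = smul (of_nat k) Z" if "k \<le> Suc m" for k
    using that
  proof (induction k)
    case (Suc k)
    then show ?case using Suc.prems \<open>\<And>i. 0 < i \<Longrightarrow> i < Suc m \<Longrightarrow> leg T (a + i) Z = Z\<close>[of k]
      by (cases "k = 0") auto
  qed simp
  from this[of "Suc m"] show ?case
    using Suc by (simp add: act_smul algebra_simps del: ins.simps)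
qed simp

text \<open>
  Modulo the span of the kernels of \<open>1 + T\<^sub>i\<close>, the half twist acts as a sign on the kernel of the
  symmetrizer: by \<open>qsym_add\<close> and the induction hypothesis a shuffle sum maps the latter into the
  span, the half twist of the first \<open>k\<close> strands only permutes the kernels, and so only two terms of
  \<open>alternating_twist_shuf\<close> remain. A vector of the kernel that is orthogonal to the span is then
  fixed by all \<open>T\<^sub>i\<close> (\<open>run_fixes\<close>), and the symmetrizer multiplies it by a factorial; so it is zero.
\<close>

theorem qsym_kernel:
  "X \<in> tensor_power n \<Longrightarrow> act (qsym a m) X = 0 \<Longrightarrow> X \<in> ker_span T n a m"
proof (induction m arbitrary: a X rule: less_induct)
  case (less m)
  show ?case
  proof (cases m)
    case 0
    then show ?thesis using less.prems by (simp add: ker_span_zero)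
  next
    case (Suc m')
    obtain Y where Y: "Y \<in> ker_span T n a m"
      "\<And>W. W \<in> ker_span T n a m \<Longrightarrow> std_inner W (X - Y) = 0"
      using orthogonal_decomposition[OF ker_span_subspace ker_span_power] by metis
    define Z where "Z = X - Y"
    have Z: "Z \<in> tensor_power n"
      using less.prems(1) Y(1) ker_span_power tensor_power_minus unfolding Z_def by blast
    have qZ: "act (qsym a m) Z = 0"
      using less.prems(2) qsym_ker_span[OF Y(1)] by (simp add: Z_def act_minus)
    have orth: "std_inner W Z = 0" if "W \<in> ker_span T n a m" for W
      using Y(2) that by (simp add: Z_def)
    have mid: "act (twist a k * shuf a k (m - k)) Z \<in> ker_span T n a m" if k: "0 < k" "k < m" for k
    proof -
      define W where "W = act (shuf a k (m - k)) Z"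
      have W: "W \<in> tensor_power n" unfolding W_def by (rule gradedD[OF graded_shuf Z])
      have "act (qsym a k * qsym (a + k) (m - k)) W = 0"
        using qsym_add[of a k "m - k"] k qZ by (simp add: W_def)
      then obtain W1 W2 where W12: "W = W1 + W2" "W1 \<in> tensor_power n" "W2 \<in> tensor_power n"
        and W1: "act (qsym a k) W1 = 0" and W2: "act (qsym (a + k) (m - k)) W2 = 0"
        using kernel_commuting_product[OF adjoint_qsym adjoint_qsym qsym_commute_disjoint W] by blast
      have "act (twist a k) W1 \<in> ker_span T n a m"
      proof (rule ker_span_map[OF less.IH[OF k(2) W12(2) W1]])
        fix i V assume i: "0 < i" "i < k" and V: "V \<in> ker_leg T n (a + i)"
        have "act (twist a k) V \<in> ker_leg T n (a + (k - i))"
          by (rule ker_leg_intertwine[OF twist_flip[OF i] graded_twist V])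
        then show "act (twist a k) V \<in> ker_span T n a m"
          by (rule ker_span_gen[rotated 2]) (use i k in auto)
      qed
      moreover have "act (twist a k) W2 \<in> ker_span T n a m"
      proof (rule ker_span_map[OF less.IH[OF _ W12(3) W2]])
        fix i V assume i: "0 < i" "i < m - k" and V: "V \<in> ker_leg T n (a + k + i)"
        have "act (twist a k) V \<in> ker_leg T n (a + k + i)"
          by (rule ker_leg_intertwine[OF twist_commute_far[symmetric] graded_twist V]) (use i in simp)
        then have "act (twist a k) V \<in> ker_leg T n (a + (k + i))" by (simp add: add.assoc)
        then show "act (twist a k) V \<in> ker_span T n a m"
          by (rule ker_span_gen[rotated 2]) (use i k in auto)
      qed (use k in simp)
      ultimately show ?thesis
        by (simp add: W_def[symmetric] W12(1) act_add ker_span_add)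
    qed
    define e :: real where "e = - ((- 1) ^ m)"
    have e: "e * e = 1" by (simp add: e_def power_mult_distrib[symmetric])
    define u where "u k = act (twist a k * shuf a k (m - k)) Z" for k
    have sgn: "act ((- 1) ^ k * x) V = smul ((- 1) ^ k) (act x V)" for k x V
    proof -
      have "smul (- 1) V' = - V'" for V' :: "'n tensors"
        by (rule poly_mapping_eqI) (simp add: lookup_smul)
      then show ?thesis by (cases "even k") simp_all
    qed
    have uk: "std_inner Z (u k) = 0" if "0 < k" "k < m" for k
      using orth[OF mid[OF that]] cnj_std_inner[of "u k" Z] by (simp add: u_def)
    have "0 = act (\<Sum>k\<le>m. (- 1) ^ k * (twist a k * shuf a k (m - k))) Z"
      using alternating_twist_shuf[of a m'] by (simp only: Suc act_simps)
    also have "\<dots> = (\<Sum>k\<le>m. smul ((- 1) ^ k) (u k))"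
      unfolding act_sum sgn u_def ..
    finally have "0 = (\<Sum>k\<le>m. (- 1) ^ k * std_inner Z (u k))"
      by (metis (no_types, lifting) std_inner_smul_right std_inner_sum(2) std_inner_zero_right sum.cong)
    also have "\<dots> = (\<Sum>k\<in>{0, m}. (- 1) ^ k * std_inner Z (u k))"
      by (rule sum.mono_neutral_right) (auto simp: uk)
    also have "\<dots> = std_inner Z Z + (- 1) ^ m * std_inner Z (act (twist a m) Z)"
      using Suc by (simp add: u_def)
    finally have "std_inner Z (act (twist a m) Z) = of_real e * std_inner Z Z"
      unfolding e_def by (cases "even m") (simp_all add: add_eq_0_iff)
    then have main: "std_inner Z (act (run a m') (act (twist a m') Z)) = of_real e * std_inner Z Z"
      by (simp add: Suc)
    have "leg T (a + i) Z = Z" if i: "0 < i" "i < m" for i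
    proof (rule run_fixes[OF Z e _ _ main])
      show "act (twist a m') Z \<in> tensor_power n" by (rule gradedD[OF graded_twist Z])
      show "nrm2 (act (twist a m') Z) \<le> nrm2 Z" by (rule contraction_twist[OF Z])
      show "std_inner W Z = 0" if "0 < i" "i \<le> m'" "W \<in> ker_leg T n (a + i)" for i W
        by (rule orth[OF ker_span_gen]) (use that Suc in auto)
    qed (use i Suc in auto)
    then have "smul (fact m) Z = 0" using qsym_fixed[of m a Z] qZ by simp
    then have "smul (1 / fact m) (smul (fact m) Z) = 0" by (simp only: smul_simps)
    then have "Z = 0" by simp
    then show ?thesis using Y(1) by (simp add: Z_def)
  qed
qed

end

section \<open>Ideals of the Wick algebra\<close>

lemma (in ring) idealI_closed:
  assumes "I \<subseteq> carrier R" "\<zero> \<in> I" "\<And>x y. x \<in> I \<Longrightarrow> y \<in> I \<Longrightarrow> x \<oplus> y \<in> I"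
    and l: "\<And>x y. x \<in> I \<Longrightarrow> y \<in> carrier R \<Longrightarrow> y \<otimes> x \<in> I"
    and r: "\<And>x y. x \<in> I \<Longrightarrow> y \<in> carrier R \<Longrightarrow> x \<otimes> y \<in> I"
  shows "ideal I R"
proof (rule idealI[OF ring_axioms _ l r])
  show "subgroup I (add_monoid R)"
  proof (rule add.subgroupI)
    show "\<ominus> x \<in> I" if "x \<in> I" for x
      using l[OF that, of "\<ominus> \<one>"] assms(1) that l_minus[of \<one> x] by auto
  qed (use assms in auto)
qed

lemma wick_class_hom: "wick_class T \<in> ring_hom free_alg (wick_algebra T)"
  using ideal.rcos_ring_hom[OF wick_ideal, of T]
  unfolding wick_algebra_def wick_class_def[abs_def] .

lemma wick_class_add: "wick_class T (x + y) = wick_class T x \<oplus>\<^bsub>wick_algebra T\<^esub> wick_class T y"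
  and wick_class_mult: "wick_class T (x * y) = wick_class T x \<otimes>\<^bsub>wick_algebra T\<^esub> wick_class T y"
  using ring_hom_add[OF wick_class_hom, of x y T] ring_hom_mult[OF wick_class_hom, of x y T] by simp_all

lemma wick_ideal_closed:
  "0 \<in> wick_ideal T" "x \<in> wick_ideal T \<Longrightarrow> y \<in> wick_ideal T \<Longrightarrow> x + y \<in> wick_ideal T"
  "x \<in> wick_ideal T \<Longrightarrow> z * x \<in> wick_ideal T" "x \<in> wick_ideal T \<Longrightarrow> x * z \<in> wick_ideal T"
  using additive_subgroup.zero_closed[OF ideal.axioms(1)[OF wick_ideal[of T]]]
    additive_subgroup.a_closed[OF ideal.axioms(1)[OF wick_ideal[of T]], of x y]
    ideal.I_l_closed[OF wick_ideal[of T], of x z] ideal.I_r_closed[OF wick_ideal[of T], of x z]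
  by simp_all

lemma wick_class_eqI:
  assumes "x - y \<in> wick_ideal T"
  shows "wick_class T x = wick_class T y"
proof -
  have sub: "wick_class T x \<subseteq> wick_class T y" if "x - y \<in> wick_ideal T" for x y
  proof
    fix z assume "z \<in> wick_class T x"
    then obtain i where "i \<in> wick_ideal T" "z = i + x" unfolding wick_class_eq by blast
    then have "i + (x - y) \<in> wick_ideal T" "z = (i + (x - y)) + y"
      using wick_ideal_closed(2) that by auto
    then show "z \<in> wick_class T y" unfolding wick_class_eq by blast
  qed
  have "y - x \<in> wick_ideal T"
    using wick_ideal_closed(3)[OF assms, of "- 1"] by simp
  then show ?thesis using sub assms by blast
qed

lemma wick_class_zero: "wick_class T 0 = \<zero>\<^bsub>wick_algebra T\<^esub>"
  using ring_hom_zero[OF wick_class_hom ring_free_alg ring_wick_algebra, of T] by simp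

definition cre :: "'n tensors \<Rightarrow> 'n free_star" where
  "cre = lin (\<lambda>w. word (map Cre w))"

lemma cre_simps:
  "cre (X + Y) = cre X + cre Y" "cre (X - Y) = cre X - cre Y" "cre (smul c X) = smul c (cre X)"
  "cre 0 = 0" "cre (word w) = word (map Cre w)" "cre (sum f A) = (\<Sum>a\<in>A. cre (f a))"
  by (simp_all add: cre_def lin_add lin_smul lin_sum lin_diff)

lemma cre_mult: "cre (X * Y) = cre X * cre Y"
proof (induction X rule: span_induct)
  case (3 c u)
  have "cre (word u * Y) = word (map Cre u) * cre Y"
    by (induction Y rule: span_induct)
       (simp_all add: cre_simps distrib_left mult_smul_right flip: word_append)
  then show ?case by (simp add: cre_simps smul_mult_left)
qed (simp_all add: cre_simps distrib_right)

lemma cre_one: "cre 1 = 1"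
  using cre_simps(5)[of "[]"] by (simp add: word_Nil)

lemma tensor_to_wick_cre: "tensor_to_wick T X = wick_class T (cre X)"
  by (simp add: tensor_to_wick_def cre_def)

lemma free_action_cre: "free_action T (cre X) Y = X * Y"
proof (induction X rule: span_induct)
  case (3 c u)
  have "word_action T (map Cre u) Y = word u * Y"
  proof (induction u)
    case (Cons i u)
    then show ?case by (simp add: word_Cons[of i u] mult.assoc)
  qed (simp add: word_Nil)
  then show ?case by (simp add: cre_simps free_action_smul_left smul_mult_left)
qed (simp_all add: cre_simps free_action_add_left distrib_right)

subsection \<open>Wick ordering\<close>

text \<open>
  A Wick ordered element has all creators to the left of all annihilators. It is grouped by the
  words of annihilators because their lengths govern the action on tensors of a given degree.
\<close>

definition wick_sum :: "nat \<Rightarrow> (('n::finite) list \<Rightarrow> 'n tensors) \<Rightarrow> 'n free_star" where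
  "wick_sum M y = (\<Sum>v | length v < M. cre (y v) * word (map Ann v))"

lemma finite_words_less: "finite {w :: ('n::finite) list. length w < M}"
proof -
  have "{w :: 'n list. length w < M} = (\<Union>n<M. {w. length w = n})" by auto
  then show ?thesis using finite_words by (metis finite_UN_I finite_lessThan)
qed

definition wick_ordered :: "('n::finite) free_star set" where
  "wick_ordered = {wick_sum M y | M y. \<forall>v. M \<le> length v \<longrightarrow> y v = 0}"

lemma wick_sum_extend:
  "M \<le> N \<Longrightarrow> \<forall>v. M \<le> length v \<longrightarrow> y v = 0 \<Longrightarrow> wick_sum M y = wick_sum N y"
  unfolding wick_sum_def
  by (rule sum.mono_neutral_left) (auto simp: finite_words_less cre_simps)

lemma wick_ordered_add:
  assumes "x \<in> wick_ordered" "x' \<in> wick_ordered"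
  shows "x + x' \<in> wick_ordered"
proof -
  obtain M y M' y' where x: "x = wick_sum M y" "\<forall>v. M \<le> length v \<longrightarrow> y v = 0"
    and x': "x' = wick_sum M' y'" "\<forall>v. M' \<le> length v \<longrightarrow> y' v = 0"
    using assms by (auto simp: wick_ordered_def)
  let ?N = "max M M'"
  have "x + x' = wick_sum ?N y + wick_sum ?N y'"
    using wick_sum_extend[of M ?N y] wick_sum_extend[of M' ?N y'] x x' by simp
  also have "\<dots> = wick_sum ?N (\<lambda>v. y v + y' v)"
    by (simp add: wick_sum_def sum.distrib cre_simps distrib_right)
  finally show ?thesis
    using x(2) x'(2) unfolding wick_ordered_def by (auto intro!: exI[of _ ?N] exI[of _ "\<lambda>v. y v + y' v"])
qed

lemma wick_ordered_monomial: "cre X * word (map Ann v) \<in> wick_ordered"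
proof -
  let ?y = "\<lambda>w. if w = v then X else 0"
  have "wick_sum (Suc (length v)) ?y = (\<Sum>w | length w < Suc (length v). if w = v then cre X * word (map Ann v) else 0)"
    unfolding wick_sum_def by (rule sum.cong) (auto simp: cre_simps)
  also have "\<dots> = cre X * word (map Ann v)"
    by (simp add: sum.delta[OF finite_words_less])
  finally show ?thesis
    unfolding wick_ordered_def by (auto intro!: exI[of _ "Suc (length v)"] exI[of _ ?y])
qed

lemma wick_ordered_zero: "0 \<in> wick_ordered"
  using wick_ordered_monomial[of 0 "[]"] by (simp add: cre_simps)

lemma wick_ordered_cre_mult:
  assumes "x \<in> wick_ordered"
  shows "cre X * x \<in> wick_ordered"
proof -
  obtain M y where x: "x = wick_sum M y" "\<forall>v. M \<le> length v \<longrightarrow> y v = 0"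
    using assms by (auto simp: wick_ordered_def)
  have "cre X * x = wick_sum M (\<lambda>v. X * y v)"
    by (simp add: x wick_sum_def cre_mult sum_distrib_left mult.assoc)
  then show ?thesis
    using x(2) unfolding wick_ordered_def by (auto intro!: exI[of _ M] exI[of _ "\<lambda>v. X * y v"])
qed

definition wick_orderable :: "('n::finite) coeffs \<Rightarrow> 'n free_star set" where
  "wick_orderable T = {x. \<exists>z\<in>wick_ordered. x - z \<in> wick_ideal T}"

lemma wick_orderable_ordered: "x \<in> wick_ordered \<Longrightarrow> x \<in> wick_orderable T"
  using wick_ideal_closed(1) unfolding wick_orderable_def by (metis (mono_tags, lifting) diff_self mem_Collect_eq)

lemma wick_orderable_add:
  assumes "x \<in> wick_orderable T" "y \<in> wick_orderable T"
  shows "x + y \<in> wick_orderable T"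
proof -
  obtain z w where "z \<in> wick_ordered" "x - z \<in> wick_ideal T" "w \<in> wick_ordered" "y - w \<in> wick_ideal T"
    using assms by (auto simp: wick_orderable_def)
  then have "z + w \<in> wick_ordered" "(x + y) - (z + w) \<in> wick_ideal T"
    using wick_ideal_closed(2)[of "x - z" T "y - w"] by (auto intro: wick_ordered_add simp: algebra_simps)
  then show ?thesis unfolding wick_orderable_def by blast
qed

lemma wick_orderable_sum:
  "(\<And>a. a \<in> A \<Longrightarrow> f a \<in> wick_orderable T) \<Longrightarrow> sum f A \<in> wick_orderable T"
  by (induction A rule: infinite_finite_induct)
     (auto intro: wick_orderable_add wick_orderable_ordered wick_ordered_zero)

lemma wick_orderable_cre_mult:
  assumes "x \<in> wick_orderable T"
  shows "cre X * x \<in> wick_orderable T"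
proof -
  obtain z where z: "z \<in> wick_ordered" "x - z \<in> wick_ideal T"
    using assms by (auto simp: wick_orderable_def)
  then have "cre X * x - cre X * z \<in> wick_ideal T"
    using wick_ideal_closed(3)[OF z(2), of "cre X"] by (simp add: right_diff_distrib)
  then show ?thesis
    unfolding wick_orderable_def using wick_ordered_cre_mult[OF z(1)] by blast
qed

lemma wick_orderable_smul:
  assumes "x \<in> wick_orderable T"
  shows "smul c x \<in> wick_orderable T"
  using wick_orderable_cre_mult[OF assms, of "smul c 1"]
  by (simp add: cre_simps cre_one smul_mult_left)

lemma wick_orderable_ideal:
  "x \<in> wick_ideal T \<Longrightarrow> x \<in> wick_orderable T"
  unfolding wick_orderable_def using wick_ordered_zero by (auto intro!: bexI[of _ 0])

lemma wick_relator_in_ideal: "wick_relator T i j \<in> wick_ideal T"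
  unfolding wick_ideal_def by (rule subsetD[OF gen_star_ideal_gen]) blast

text \<open>The defining relations move an annihilator to the right past one creator after another.\<close>

lemma wick_orderable_Ann_monomial:
  "word [Ann i] * (word (map Cre u) * word (map Ann v)) \<in> wick_orderable T"
proof (induction u arbitrary: i)
  case Nil
  have "word [Ann i] * (word (map Cre []) * word (map Ann v)) = cre 1 * word (map Ann (i # v))"
    by (simp add: cre_one word_Nil flip: word_append)
  then show ?case by (simp only: wick_orderable_ordered wick_ordered_monomial)
next
  case (Cons j u)
  define r where "r = word (map Cre u) * word (map Ann v)"
  have IH: "word [Ann k] * r \<in> wick_orderable T" for k
    using Cons unfolding r_def .
  have r: "r \<in> wick_orderable T"
    using wick_ordered_monomial[of "word u" v] unfolding r_def
    by (auto simp: cre_simps intro: wick_orderable_ordered)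
  have "word [Ann i] * (word (map Cre (j # u)) * word (map Ann v)) = word [Ann i] * word [Cre j] * r"
    unfolding r_def by (simp add: mult.assoc flip: word_append)
  also have "\<dots> = wick_relator T i j * r + (if i = j then r else 0)
      + (\<Sum>k\<in>UNIV. \<Sum>l\<in>UNIV. smul (T i j k l) (cre (word [l]) * (word [Ann k] * r)))"
    unfolding wick_relator_def
    by (simp add: left_diff_distrib sum_distrib_right smul_mult_left mult.assoc cre_simps)
  also have "\<dots> \<in> wick_orderable T"
    by (intro wick_orderable_add wick_orderable_sum wick_orderable_smul wick_orderable_cre_mult IH)
       (auto intro: r wick_orderable_ideal wick_ideal_closed(4) wick_relator_in_ideal
         wick_orderable_ordered wick_ordered_zero)
  finally show ?case .
qed

lemma wick_orderable_Ann:
  assumes "x \<in> wick_orderable T"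
  shows "word [Ann i] * x \<in> wick_orderable T"
proof -
  obtain z where z: "z \<in> wick_ordered" "x - z \<in> wick_ideal T"
    using assms by (auto simp: wick_orderable_def)
  have mono: "word [Ann i] * (cre Y * word (map Ann v)) \<in> wick_orderable T" for Y v
  proof (induction Y rule: span_induct)
    case (3 c u)
    then show ?case
      using wick_orderable_smul[OF wick_orderable_Ann_monomial]
      by (simp add: cre_simps smul_mult_left mult_smul_right)
  qed (auto simp: cre_simps distrib_left distrib_right
      intro: wick_orderable_add wick_orderable_ordered wick_ordered_zero)
  obtain M y where zy: "z = wick_sum M y" using z(1) by (auto simp: wick_ordered_def)
  have "word [Ann i] * z \<in> wick_orderable T"
    unfolding zy wick_sum_def sum_distrib_left by (intro wick_orderable_sum mono)
  moreover have "word [Ann i] * (x - z) \<in> wick_orderable T"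
    by (intro wick_orderable_ideal wick_ideal_closed(3) z)
  ultimately have "word [Ann i] * z + word [Ann i] * (x - z) \<in> wick_orderable T"
    by (rule wick_orderable_add)
  then show ?thesis by (simp add: right_diff_distrib)
qed

lemma all_wick_orderable: "x \<in> wick_orderable T"
proof (induction x rule: span_induct)
  case (3 c w)
  have "word w \<in> wick_orderable T"
  proof (induction w)
    case Nil
    have "cre 1 * word (map Ann []) \<in> wick_orderable T"
      by (rule wick_orderable_ordered[OF wick_ordered_monomial])
    then show ?case by (simp add: cre_one word_Nil)
  next
    case (Cons g w)
    have "word [g] * word w \<in> wick_orderable T"
      using wick_orderable_Ann[OF Cons] wick_orderable_cre_mult[OF Cons, of "word [i]" for i]
      by (cases g) (auto simp: cre_simps)
    then show ?case by (simp only: word_Cons[of g w])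
  qed
  then show ?case by (rule wick_orderable_smul)
qed (auto intro: wick_orderable_add wick_orderable_ordered wick_ordered_zero)

subsection \<open>Annihilators on tensors\<close>

lemma word_action_Ann_power:
  "X \<in> tensor_power m \<Longrightarrow> word_action T (map Ann v) X \<in> tensor_power (m - length v)"
proof (induction v)
  case (Cons i v)
  have "lin (\<lambda>w. ann_basis T w i) (word_action T (map Ann v) X) \<in> tensor_power (m - length v - 1)"
    by (rule tensor_power_lin[OF Cons.IH[OF Cons.prems]]) (use ann_basis_power in metis)
  then show ?case by simp
qed simp

lemma tensor_power_0: "X \<in> tensor_power 0 \<Longrightarrow> X = smul (Poly_Mapping.lookup X []) 1"
proof (induction X rule: tensor_power_induct)
  case (3 c w)
  then show ?case by (simp add: word_Nil lookup_smul) (simp add: lookup_one flip: zero_list_def)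
qed (simp_all add: lookup_add)

lemma word_action_Ann_kill:
  assumes "X \<in> tensor_power m" "m < length v"
  shows "word_action T (map Ann v) X = 0"
proof -
  obtain i w where v: "v = i # w" "m \<le> length w" using assms(2) by (cases v) auto
  have "word_action T (map Ann w) X \<in> tensor_power 0"
    using word_action_Ann_power[OF assms(1), of T w] v by simp
  then obtain c where "word_action T (map Ann w) X = smul c (word [])"
    using tensor_power_0 by (metis word_Nil)
  then show ?thesis by (simp only: v list.map word_action.simps letter_action.simps lin_smul lin_word) simp
qed

lemma fock_form_word_action_Ann:
  "fock_form T Y (word_action T (map Ann v) X) = fock_form T (word (rev v) * Y) X"
proof (induction v arbitrary: Y)
  case (Cons i v)
  have "fock_form T Y (word_action T (map Ann (i # v)) X)
      = fock_form T (word [i] * Y) (word_action T (map Ann v) X)"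
    using fock_form_adjoint[of T i Y] by simp
  also have "\<dots> = fock_form T (word (rev (i # v)) * Y) X"
    by (simp add: Cons mult.assoc word_append)
  finally show ?case .
qed (simp add: word_Nil)

text \<open>
  The result is a multiple of the vacuum, found by moving the annihilators to the other side of
  the Fock inner product.
\<close>

lemma word_action_Ann_vacuum:
  assumes "X \<in> tensor_power (length v)"
  shows "word_action T (map Ann v) X
    = smul (Poly_Mapping.lookup (P_op T (length v) X) (rev v)) 1"
proof -
  have "word_action T (map Ann v) X \<in> tensor_power 0"
    using word_action_Ann_power[OF assms, of T v] by simp
  then obtain c where c: "word_action T (map Ann v) X = smul c 1"
    using tensor_power_0 by blast
  have "c = fock_form T 1 (word_action T (map Ann v) X)"
    by (simp add: c fock_form_smul_right fock_form_vac)
  also have "\<dots> = fock_form T (word (rev v)) X"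
    by (simp add: fock_form_word_action_Ann)
  also have "\<dots> = Poly_Mapping.lookup (P_op T (length v) X) (rev v)"
    using P_total_power[OF assms, of T]
    by (simp add: fock_form_def std_inner_word flip: P_total_def)
  finally show ?thesis using c by simp
qed

section \<open>The kernel of the Fock representation\<close>

lemma tensor_power_slices:
  fixes X :: "('n::finite) tensors"
  assumes "X \<in> tensor_power (p + (2 + q))"
  shows "X = (\<Sum>u | length u = p. \<Sum>v | length v = q. word u * slice u v X * word v)"
proof -
  have "X = (\<Sum>w | length w = p + (2 + q). smul (Poly_Mapping.lookup X w) (word w))"
    using lin_superset[of "{w. length w = p + (2 + q)}" X word] assms words_span[of X] finite_words
    by (auto simp: tensor_power_def lin_def)
  also have "\<dots> = (\<Sum>u | length u = p. \<Sum>v | length v = q. word u * slice u v X * word v)"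
    by (simp add: sum_words_slices slice_def sum_distrib_left sum_distrib_right mult_smul_right
        smul_mult_left del: add_2_eq_Suc add_2_eq_Suc' flip: word_append)
  finally show ?thesis .
qed

lemma slice_add: "slice u v (X + Y) = slice u v X + slice u v Y"
  by (simp add: slice_def lookup_add sum.distrib)

lemma slice_zero: "slice u v 0 = 0"
  by (simp add: slice_def)

lemma slice_ker_leg:
  assumes "X \<in> ker_leg T n (Suc (length u))"
  shows "slice u v X \<in> ker_one_plus T"
proof -
  have "slice u v (X + leg T (Suc (length u)) X) = 0"
    using assms by (simp add: ker_leg_def slice_zero)
  then show ?thesis
    by (simp add: ker_one_plus_def slice_power slice_add slice_leg)
qed

text \<open>Pulled back to the free algebra, where one can compute with representatives.\<close>

definition ker_ideal :: "('n::finite) coeffs \<Rightarrow> 'n free_star set" where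
  "ker_ideal T = {x. wick_class T x
     \<in> gen_star_ideal (wick_algebra T) wick_star (tensor_to_wick T ` ker_one_plus T)}"

lemma ideal_gen_ker:
  "ideal (gen_star_ideal (wick_algebra T) wick_star (tensor_to_wick T ` ker_one_plus T)) (wick_algebra T)"
  by (rule gen_star_ideal_wick_algebra) (auto simp: tensor_to_wick_def carrier_wick_algebra)

lemma ker_ideal_closed:
  "0 \<in> ker_ideal T" "x \<in> ker_ideal T \<Longrightarrow> y \<in> ker_ideal T \<Longrightarrow> x + y \<in> ker_ideal T"
  "x \<in> ker_ideal T \<Longrightarrow> z * x \<in> ker_ideal T" "x \<in> ker_ideal T \<Longrightarrow> x * z \<in> ker_ideal T"
  "x \<in> ker_ideal T \<Longrightarrow> star x \<in> ker_ideal T"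
  "x \<in> ker_ideal T \<Longrightarrow> x - y \<in> wick_ideal T \<Longrightarrow> y \<in> ker_ideal T"
proof -
  interpret ideal "gen_star_ideal (wick_algebra T) wick_star (tensor_to_wick T ` ker_one_plus T)" "wick_algebra T"
    by (rule ideal_gen_ker)
  have c: "wick_class T z \<in> carrier (wick_algebra T)" for z
    by (simp add: carrier_wick_algebra)
  show "0 \<in> ker_ideal T" by (simp add: ker_ideal_def wick_class_zero)
  show "x \<in> ker_ideal T \<Longrightarrow> y \<in> ker_ideal T \<Longrightarrow> x + y \<in> ker_ideal T"
    by (simp add: ker_ideal_def wick_class_add a_closed)
  show "x \<in> ker_ideal T \<Longrightarrow> z * x \<in> ker_ideal T" "x \<in> ker_ideal T \<Longrightarrow> x * z \<in> ker_ideal T"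
    by (simp_all add: ker_ideal_def wick_class_mult I_l_closed I_r_closed c)
  show "x \<in> ker_ideal T \<Longrightarrow> star x \<in> ker_ideal T"
    using gen_star_ideal_closed[of "wick_class T x" "wick_algebra T" wick_star]
    by (simp add: ker_ideal_def flip: wick_star_class)
  show "x \<in> ker_ideal T \<Longrightarrow> x - y \<in> wick_ideal T \<Longrightarrow> y \<in> ker_ideal T"
    using wick_class_eqI[of x y T] by (simp add: ker_ideal_def)
qed

lemma ker_ideal_sum: "(\<And>a. a \<in> A \<Longrightarrow> f a \<in> ker_ideal T) \<Longrightarrow> sum f A \<in> ker_ideal T"
  by (induction A rule: infinite_finite_induct) (auto intro: ker_ideal_closed)

lemma ker_ideal_smul: "x \<in> ker_ideal T \<Longrightarrow> smul c x \<in> ker_ideal T"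
  unfolding smul_def by (rule ker_ideal_closed(3))

lemma ker_ideal_gen: "X \<in> ker_one_plus T \<Longrightarrow> cre X \<in> ker_ideal T"
  using gen_star_ideal_gen[of "tensor_to_wick T ` ker_one_plus T"]
  by (auto simp: ker_ideal_def tensor_to_wick_cre)

text \<open>
  A tensor in the kernel of \<open>1 + T\<^sub>i\<close> is a sum of products \<open>u \<otimes> X \<otimes> v\<close> with \<open>X\<close> in \<open>ker (1 + T)\<close>.
\<close>

lemma cre_ker_leg:
  assumes "X \<in> ker_leg T n i" "0 < i" "i < n"
  shows "cre X \<in> ker_ideal T"
proof -
  obtain p where p: "i = Suc p" using assms(2) by (cases i) auto
  obtain q where n: "n = p + (2 + q)" using assms(3) p less_iff_Suc_add[of i n] by auto
  have X: "X \<in> tensor_power (p + (2 + q))" using assms(1) n by (simp add: ker_leg_def)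
  have "cre (\<Sum>u | length u = p. \<Sum>v | length v = q. word u * slice u v X * word v) \<in> ker_ideal T"
    using assms(1) unfolding cre_simps cre_mult p
    by (intro ker_ideal_sum ker_ideal_closed(3,4) ker_ideal_gen) (simp add: slice_ker_leg)
  then show ?thesis using tensor_power_slices[OF X] by simp
qed

lemma homog_sum: "X = (\<Sum>n\<in>length ` Poly_Mapping.keys X. homog n X)"
proof (rule poly_mapping_eqI)
  fix w
  have "Poly_Mapping.lookup (\<Sum>n\<in>length ` Poly_Mapping.keys X. homog n X) w
      = (\<Sum>n\<in>length ` Poly_Mapping.keys X. if n = length w then Poly_Mapping.lookup X w else 0)"
    unfolding lookup_sum lookup_homog by (intro sum.cong) auto
  also have "\<dots> = Poly_Mapping.lookup X w"
    by (auto simp: sum.delta in_keys_iff image_iff)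
  finally show "Poly_Mapping.lookup X w = Poly_Mapping.lookup (\<Sum>n\<in>length ` Poly_Mapping.keys X. homog n X) w"
    by simp
qed

lemma kernel_fock_null:
  assumes "X \<in> tensor_power n" "P_op T n X = 0"
  shows "X \<in> fock_null T"
proof -
  have "P_total T X = 0" using P_total_power[OF assms(1)] assms(2) by simp
  then show ?thesis by (simp add: fock_null_iff fock_form_def P_total_def)
qed

lemma fock_null_minus: "X \<in> fock_null T \<Longrightarrow> Y \<in> fock_null T \<Longrightarrow> X - Y \<in> fock_null T"
  by (simp add: fock_null_iff fock_form_def lin_diff std_inner_minus)

lemma fock_form_free_action_star:
  "fock_form T (free_action T (star x) X) Y = fock_form T X (free_action T x Y)"
  if "hermitian_coeffs T"
proof (induction x arbitrary: X rule: span_induct)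
  case (3 c w)
  have letter: "fock_form T (letter_action T (adj g) X) Y = fock_form T X (letter_action T g Y)" for g X Y
  proof (cases g)
    case (Cre i)
    then show ?thesis
      using fock_form_adjoint[of T i Y X] fock_form_hermitian[OF that] by (metis adj.simps(1))
  qed (simp only: adj.simps fock_form_adjoint)
  have "fock_form T (word_action T (rev (map adj w)) X) Y = fock_form T X (word_action T w Y)"
    by (induction w arbitrary: X Y) (simp_all add: word_action_append letter)
  then show ?case
    by (simp add: star_smul free_action_smul_left fock_form_smul_left fock_form_smul_right)
qed (simp_all add: star_add free_action_add_left fock_form_add_left fock_form_add_right)

lemma wick_class_fock_kernel:
  assumes "hermitian_coeffs T"
  shows "wick_class T x \<in> fock_kernel T \<longleftrightarrow> (\<forall>X. free_action T x X \<in> fock_null T)"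
  unfolding fock_kernel_eq[OF assms] by (simp add: fock_action_class[OF assms] carrier_wick_algebra)

lemma ideal_fock_kernel:
  assumes "hermitian_coeffs T"
  shows "ideal (fock_kernel T) (wick_algebra T)"
proof (rule ring.idealI_closed[OF ring_wick_algebra])
  have sub: "fock_kernel T \<subseteq> range (wick_class T)"
    by (auto simp: fock_kernel_def carrier_wick_algebra)
  note k = wick_class_fock_kernel[OF assms]
  show "fock_kernel T \<subseteq> carrier (wick_algebra T)" by (auto simp: fock_kernel_def)
  show "\<zero>\<^bsub>wick_algebra T\<^esub> \<in> fock_kernel T"
    by (simp add: wick_class_zero[symmetric] k fock_null_zero)
  fix A B assume A: "A \<in> fock_kernel T"
  then obtain x where x: "A = wick_class T x" using sub by blast
  show "A \<oplus>\<^bsub>wick_algebra T\<^esub> B \<in> fock_kernel T" if B: "B \<in> fock_kernel T"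
  proof -
    obtain y where y: "B = wick_class T y" using sub B by blast
    show ?thesis using A B
      by (simp add: x y wick_class_add[symmetric] k free_action_add_left fock_null_add)
  qed
  assume "B \<in> carrier (wick_algebra T)"
  then obtain y where y: "B = wick_class T y" by (auto simp: carrier_wick_algebra)
  show "B \<otimes>\<^bsub>wick_algebra T\<^esub> A \<in> fock_kernel T" "A \<otimes>\<^bsub>wick_algebra T\<^esub> B \<in> fock_kernel T"
    using A by (simp_all add: x y wick_class_mult[symmetric] k free_action_mult
        fock_null_free_action[OF assms])
qed

lemma fock_kernel_star:
  assumes "hermitian_coeffs T"
  shows "wick_star ` fock_kernel T \<subseteq> fock_kernel T"
proof
  fix B assume "B \<in> wick_star ` fock_kernel T"
  then obtain A where B: "B = wick_star A" and A: "A \<in> fock_kernel T" by blast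
  then obtain x where x: "A = wick_class T x" by (auto simp: fock_kernel_def carrier_wick_algebra)
  have "fock_form T Y (free_action T (star x) X) = 0" for X Y
  proof -
    have "fock_form T (free_action T x Y) X = fock_form T Y (free_action T (star x) X)"
      using fock_form_free_action_star[OF assms, of "star x" Y X] by simp
    moreover have "fock_form T X (free_action T x Y) = 0"
      using A unfolding x wick_class_fock_kernel[OF assms] fock_null_iff by blast
    ultimately show ?thesis using fock_form_hermitian[OF assms, of X "free_action T x Y"] by simp
  qed
  then show "B \<in> fock_kernel T"
    by (simp add: B x wick_star_class wick_class_fock_kernel[OF assms] fock_null_iff)
qed

context braided_contraction
begin

lemma cre_fock_null:
  assumes "X \<in> fock_null T"
  shows "cre X \<in> ker_ideal T"
proof -
  have "cre (homog n X) \<in> ker_ideal T" for n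
  proof (cases "n < 2")
    case True
    then have "homog n X = 0"
      using assms by (auto simp: fock_null_def less_2_cases_iff)
    then show ?thesis by (simp add: cre_simps ker_ideal_closed)
  next
    case False
    then have "act (qsym 0 n) (homog n X) = 0"
      using assms P_op_qsym[OF braided homog_power, of n X] by (simp add: fock_null_def)
    then have "homog n X \<in> ker_span T n 0 n"
      by (rule qsym_kernel[OF homog_power])
    then show ?thesis
      by (induction rule: ker_span_induct)
         (auto simp: cre_simps intro: ker_ideal_closed ker_ideal_smul cre_ker_leg)
  qed
  then have "cre (\<Sum>n\<in>length ` Poly_Mapping.keys X. homog n X) \<in> ker_ideal T"
    unfolding cre_simps by (intro ker_ideal_sum)
  then show ?thesis by (simp flip: homog_sum)
qed

lemma ker_one_plus_fock_null:
  assumes "X \<in> ker_one_plus T"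
  shows "X * Y \<in> fock_null T"
proof (induction Y rule: span_induct)
  case (3 c w)
  have X: "X \<in> tensor_power 2" "X + leg T 1 X = 0" using assms by (auto simp: ker_one_plus_def)
  have p: "X * word w \<in> tensor_power (2 + length w)"
    using X(1)
  proof (induction X rule: tensor_power_induct)
    case (3 c u)
    then show ?case
      by (simp add: smul_mult_left tensor_power_smul tensor_power_word flip: word_append)
  qed (simp_all add: distrib_right tensor_power_add)
  have "X * word w + leg T 1 (X * word w) = (X + leg T 1 X) * word w"
    using leg_append[OF X(1), of 1] by (simp add: distrib_right)
  then have "X * word w \<in> ker_leg T (2 + length w) (0 + 1)"
    using X p by (simp add: ker_leg_def)
  then have "act (qsym 0 (2 + length w)) (X * word w) = 0"
    by (rule qsym_ker_leg[rotated 2]) simp_all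
  then have "X * word w \<in> fock_null T"
    using kernel_fock_null[OF p] P_op_qsym[OF braided p] by simp
  then show ?case by (simp add: mult_smul_right fock_null_smul)
qed (simp_all add: distrib_left fock_null_add fock_null_zero)

lemma gen_ker_subset_fock_kernel:
  "gen_star_ideal (wick_algebra T) wick_star (tensor_to_wick T ` ker_one_plus T) \<subseteq> fock_kernel T"
  by (rule gen_star_ideal_least[OF ideal_fock_kernel[OF hermitian] fock_kernel_star[OF hermitian]])
     (auto simp: tensor_to_wick_cre wick_class_fock_kernel[OF hermitian] free_action_cre
       ker_one_plus_fock_null)

lemma adjoint_P_op:
  assumes "X \<in> tensor_power n" "Y \<in> tensor_power n"
  shows "std_inner (P_op T n X) Y = std_inner X (P_op T n Y)"
  using adjoint_opsD[OF adjoint_qsym assms] assms by (simp add: P_op_qsym[OF braided])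

text \<open>
  The basis vector \<open>word u\<close> is split into its component \<open>Q u\<close> in the range of \<open>P\<^sub>n\<close> and a component
  in the kernel of \<open>P\<^sub>n\<close>, whose adjoint lies in the ideal. As the matrix of \<open>Q\<close> is hermitian, it can
  be moved to the creators, and the hypothesis applies to its columns.
\<close>

lemma wick_level_ker_ideal:
  fixes z :: "'n list \<Rightarrow> 'n tensors"
  assumes "\<And>X. X \<in> tensor_power n \<Longrightarrow>
    (\<Sum>u | length u = n. smul (Poly_Mapping.lookup (P_op T n X) u) (z u)) \<in> fock_null T"
  shows "(\<Sum>u | length u = n. cre (z u) * star (cre (word u))) \<in> ker_ideal T"
proof -
  let ?W = "{u :: 'n list. length u = n}"
  let ?S = "P_op T n ` tensor_power n"
  have "tensor_space.subspace ?S"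
    by (rule subspace_image_tensor_power) (simp_all add: P_op_add P_op_smul)
  moreover have S: "?S \<subseteq> tensor_power n" using P_op_power by blast
  ultimately have "\<forall>u. \<exists>Y\<in>?S. \<forall>Z\<in>?S. std_inner Z (word u - Y) = 0"
    using orthogonal_decomposition by blast
  then obtain Q where Q: "\<And>u. Q u \<in> ?S" "\<And>u Z. Z \<in> ?S \<Longrightarrow> std_inner Z (word u - Q u) = 0"
    by metis
  have Qp: "Q u \<in> tensor_power n" for u using Q(1) S by blast
  have k: "word u - Q u \<in> fock_null T" if "length u = n" for u
  proof (rule kernel_fock_null)
    show p: "word u - Q u \<in> tensor_power n"
      by (rule tensor_power_minus[OF tensor_power_word[OF that] Qp])
    have "std_inner (P_op T n (P_op T n (word u - Q u))) (word u - Q u) = 0"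
      by (rule Q(2)) (use P_op_power[OF p] in blast)
    then show "P_op T n (word u - Q u) = 0"
      using adjoint_P_op[OF P_op_power[OF p] p] by (simp add: std_inner_self_zero)
  qed
  have Q_herm: "cnj (Poly_Mapping.lookup (Q u) w) = Poly_Mapping.lookup (Q w) u" for u w
  proof -
    have "Poly_Mapping.lookup (Q u) w = std_inner (Q w) (Q u)" for u w
      using Q(2)[OF Q(1)[of u], of w] cnj_std_inner[of "Q u" "word w"] cnj_std_inner[of "Q u" "Q w"]
      by (simp add: std_inner_minus flip: std_inner_word)
    then show ?thesis by (simp add: cnj_std_inner)
  qed
  have Q_sum: "Q u = (\<Sum>w\<in>?W. smul (Poly_Mapping.lookup (Q u) w) (word w))" for u
    using lin_superset[of ?W "Q u" word] Qp[of u] words_span[of "Q u"] finite_words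
    by (auto simp: tensor_power_def lin_def)
  have "(\<Sum>u\<in>?W. cre (z u) * star (cre (Q u)))
      = (\<Sum>u\<in>?W. \<Sum>w\<in>?W. smul (Poly_Mapping.lookup (Q w) u) (cre (z u) * star (cre (word w))))"
    by (subst Q_sum) (simp only: cre_simps star_sum star_smul Q_herm sum_distrib_left mult_smul_right)
  also have "\<dots> = (\<Sum>w\<in>?W. cre (\<Sum>u\<in>?W. smul (Poly_Mapping.lookup (Q w) u) (z u)) * star (cre (word w)))"
    by (subst sum.swap) (simp only: cre_simps sum_distrib_right smul_mult_left)
  also have "\<dots> \<in> ker_ideal T"
  proof (intro ker_ideal_sum ker_ideal_closed(4) cre_fock_null)
    fix w
    obtain X where "Q w = P_op T n X" "X \<in> tensor_power n" using Q(1)[of w] by blast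
    then show "(\<Sum>u\<in>?W. smul (Poly_Mapping.lookup (Q w) u) (z u)) \<in> fock_null T"
      using assms by simp
  qed
  finally have 1: "(\<Sum>u\<in>?W. cre (z u) * star (cre (Q u))) \<in> ker_ideal T" .
  have 2: "(\<Sum>u\<in>?W. cre (z u) * star (cre (word u - Q u))) \<in> ker_ideal T"
    by (intro ker_ideal_sum ker_ideal_closed(3,5) cre_fock_null k) simp
  have "(\<Sum>u\<in>?W. cre (z u) * star (cre (word u)))
      = (\<Sum>u\<in>?W. cre (z u) * star (cre (Q u))) + (\<Sum>u\<in>?W. cre (z u) * star (cre (word u - Q u)))"
    by (simp add: sum.distrib[symmetric] distrib_left[symmetric] star_add[symmetric] cre_simps(1)[symmetric])
  then show ?thesis using ker_ideal_closed(2)[OF 1 2] by simp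
qed

lemma ker_ideal_free_action: "x \<in> ker_ideal T \<Longrightarrow> free_action T x X \<in> fock_null T"
  using gen_ker_subset_fock_kernel wick_class_fock_kernel[OF hermitian] by (auto simp: ker_ideal_def)

text \<open>
  On tensors of degree \<open>n\<close> the terms with more than \<open>n\<close> annihilators vanish. So the terms with
  exactly \<open>n\<close> annihilators satisfy the hypothesis of \<open>wick_level_ker_ideal\<close> and can be subtracted.
\<close>

lemma wick_sum_ker_ideal:
  fixes y :: "'n list \<Rightarrow> 'n tensors"
  assumes "\<And>X. free_action T (\<Sum>v | n \<le> length v \<and> length v < M. cre (y v) * word (map Ann v)) X \<in> fock_null T"
  shows "(\<Sum>v | n \<le> length v \<and> length v < M. cre (y v) * word (map Ann v)) \<in> ker_ideal T"
  using assms
proof (induction "M - n" arbitrary: n)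
  case 0
  then have "{v :: 'n list. n \<le> length v \<and> length v < M} = {}" by auto
  then show ?case by (simp only: sum.empty ker_ideal_closed)
next
  case (Suc d)
  let ?g = "\<lambda>v. cre (y v) * word (map Ann v)"
  let ?lo = "\<Sum>v | length v = n. ?g v" and ?hi = "\<Sum>v | Suc n \<le> length v \<and> length v < M. ?g v"
  have "{v :: 'n list. n \<le> length v \<and> length v < M}
      = {v. length v = n} \<union> {v. Suc n \<le> length v \<and> length v < M}"
    using Suc.hyps(2) by auto
  moreover have "finite {v :: 'n list. Suc n \<le> length v \<and> length v < M}"
    by (rule finite_subset[OF _ finite_words_less[of M]]) auto
  ultimately have split: "(\<Sum>v | n \<le> length v \<and> length v < M. ?g v) = ?lo + ?hi"
    by (simp only:) (rule sum.union_disjoint, auto simp: finite_words)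
  have lo: "?lo \<in> ker_ideal T"
  proof -
    have "(\<Sum>u | length u = n. smul (Poly_Mapping.lookup (P_op T n X) u) (y (rev u))) \<in> fock_null T"
      if X: "X \<in> tensor_power n" for X
    proof -
      have hi: "free_action T ?hi X = 0"
        by (auto simp: free_action_sum_left free_action_mult word_action_Ann_kill[OF X] intro!: sum.neutral)
      have "free_action T ?lo X
          = (\<Sum>v | length v = n. smul (Poly_Mapping.lookup (P_op T n X) (rev v)) (y v))"
        unfolding free_action_sum_left
        by (rule sum.cong) (use X in \<open>auto simp: free_action_mult word_action_Ann_vacuum
              free_action_smul free_action_cre\<close>)
      also have "\<dots> = (\<Sum>u | length u = n. smul (Poly_Mapping.lookup (P_op T n X) u) (y (rev u)))"
        by (rule sum.reindex_bij_witness[of _ rev rev]) auto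
      finally show ?thesis using Suc.prems[of X] by (simp add: split free_action_add_left hi)
    qed
    then have "(\<Sum>u | length u = n. cre (y (rev u)) * star (cre (word u))) \<in> ker_ideal T"
      by (rule wick_level_ker_ideal)
    also have "(\<Sum>u | length u = n. cre (y (rev u)) * star (cre (word u))) = ?lo"
      by (rule sum.reindex_bij_witness[of _ rev rev]) (auto simp: cre_simps rev_map comp_def)
    finally show ?thesis .
  qed
  have "free_action T ?hi X \<in> fock_null T" for X
    using fock_null_minus[OF Suc.prems[of X] ker_ideal_free_action[OF lo, of X]]
    by (simp add: split free_action_add_left)
  then have "?hi \<in> ker_ideal T"
    using Suc.hyps(1)[of "Suc n"] Suc.hyps(2) by simp
  then show ?case unfolding split using lo by (rule ker_ideal_closed(2)[rotated])
qed

lemma fock_kernel_subset_gen_ker: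
  "fock_kernel T \<subseteq> gen_star_ideal (wick_algebra T) wick_star (tensor_to_wick T ` ker_one_plus T)"
proof
  fix A assume A: "A \<in> fock_kernel T"
  then obtain x where x: "A = wick_class T x" by (auto simp: fock_kernel_def carrier_wick_algebra)
  obtain M y where xy: "x - wick_sum M y \<in> wick_ideal T"
    using all_wick_orderable[of x T] by (auto simp: wick_orderable_def wick_ordered_def)
  have A': "A = wick_class T (wick_sum M y)"
    using wick_class_eqI[OF xy] x by simp
  then have "free_action T (wick_sum M y) X \<in> fock_null T" for X
    using A wick_class_fock_kernel[OF hermitian] by simp
  then have "wick_sum M y \<in> ker_ideal T"
    using wick_sum_ker_ideal[where n = 0 and M = M and y = y] by (simp add: wick_sum_def)
  then show "A \<in> gen_star_ideal (wick_algebra T) wick_star (tensor_to_wick T ` ker_one_plus T)"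
    by (simp add: A' ker_ideal_def)
qed

end

theorem theorem5:
  fixes T :: "'n::finite \<Rightarrow> 'n \<Rightarrow> 'n \<Rightarrow> 'n \<Rightarrow> complex"
  assumes hermitian: "hermitian_coeffs T"
    and braid: "braided T"
    and lower: "op_le (\<lambda>X. - X) (leg T 1)"
    and upper: "op_le (leg T 1) (\<lambda>X. X)"
  shows "fock_kernel T =
    gen_star_ideal (wick_algebra T) wick_star (tensor_to_wick T ` ker_one_plus T)"
proof -
  interpret braided_contraction T
    using assms by unfold_locales
  show ?thesis
    using gen_ker_subset_fock_kernel fock_kernel_subset_gen_ker by (rule subset_antisym[rotated])
qed

end
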